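(* Let $H$ be a nontrivial $D$-generated subgroup of $G$. Then $$\dim_{\mathrm{Krull}}\gamma(H)=\Omega(D_H)+1.$$
   Context: Setup: $G$ is a finite group, $D$ is a nonempty set of nontrivial conjugacy classes of $G$, $\xi:D\to\mathbb{Z}_{>0}$ is a map, $|\xi|=\sum_{\gamma\in D}\xi(\gamma)$, and $k$ is a field whose characteristic does not divide $|G|$. The Artin braid group $\mathrm{B}_n$ (standard generators $\sigma_1,\dots,\sigma_{n-1}$) acts on $G^n$ by the Hurwitz action: $\sigma_i$ replaces the entries $(g_i,g_{i+1})$ in positions $i,i+1$ by $(g_ig_{i+1}g_i^{-1},g_i)$ and fixes the other entries. The product $g_1\cdots g_n$ and the subgroup $\langle g_1,\dots,g_n\rangle$ of $G$ are invariant under this action. A component of degree $n$ is an orbit, under $\mathrm{B}_{n|\xi|}$, of a tuple $(g_1,\dots,g_{n|\xi|})\in G^{n|\xi|}$ with $g_1\cdots g_{n|\xi|}=1$ and such that exactly $n\,\xi(\gamma)$ entries belong to $\gamma$, for each $\gamma\in D$. The group $\langle m\rangle$ of a component $m$ is the subgroup of $G$ generated by the entries of a representing tuple. Components of all degrees $n\ge 0$ form, under concatenation, a commutative finitely generated graded monoid $\mathrm{Comp}$, with identity the orbit of the empty tuple. The ring of components is the monoid ring $R=k[\mathrm{Comp}]$, a finitely generated commutative graded $k$-algebra. For a subgroup $H\subseteq G$: $I_H$ (resp. $I_H^*$) is the homogeneous ideal of $R$ spanned over $k$ by the components whose group contains $H$ (resp. properly contains $H$). For an ideal $I$ of $R$,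 $V(I)\subseteq\operatorname{Spec}R$ is the closed set of prime ideals containing $I$. The stratum associated to $H$ is $\gamma(H)=V(I_H^* )\setminus V(I_H)$, with the subspace topology; $\dim_{\mathrm{Krull}}$ denotes the Krull dimension of this topological space. A subgroup $H$ of $G$ is $D$-generated if the sets $\gamma\cap H$ ($\gamma\in D$) are all nonempty and collectively generate $H$. Put $D_H=\{\gamma\cap H:\gamma\in D\}$, $c_H=\bigsqcup_{\gamma\in D}(\gamma\cap H)$, and let $D_H^*$ be the set of conjugacy classes of $H$ contained in $c_H$. The splitting number of $H$ is $\Omega(D_H)=|D_H^*|-|D_H|$. *)

theory Defs
  imports
    "HOL-Algebra.Group_Action"
    "HOL-Algebra.Generated_Groups"
    "HOL-Algebra.Multiplicative_Group"
    "HOL-Algebra.Ideal"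
    "HOL-Analysis.Abstract_Topology"
    "HOL-Library.Extended_Real"
begin

text \<open>
  The letter \<open>(i, True)\<close> stands for the generator \<open>\<sigma>\<^sub>i\<close> and \<open>(i, False)\<close> for its inverse.
  Positions in tuples are counted from 0, so the generators on \<open>n\<close> strands are the \<open>\<sigma>\<^sub>i\<close> with
  \<open>i + 1 < n\<close>.
\<close>

type_synonym braid_word = "(nat \<times> bool) list"

definition braid_words :: "nat \<Rightarrow> braid_word set" where
  "braid_words n = lists ({i. Suc i < n} \<times> UNIV)"

inductive braid_equiv :: "nat \<Rightarrow> braid_word \<Rightarrow> braid_word \<Rightarrow> bool" for n where
  refl: "w \<in> braid_words n \<Longrightarrow> braid_equiv n w w"
| sym: "braid_equiv n v w \<Longrightarrow> braid_equiv n w v"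
| trans: "braid_equiv n u v \<Longrightarrow> braid_equiv n v w \<Longrightarrow> braid_equiv n u w"
| append: "braid_equiv n u u' \<Longrightarrow> braid_equiv n v v' \<Longrightarrow> braid_equiv n (u @ v) (u' @ v')"
| cancel: "Suc i < n \<Longrightarrow> braid_equiv n [(i, b), (i, \<not> b)] []"
| commute: "Suc j < n \<Longrightarrow> Suc i < j \<Longrightarrow>
    braid_equiv n [(i, True), (j, True)] [(j, True), (i, True)]"
| braid: "Suc (Suc i) < n \<Longrightarrow>
    braid_equiv n [(i, True), (Suc i, True), (i, True)] [(Suc i, True), (i, True), (Suc i, True)]"

definition braid_rel :: "nat \<Rightarrow> (braid_word \<times> braid_word) set" where
  "braid_rel n = {(v, w). braid_equiv n v w}"

definition braid_group :: "nat \<Rightarrow> braid_word set monoid" where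
  "braid_group n =
    \<lparr>carrier = braid_words n // braid_rel n,
     mult = (\<lambda>X Y. \<Union>v\<in>X. \<Union>w\<in>Y. braid_rel n `` {v @ w}),
     one = braid_rel n `` {[]}\<rparr>"

definition tuples :: "('g, 'a) monoid_scheme \<Rightarrow> nat \<Rightarrow> 'g list set" where
  "tuples G n = {gs. set gs \<subseteq> carrier G \<and> length gs = n}"

fun hurwitz_letter :: "('g, 'a) monoid_scheme \<Rightarrow> nat \<times> bool \<Rightarrow> 'g list \<Rightarrow> 'g list" where
  "hurwitz_letter G (i, True) gs =
    gs[i := gs ! i \<otimes>\<^bsub>G\<^esub> gs ! Suc i \<otimes>\<^bsub>G\<^esub> inv\<^bsub>G\<^esub> (gs ! i), Suc i := gs ! i]"
| "hurwitz_letter G (i, False) gs =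
    gs[i := gs ! Suc i, Suc i := inv\<^bsub>G\<^esub> (gs ! Suc i) \<otimes>\<^bsub>G\<^esub> gs ! i \<otimes>\<^bsub>G\<^esub> gs ! Suc i]"

definition hurwitz_word :: "('g, 'a) monoid_scheme \<Rightarrow> braid_word \<Rightarrow> 'g list \<Rightarrow> 'g list" where
  "hurwitz_word G w gs = foldr (hurwitz_letter G) w gs"

text \<open>The choice of the word representing the braid is irrelevant, see \<open>hurwitz_action_class\<close>.\<close>

definition hurwitz_action ::
    "('g, 'a) monoid_scheme \<Rightarrow> nat \<Rightarrow> braid_word set \<Rightarrow> 'g list \<Rightarrow> 'g list" where
  "hurwitz_action G n X = (\<lambda>gs\<in>tuples G n. hurwitz_word G (SOME w. w \<in> X) gs)"

lemma braid_equiv_words: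
  "braid_equiv n v w \<Longrightarrow> v \<in> braid_words n \<and> w \<in> braid_words n"
  by (induction rule: braid_equiv.induct) (auto simp: braid_words_def)

lemma equiv_braid_rel: "equiv (braid_words n) (braid_rel n)"
  by (rule equivI) (auto simp: braid_rel_def refl_on_def sym_def trans_def
      dest: braid_equiv_words intro: braid_equiv.intros)

lemma braid_rel_append:
  "\<lbrakk>(v, v') \<in> braid_rel n; (w, w') \<in> braid_rel n\<rbrakk> \<Longrightarrow> (v @ w, v' @ w') \<in> braid_rel n"
  by (auto simp: braid_rel_def intro: braid_equiv.append)

lemma braid_group_mult_class:
  assumes "v \<in> braid_words n" "w \<in> braid_words n"
  shows "braid_rel n `` {v} \<otimes>\<^bsub>braid_group n\<^esub> braid_rel n `` {w} = braid_rel n `` {v @ w}"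
proof -
  have "congruent2 (braid_rel n) (braid_rel n) (\<lambda>v w. braid_rel n `` {v @ w})"
    by (auto simp: congruent2_def intro!: equiv_class_eq[OF equiv_braid_rel] braid_rel_append)
  from UN_equiv_class2[OF equiv_braid_rel equiv_braid_rel this assms]
  show ?thesis by (simp add: braid_group_def)
qed

lemma braid_words_simps [simp]:
  "[] \<in> braid_words n"
  "v @ w \<in> braid_words n \<longleftrightarrow> v \<in> braid_words n \<and> w \<in> braid_words n"
  "x # w \<in> braid_words n \<longleftrightarrow> Suc (fst x) < n \<and> w \<in> braid_words n"
  by (cases x; auto simp: braid_words_def)+

lemma braid_inverse_word:
  "w \<in> braid_words n \<Longrightarrow> \<exists>v\<in>braid_words n. (v @ w, []) \<in> braid_rel n"
proof (induction w)
  case Nil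
  show ?case by (auto simp: braid_rel_def intro!: bexI[of _ "[]"] braid_equiv.refl)
next
  case (Cons x w)
  obtain i b where x: "x = (i, b)" by (cases x)
  from Cons obtain v where v: "v \<in> braid_words n" "braid_equiv n (v @ w) []"
    by (auto simp: braid_rel_def)
  have i: "Suc i < n" and w: "w \<in> braid_words n" using Cons.prems x by auto
  have "braid_equiv n ([(i, \<not> b)] @ [(i, b)]) []"
    using braid_equiv.cancel[OF i, of "\<not> b"] by simp
  then have "braid_equiv n (v @ ([(i, \<not> b)] @ [(i, b)]) @ w) (v @ [] @ w)"
    by (intro braid_equiv.append braid_equiv.refl v w)
  then have "braid_equiv n ((v @ [(i, \<not> b)]) @ x # w) []"
    using v(2) x by (auto intro: braid_equiv.trans)
  then show ?case using v i
    by (intro bexI[of _ "v @ [(i, \<not> b)]"]) (auto simp: braid_rel_def)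
qed

lemma group_braid_group: "group (braid_group n)"
proof (rule groupI)
  let ?B = "braid_group n" and ?R = "braid_rel n"
  have car: "X \<in> carrier ?B \<longleftrightarrow> (\<exists>w\<in>braid_words n. X = ?R `` {w})" for X
    by (auto simp: braid_group_def quotient_def)
  have one: "\<one>\<^bsub>?B\<^esub> = ?R `` {[]}" by (simp add: braid_group_def)
  note m = braid_group_mult_class
  show "\<one>\<^bsub>?B\<^esub> \<in> carrier ?B" by (auto simp: car one)
  show "X \<otimes>\<^bsub>?B\<^esub> Y \<in> carrier ?B" if "X \<in> carrier ?B" "Y \<in> carrier ?B" for X Y
  proof -
    from that obtain v w where "v \<in> braid_words n" "w \<in> braid_words n"
      "X = ?R `` {v}" "Y = ?R `` {w}" by (auto simp: car)
    then show ?thesis by (auto simp: car m intro!: bexI[of _ "v @ w"])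
  qed
  show "X \<otimes>\<^bsub>?B\<^esub> Y \<otimes>\<^bsub>?B\<^esub> Z = X \<otimes>\<^bsub>?B\<^esub> (Y \<otimes>\<^bsub>?B\<^esub> Z)"
    if "X \<in> carrier ?B" "Y \<in> carrier ?B" "Z \<in> carrier ?B" for X Y Z
    using that by (auto simp: car m)
  show "\<one>\<^bsub>?B\<^esub> \<otimes>\<^bsub>?B\<^esub> X = X" if "X \<in> carrier ?B" for X
    using that by (auto simp: car m one)
  show "\<exists>Y\<in>carrier ?B. Y \<otimes>\<^bsub>?B\<^esub> X = \<one>\<^bsub>?B\<^esub>" if X: "X \<in> carrier ?B" for X
  proof -
    from X obtain w where w: "w \<in> braid_words n" "X = ?R `` {w}" by (auto simp: car)
    from braid_inverse_word[OF w(1)] obtain v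
      where v: "v \<in> braid_words n" "(v @ w, []) \<in> ?R" by blast
    have "?R `` {v} \<otimes>\<^bsub>?B\<^esub> X = \<one>\<^bsub>?B\<^esub>"
      using v w by (simp add: m one equiv_class_eq[OF equiv_braid_rel])
    moreover have "?R `` {v} \<in> carrier ?B" using v by (auto simp: car)
    ultimately show ?thesis by blast
  qed
qed

context group
begin

lemma hurwitz_letter_closed:
  assumes "gs \<in> tuples G n" "Suc (fst x) < n"
  shows "hurwitz_letter G x gs \<in> tuples G n"
proof -
  obtain i b where x: "x = (i, b)" by (cases x)
  have "gs ! i \<in> carrier G" "gs ! Suc i \<in> carrier G"
    using assms x by (auto simp: tuples_def)
  then show ?thesis using assms x
    by (cases b) (auto simp: tuples_def dest!: set_update_subset_insert[THEN subsetD])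
qed

lemma hurwitz_word_closed:
  "gs \<in> tuples G n \<Longrightarrow> w \<in> braid_words n \<Longrightarrow> hurwitz_word G w gs \<in> tuples G n"
  by (induction w) (auto simp: hurwitz_word_def hurwitz_letter_closed)

lemma hurwitz_word_equiv:
  assumes "braid_equiv n v w" "gs \<in> tuples G n"
  shows "hurwitz_word G v gs = hurwitz_word G w gs"
  using assms
proof (induction arbitrary: gs rule: braid_equiv.induct)
  case (append u u' v v')
  have "v \<in> braid_words n" "v' \<in> braid_words n"
    using append.hyps braid_equiv_words by blast+
  then show ?case
    using append.IH append.prems hurwitz_word_closed[OF append.prems, of v']
    by (simp add: hurwitz_word_def)
next
  case (cancel i b)
  then have "gs ! i \<in> carrier G" "gs ! Suc i \<in> carrier G" "Suc i < length gs"
    by (auto simp: tuples_def)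
  then show ?case
    by (cases b) (auto simp: hurwitz_word_def list_eq_iff_nth_eq nth_list_update
        inv_mult_group m_assoc[symmetric] inv_solve_right' l_inv r_inv,
        (simp add: m_assoc inv_solve_left' inv_solve_right')+)
next
  case (commute j i)
  then show ?case
    by (auto simp: hurwitz_word_def tuples_def list_eq_iff_nth_eq nth_list_update)
next
  case (braid i)
  then have "gs ! i \<in> carrier G" "gs ! Suc i \<in> carrier G" "gs ! Suc (Suc i) \<in> carrier G"
    "Suc (Suc i) < length gs"
    by (auto simp: tuples_def)
  then show ?case
    by (auto simp: hurwitz_word_def list_eq_iff_nth_eq nth_list_update inv_mult_group m_assoc
        inv_solve_left' simp flip: m_assoc[of "inv _" "_"])
qed auto

lemma hurwitz_action_class:
  assumes "w \<in> braid_words n" "gs \<in> tuples G n"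
  shows "hurwitz_action G n (braid_rel n `` {w}) gs = hurwitz_word G w gs"
proof -
  have "(SOME v. v \<in> braid_rel n `` {w}) \<in> braid_rel n `` {w}"
    using equiv_class_self[OF equiv_braid_rel assms(1)] by (rule someI)
  then have "braid_equiv n w (SOME v. v \<in> braid_rel n `` {w})"
    by (simp add: braid_rel_def)
  then show ?thesis
    using hurwitz_word_equiv assms(2) by (simp add: hurwitz_action_def)
qed

theorem group_action_hurwitz: "group_action (braid_group n) (tuples G n) (hurwitz_action G n)"
proof -
  let ?B = "braid_group n" and ?E = "tuples G n" and ?R = "braid_rel n"
  have car: "X \<in> carrier ?B \<longleftrightarrow> (\<exists>w\<in>braid_words n. X = ?R `` {w})" for X
    by (auto simp: braid_group_def quotient_def)
  have mult: "hurwitz_action G n (X \<otimes>\<^bsub>?B\<^esub> Y) = compose ?E (hurwitz_action G n X) (hurwitz_action G n Y)"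
    if "X \<in> carrier ?B" "Y \<in> carrier ?B" for X Y
  proof -
    from that obtain v w where vw: "v \<in> braid_words n" "w \<in> braid_words n"
      "X = ?R `` {v}" "Y = ?R `` {w}" by (auto simp: car)
    show ?thesis
    proof (rule ext)
      fix gs
      show "hurwitz_action G n (X \<otimes>\<^bsub>?B\<^esub> Y) gs
          = compose ?E (hurwitz_action G n X) (hurwitz_action G n Y) gs"
      proof (cases "gs \<in> ?E")
        case True
        then show ?thesis using vw
          by (simp add: braid_group_mult_class hurwitz_action_class compose_def
              hurwitz_word_closed) (simp add: hurwitz_word_def)
      qed (simp add: hurwitz_action_def compose_def)
    qed
  qed
  have clo: "hurwitz_action G n X gs \<in> ?E" if "X \<in> carrier ?B" "gs \<in> ?E" for X gs
    using that by (auto simp: car hurwitz_action_class hurwitz_word_closed)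
  have one: "hurwitz_action G n \<one>\<^bsub>?B\<^esub> gs = gs" if "gs \<in> ?E" for gs
    using hurwitz_action_class[of "[]" n gs] that by (simp add: braid_group_def hurwitz_word_def)
  interpret B: group ?B by (rule group_braid_group)
  have inv: "hurwitz_action G n X (hurwitz_action G n Y gs) = gs"
    if "X \<in> carrier ?B" "Y \<in> carrier ?B" "X \<otimes>\<^bsub>?B\<^esub> Y = \<one>\<^bsub>?B\<^esub>" "gs \<in> ?E" for X Y gs
    using fun_cong[OF mult[OF that(1,2)], of gs] one[OF that(4)] that(3,4)
    by (simp add: compose_def)
  have bij: "hurwitz_action G n X \<in> Bij ?E" if X: "X \<in> carrier ?B" for X
  proof -
    have "bij_betw (hurwitz_action G n X) ?E ?E"
      by (rule bij_betwI[of _ _ _ "hurwitz_action G n (inv\<^bsub>?B\<^esub> X)"])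
        (use X clo inv in auto)
    then show ?thesis by (auto simp: Bij_def hurwitz_action_def)
  qed
  have "hurwitz_action G n \<in> hom ?B (BijGroup ?E)"
    by (rule homI) (auto simp: BijGroup_def bij mult)
  then show ?thesis
    by (simp add: group_action_def group_hom_def group_hom_axioms_def group_braid_group
        group_BijGroup)
qed

end

definition conjugacy_classes :: "('g, 'a) monoid_scheme \<Rightarrow> 'g set set" where
  "conjugacy_classes G =
    orbits G (carrier G) (\<lambda>g. \<lambda>h\<in>carrier G. g \<otimes>\<^bsub>G\<^esub> h \<otimes>\<^bsub>G\<^esub> inv\<^bsub>G\<^esub> g)"

definition D_generated :: "('g, 'a) monoid_scheme \<Rightarrow> 'g set set \<Rightarrow> 'g set \<Rightarrow> bool" where
  "D_generated G D H \<longleftrightarrow>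
    subgroup H G \<and> (\<forall>\<gamma>\<in>D. \<gamma> \<inter> H \<noteq> {}) \<and> generate G (\<Union>\<gamma>\<in>D. \<gamma> \<inter> H) = H"

definition D_restrict :: "'g set set \<Rightarrow> 'g set \<Rightarrow> 'g set set" where
  "D_restrict D H = {\<gamma> \<inter> H | \<gamma>. \<gamma> \<in> D}"

definition D_star :: "('g, 'a) monoid_scheme \<Rightarrow> 'g set set \<Rightarrow> 'g set \<Rightarrow> 'g set set" where
  "D_star G D H = {C \<in> conjugacy_classes (G\<lparr>carrier := H\<rparr>). C \<subseteq> (\<Union>\<gamma>\<in>D. \<gamma> \<inter> H)}"

definition splitting_number :: "('g, 'a) monoid_scheme \<Rightarrow> 'g set set \<Rightarrow> 'g set \<Rightarrow> int" where
  "splitting_number G D H = int (card (D_star G D H)) - int (card (D_restrict D H))"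

definition hurwitz_orbit :: "('g, 'a) monoid_scheme \<Rightarrow> 'g list \<Rightarrow> 'g list set" where
  "hurwitz_orbit G gs = orbit (braid_group (length gs)) (hurwitz_action G (length gs)) gs"

definition components ::
    "('g, 'a) monoid_scheme \<Rightarrow> 'g set set \<Rightarrow> ('g set \<Rightarrow> nat) \<Rightarrow> nat \<Rightarrow> 'g list set set" where
  "components G D \<xi> n =
    {hurwitz_orbit G gs | gs.
      gs \<in> tuples G (n * (\<Sum>\<gamma>\<in>D. \<xi> \<gamma>)) \<and>
      foldr (\<otimes>\<^bsub>G\<^esub>) gs \<one>\<^bsub>G\<^esub> = \<one>\<^bsub>G\<^esub> \<and>
      (\<forall>\<gamma>\<in>D. length (filter (\<lambda>g. g \<in> \<gamma>) gs) = n * \<xi> \<gamma>)}"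

text \<open>
  The orbit of a concatenation depends only on the orbits of the two factors, so the union below
  is over a family of equal sets, see \<open>Comp_mult\<close>.
\<close>

definition Comp ::
    "('g, 'a) monoid_scheme \<Rightarrow> 'g set set \<Rightarrow> ('g set \<Rightarrow> nat) \<Rightarrow> 'g list set monoid" where
  "Comp G D \<xi> =
    \<lparr>carrier = (\<Union>n. components G D \<xi> n),
     mult = (\<lambda>X Y. \<Union>xs\<in>X. \<Union>ys\<in>Y. hurwitz_orbit G (xs @ ys)),
     one = hurwitz_orbit G []\<rparr>"

text \<open>The choice of the representing tuple is irrelevant, see \<open>component_group_orbit\<close>.\<close>

definition component_group :: "('g, 'a) monoid_scheme \<Rightarrow> 'g list set \<Rightarrow> 'g set" where
  "component_group G m = generate G (set (SOME gs. gs \<in> m))"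

context group
begin

lemma hurwitz_orbit_words:
  assumes "set gs \<subseteq> carrier G"
  shows "hurwitz_orbit G gs = {hurwitz_word G w gs | w. w \<in> braid_words (length gs)}"
proof -
  have gs: "gs \<in> tuples G (length gs)" using assms by (simp add: tuples_def)
  have "(\<exists>X\<in>carrier (braid_group (length gs)). z = hurwitz_action G (length gs) X gs) \<longleftrightarrow>
      (\<exists>w\<in>braid_words (length gs). z = hurwitz_word G w gs)" for z
    using hurwitz_action_class[OF _ gs] by (force simp: braid_group_def quotient_def)
  then show ?thesis unfolding hurwitz_orbit_def orbit_def by blast
qed

lemma hurwitz_orbit_closed:
  "set xs \<subseteq> carrier G \<Longrightarrow> ys \<in> hurwitz_orbit G xs \<Longrightarrow> ys \<in> tuples G (length xs)"
  using hurwitz_word_closed[of xs "length xs"]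
  by (auto simp: hurwitz_orbit_words) (simp add: tuples_def)

lemma hurwitz_orbit_eq:
  assumes "set xs \<subseteq> carrier G" "ys \<in> hurwitz_orbit G xs"
  shows "hurwitz_orbit G ys = hurwitz_orbit G xs"
proof -
  interpret A: group_action "braid_group (length xs)" "tuples G (length xs)"
      "hurwitz_action G (length xs)"
    by (rule group_action_hurwitz)
  have xs: "xs \<in> tuples G (length xs)" and ys: "ys \<in> tuples G (length xs)"
    using assms hurwitz_orbit_closed by (auto simp: tuples_def)
  then have [simp]: "length ys = length xs" by (simp add: tuples_def)
  have y: "ys \<in> orbit (braid_group (length xs)) (hurwitz_action G (length xs)) xs"
    using assms by (simp add: hurwitz_orbit_def)
  let ?orb = "orbit (braid_group (length xs)) (hurwitz_action G (length xs))"
  have c: "z \<in> tuples G (length xs)" if "u \<in> tuples G (length xs)" "z \<in> ?orb u" for u z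
    using that A.element_image by (auto simp: orbit_def)
  have "?orb ys \<subseteq> ?orb xs"
    using A.orbit_trans[OF xs ys c[OF ys] y] by blast
  moreover have "?orb xs \<subseteq> ?orb ys"
    using A.orbit_trans[OF ys xs c[OF xs] A.orbit_sym[OF xs ys y]] by blast
  ultimately show ?thesis by (simp add: hurwitz_orbit_def)
qed

lemma hurwitz_word_append:
  assumes "v \<in> braid_words (length xs)" "w \<in> braid_words (length ys)"
    and "set xs \<subseteq> carrier G" "set ys \<subseteq> carrier G"
  shows "\<exists>u\<in>braid_words (length (xs @ ys)).
    hurwitz_word G u (xs @ ys) = hurwitz_word G v xs @ hurwitz_word G w ys"
proof -
  let ?s = "map (\<lambda>(i, b). (length xs + i, b))"
  have len: "length (hurwitz_word G u gs) = length gs"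
    if "u \<in> braid_words (length gs)" "set gs \<subseteq> carrier G" for u gs
    using hurwitz_word_closed[of gs "length gs" u] that by (simp add: tuples_def)
  have left: "hurwitz_word G v (xs @ zs) = hurwitz_word G v xs @ zs" for zs
    using assms(1)
  proof (induction v)
    case (Cons x v)
    obtain i b where x: "x = (i, b)" by (cases x)
    have "length (hurwitz_word G v xs) = length xs" using Cons.prems assms(3) by (simp add: len)
    then show ?case using Cons x
      by (cases b) (auto simp: hurwitz_word_def list_update_append nth_append)
  qed (simp add: hurwitz_word_def)
  have right: "hurwitz_word G (?s w) (xs @ ys) = xs @ hurwitz_word G w ys"
    using assms(2)
  proof (induction w)
    case (Cons x w)
    obtain i b where x: "x = (i, b)" by (cases x)
    have "length (hurwitz_word G w ys) = length ys" using Cons.prems assms(4) by (simp add: len)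
    then show ?case using Cons x
      by (cases b) (auto simp: hurwitz_word_def list_update_append nth_append
          simp flip: add_Suc_right)
  qed (simp add: hurwitz_word_def)
  have "hurwitz_word G (v @ ?s w) (xs @ ys) = hurwitz_word G v xs @ hurwitz_word G w ys"
    using left right by (simp add: hurwitz_word_def)
  moreover have "v @ ?s w \<in> braid_words (length (xs @ ys))"
    using assms(1,2) by (fastforce simp: braid_words_def)
  ultimately show ?thesis by blast
qed

lemma hurwitz_orbit_append:
  assumes "set xs \<subseteq> carrier G" "set ys \<subseteq> carrier G"
    and "xs' \<in> hurwitz_orbit G xs" "ys' \<in> hurwitz_orbit G ys"
  shows "hurwitz_orbit G (xs' @ ys') = hurwitz_orbit G (xs @ ys)"
proof -
  from assms obtain v w where vw: "v \<in> braid_words (length xs)" "xs' = hurwitz_word G v xs"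
    "w \<in> braid_words (length ys)" "ys' = hurwitz_word G w ys"
    by (auto simp: hurwitz_orbit_words)
  from hurwitz_word_append[OF vw(1,3) assms(1,2)] obtain u
    where "u \<in> braid_words (length (xs @ ys))" "hurwitz_word G u (xs @ ys) = xs' @ ys'"
    using vw by auto
  then have "xs' @ ys' \<in> hurwitz_orbit G (xs @ ys)"
    using assms by (subst hurwitz_orbit_words) force+
  then show ?thesis using assms by (intro hurwitz_orbit_eq) auto
qed

lemma hurwitz_orbit_self: "set gs \<subseteq> carrier G \<Longrightarrow> gs \<in> hurwitz_orbit G gs"
  by (auto simp: hurwitz_orbit_words hurwitz_word_def intro!: exI[of _ "[]"])

lemma Comp_mult:
  assumes "set xs \<subseteq> carrier G" "set ys \<subseteq> carrier G"
  shows "hurwitz_orbit G xs \<otimes>\<^bsub>Comp G D \<xi>\<^esub> hurwitz_orbit G ys = hurwitz_orbit G (xs @ ys)"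
proof -
  have "hurwitz_orbit G xs \<otimes>\<^bsub>Comp G D \<xi>\<^esub> hurwitz_orbit G ys
      = (\<Union>xs'\<in>hurwitz_orbit G xs. \<Union>ys'\<in>hurwitz_orbit G ys. hurwitz_orbit G (xs @ ys))"
    unfolding Comp_def monoid.simps by (intro SUP_cong HOL.refl hurwitz_orbit_append assms)
  also have "\<dots> = hurwitz_orbit G (xs @ ys)"
    using hurwitz_orbit_self assms by blast
  finally show ?thesis .
qed

lemma generate_hurwitz_letter:
  assumes "set gs \<subseteq> carrier G" "Suc (fst x) < length gs"
  shows "set (hurwitz_letter G x gs) \<subseteq> generate G (set gs)"
proof -
  obtain i b where x: "x = (i, b)" by (cases x)
  have "gs ! i \<in> generate G (set gs)" "gs ! Suc i \<in> generate G (set gs)"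
    using assms x by (auto intro: generate.incl)
  moreover have "set gs \<subseteq> generate G (set gs)" by (auto intro: generate.incl)
  ultimately show ?thesis using x assms
    by (cases b) (auto dest!: set_update_subset_insert[THEN subsetD]
        intro: generate.eng generate_m_inv_closed)
qed

lemma generate_hurwitz_word:
  assumes "set gs \<subseteq> carrier G" "w \<in> braid_words (length gs)"
  shows "generate G (set (hurwitz_word G w gs)) \<subseteq> generate G (set gs)"
  using assms(2)
proof (induction w)
  case (Cons x w)
  let ?hs = "hurwitz_word G w gs"
  have hs: "set ?hs \<subseteq> carrier G" "length ?hs = length gs"
    using hurwitz_word_closed[of gs "length gs" w] assms Cons.prems by (auto simp: tuples_def)
  have "generate G (set (hurwitz_letter G x ?hs)) \<subseteq> generate G (set ?hs)"
    using generate_hurwitz_letter[OF hs(1)] hs Cons.prems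
    by (intro generate_subgroup_incl generate_is_subgroup) auto
  then show ?case using Cons by (auto simp: hurwitz_word_def)
qed (simp add: hurwitz_word_def)

lemma component_group_orbit:
  assumes "set gs \<subseteq> carrier G"
  shows "component_group G (hurwitz_orbit G gs) = generate G (set gs)"
proof -
  define hs where "hs = (SOME hs. hs \<in> hurwitz_orbit G gs)"
  have hs: "hs \<in> hurwitz_orbit G gs"
    unfolding hs_def using hurwitz_orbit_self[OF assms] by (rule someI)
  have hs': "set hs \<subseteq> carrier G"
    using hurwitz_orbit_closed[OF assms hs] by (simp add: tuples_def)
  have gs: "gs \<in> hurwitz_orbit G hs"
    using hurwitz_orbit_eq[OF assms hs] hurwitz_orbit_self[OF assms] by simp
  have "generate G (set hs) \<subseteq> generate G (set gs)"
    using hs generate_hurwitz_word[OF assms] by (auto simp: hurwitz_orbit_words assms)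
  moreover have "generate G (set gs) \<subseteq> generate G (set hs)"
    using gs generate_hurwitz_word[OF hs'] by (fastforce simp: hurwitz_orbit_words hs')
  ultimately show ?thesis
    unfolding component_group_def hs_def[symmetric] by simp
qed

end

text \<open>
  An element of the monoid ring is the finitely supported function giving its coefficients.
\<close>

definition monoid_ring :: "('k, 'b) ring_scheme \<Rightarrow> ('m, 'c) monoid_scheme \<Rightarrow> ('m \<Rightarrow> 'k) ring" where
  "monoid_ring K M =
    \<lparr>carrier = {f. range f \<subseteq> carrier K \<and> finite {m. f m \<noteq> \<zero>\<^bsub>K\<^esub>} \<and>
                   {m. f m \<noteq> \<zero>\<^bsub>K\<^esub>} \<subseteq> carrier M},
     mult = (\<lambda>f g m. \<Oplus>\<^bsub>K\<^esub>p\<in>{(a, b). f a \<noteq> \<zero>\<^bsub>K\<^esub> \<and> g b \<noteq> \<zero>\<^bsub>K\<^esub> \<and> a \<otimes>\<^bsub>M\<^esub> b = m}.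
               f (fst p) \<otimes>\<^bsub>K\<^esub> g (snd p)),
     one = (\<lambda>m. if m = \<one>\<^bsub>M\<^esub> then \<one>\<^bsub>K\<^esub> else \<zero>\<^bsub>K\<^esub>),
     zero = (\<lambda>m. \<zero>\<^bsub>K\<^esub>),
     add = (\<lambda>f g m. f m \<oplus>\<^bsub>K\<^esub> g m)\<rparr>"

text \<open>The linear span of a set \<open>S\<close> of basis elements: the elements with support in \<open>S\<close>.\<close>

definition basis_span ::
    "('k, 'b) ring_scheme \<Rightarrow> ('m, 'c) monoid_scheme \<Rightarrow> 'm set \<Rightarrow> ('m \<Rightarrow> 'k) set" where
  "basis_span K M S = {f \<in> carrier (monoid_ring K M). {m. f m \<noteq> \<zero>\<^bsub>K\<^esub>} \<subseteq> S}"

definition component_ring ::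
    "('k, 'b) ring_scheme \<Rightarrow> ('g, 'a) monoid_scheme \<Rightarrow> 'g set set \<Rightarrow> ('g set \<Rightarrow> nat) \<Rightarrow>
      ('g list set \<Rightarrow> 'k) ring" where
  "component_ring K G D \<xi> = monoid_ring K (Comp G D \<xi>)"

definition I_ideal ::
    "('k, 'b) ring_scheme \<Rightarrow> ('g, 'a) monoid_scheme \<Rightarrow> 'g set set \<Rightarrow> ('g set \<Rightarrow> nat) \<Rightarrow> 'g set \<Rightarrow>
      ('g list set \<Rightarrow> 'k) set" where
  "I_ideal K G D \<xi> H =
    basis_span K (Comp G D \<xi>) {m \<in> carrier (Comp G D \<xi>). H \<subseteq> component_group G m}"

definition I_star_ideal ::
    "('k, 'b) ring_scheme \<Rightarrow> ('g, 'a) monoid_scheme \<Rightarrow> 'g set set \<Rightarrow> ('g set \<Rightarrow> nat) \<Rightarrow> 'g set \<Rightarrow>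
      ('g list set \<Rightarrow> 'k) set" where
  "I_star_ideal K G D \<xi> H =
    basis_span K (Comp G D \<xi>) {m \<in> carrier (Comp G D \<xi>). H \<subset> component_group G m}"

text \<open>As usual, the characteristic is 0 if 1 has infinite additive order.\<close>

definition ring_char :: "('k, 'b) ring_scheme \<Rightarrow> nat" where
  "ring_char K = group.ord (add_monoid K) \<one>\<^bsub>K\<^esub>"

definition Spec :: "('r, 'b) ring_scheme \<Rightarrow> 'r set set" where
  "Spec R = {P. primeideal P R}"

definition vanishing :: "('r, 'b) ring_scheme \<Rightarrow> 'r set \<Rightarrow> 'r set set" where
  "vanishing R I = {P \<in> Spec R. I \<subseteq> P}"

definition zariski :: "('r, 'b) ring_scheme \<Rightarrow> 'r set topology" where
  "zariski R = topology (\<lambda>U. \<exists>I. ideal I R \<and> U = Spec R - vanishing R I)"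

lemma (in cring) istopology_zariski:
  "istopology (\<lambda>U. \<exists>I. ideal I R \<and> U = Spec R - vanishing R I)"
  unfolding istopology_def
proof (intro conjI allI impI)
  fix U V
  assume "\<exists>I. ideal I R \<and> U = Spec R - vanishing R I" "\<exists>I. ideal I R \<and> V = Spec R - vanishing R I"
  then obtain I J where I: "ideal I R" "U = Spec R - vanishing R I"
    and J: "ideal J R" "V = Spec R - vanishing R J" by blast
  have "P \<in> vanishing R (I \<inter> J) \<Longrightarrow> P \<in> vanishing R I \<union> vanishing R J" for P
  proof (rule ccontr)
    assume P: "P \<in> vanishing R (I \<inter> J)" "P \<notin> vanishing R I \<union> vanishing R J"
    then obtain a b where ab: "a \<in> I" "a \<notin> P" "b \<in> J" "b \<notin> P"
      by (auto simp: vanishing_def)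
    then have car: "a \<in> carrier R" "b \<in> carrier R"
      using ideal.Icarr[OF I(1)] ideal.Icarr[OF J(1)] by auto
    have "a \<otimes> b \<in> I \<inter> J"
      using ideal.I_r_closed[OF I(1) ab(1) car(2)] ideal.I_l_closed[OF J(1) ab(3) car(1)] by simp
    then have "a \<otimes> b \<in> P" using P by (auto simp: vanishing_def)
    then show False using P ab car
      by (auto simp: vanishing_def Spec_def dest: primeideal.I_prime)
  qed
  then have "vanishing R (I \<inter> J) = vanishing R I \<union> vanishing R J"
    by (auto simp: vanishing_def)
  then show "\<exists>I. ideal I R \<and> U \<inter> V = Spec R - vanishing R I"
    using I J i_intersect[OF I(1) J(1)] by (intro exI[of _ "I \<inter> J"]) auto
next
  fix \<K> assume "\<forall>U\<in>\<K>. \<exists>I. ideal I R \<and> U = Spec R - vanishing R I"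
  then obtain f where f: "\<And>U. U \<in> \<K> \<Longrightarrow> ideal (f U) R \<and> U = Spec R - vanishing R (f U)"
    by metis
  have sub: "(\<Union>U\<in>\<K>. f U) \<subseteq> carrier R"
    using f by (auto dest: ideal.Icarr)
  have "Idl (\<Union>U\<in>\<K>. f U) \<subseteq> P \<longleftrightarrow> (\<forall>U\<in>\<K>. f U \<subseteq> P)" if "P \<in> Spec R" for P
    using that genideal_self[OF sub] genideal_minimal[of P "\<Union>U\<in>\<K>. f U"]
    by (auto simp: Spec_def primeideal_def)
  then have "\<Union>\<K> = Spec R - vanishing R (Idl (\<Union>U\<in>\<K>. f U))"
    using f by (auto simp: vanishing_def set_eq_iff)
  then show "\<exists>I. ideal I R \<and> \<Union>\<K> = Spec R - vanishing R I"
    using genideal_ideal[OF sub] by blast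
qed

definition irreducible_closed :: "'a topology \<Rightarrow> 'a set \<Rightarrow> bool" where
  "irreducible_closed X Z \<longleftrightarrow>
    closedin X Z \<and> Z \<noteq> {} \<and>
    (\<forall>A B. closedin X A \<and> closedin X B \<and> Z = A \<union> B \<longrightarrow> A = Z \<or> B = Z)"

text \<open>
  The supremum of the lengths of chains of irreducible closed subsets; it is \<open>-\<infinity>\<close> for the empty
  space.
\<close>

definition krull_dim :: "'a topology \<Rightarrow> ereal" where
  "krull_dim X =
    (SUP n \<in> {n. \<exists>Z. (\<forall>i\<le>n. irreducible_closed X (Z i)) \<and> (\<forall>i<n. Z i \<subset> Z (Suc i))}.
      ereal (real n))"

definition stratum ::
    "('k, 'b) ring_scheme \<Rightarrow> ('g, 'a) monoid_scheme \<Rightarrow> 'g set set \<Rightarrow> ('g set \<Rightarrow> nat) \<Rightarrow> 'g set \<Rightarrow>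
      ('g list set \<Rightarrow> 'k) set topology" where
  "stratum K G D \<xi> H =
    (let R = component_ring K G D \<xi> in
      subtopology (zariski R)
        (vanishing R (I_star_ideal K G D \<xi> H) - vanishing R (I_ideal K G D \<xi> H)))"

end

theory Submission
  imports Defs "HOL-Library.Multiset"
begin

text \<open>
  Let \<open>M\<close> be the submonoid of components with group inside \<open>H\<close>. A prime of the stratum misses some
  component \<open>m\<close> with group exactly \<open>H\<close> and therefore contains all components outside \<open>M\<close>.
  A chain of \<open>d + 1\<close> primes yields \<open>d\<close> elements algebraically independent modulo the smallest prime,
  so the number of products \<open>m t\<close> with \<open>t \<in> M\<close> of length at most \<open>L\<close> grows at least like \<open>L\<^sup>d\<close>.
  On the other hand, pulling out blocks \<open>(g, \<dots>, g)\<close> of length \<open>|G|\<close>, which commute with everything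
  and may be conjugated by \<open>H\<close> next to \<open>m\<close>, shows that up to boundedly many choices \<open>m t\<close> depends
  only on how many entries of \<open>t\<close> lie in each class of \<open>H\<close>. These counts are determined by the
  length and \<open>\<Omega>\<close> further coordinates, hence \<open>d \<le> \<Omega> + 1\<close>.

  Conversely, grade \<open>k[M]\<close> by the first \<open>j\<close> of these \<open>\<Omega> + 1\<close> coordinates. The functions for which the
  sum of coefficients vanishes in every degree form a prime, and these primes, for
  \<open>j = 0, \<dots>, \<Omega> + 1\<close>, are a strict chain in the stratum.
\<close>

section \<open>Monoid algebras\<close>

text \<open>The factor \<open>m\<close> is what makes the count possible. A block can be conjugated
  only by elements of the group generated by its companions, and \<open>t\<close> alone may generate
  a proper subgroup of \<open>H\<close>. Multiplying by \<open>m\<close> supplies all of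
  \<open>H\<close>, and nothing is lost: \<open>m\<close> lies outside the prime, so it can be
  cancelled modulo it. Blocks have length |G| because g^|G| = 1: a subtuple with product 1 passes
  its neighbours without changing them. In a tuple longer than |G|^2 some entry occurs at least |G|
  times, so what remains after removing blocks is one of finitely many tuples. The class counts are
  not independent. The classes of \<open>H\<close> inside one \<gamma> share the total n
  \<xi>(\<gamma>), and n is fixed by the length, so one class per \<gamma> is redundant. This leaves
  |D_H^*| - |D_H| counts together with the length, the origin of \<Omega> + 1. In the lower bound
  the primes are kernels of maps to polynomial rings, and strictness comes from pairs of components
  that agree in the earlier coordinates and differ in the next one.\<close>

lemma (in abelian_monoid) finsum_swap:
  assumes "finite A" "finite B" "\<And>a b. a \<in> A \<Longrightarrow> b \<in> B \<Longrightarrow> f a b \<in> carrier G"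
  shows "(\<Oplus>a\<in>A. \<Oplus>b\<in>B. f a b) = (\<Oplus>b\<in>B. \<Oplus>a\<in>A. f a b)"
  using assms(1,3)
proof (induction A rule: finite_induct)
  case empty
  then show ?case by simp
next
  case (insert x A)
  have "(\<Oplus>a\<in>insert x A. \<Oplus>b\<in>B. f a b) = (\<Oplus>b\<in>B. f x b) \<oplus> (\<Oplus>b\<in>B. \<Oplus>a\<in>A. f a b)"
    using insert by (subst finsum_insert) (auto intro!: finsum_closed)
  also have "\<dots> = (\<Oplus>b\<in>B. f x b \<oplus> (\<Oplus>a\<in>A. f a b))"
    using insert by (subst finsum_addf) (auto intro!: finsum_closed)
  also have "\<dots> = (\<Oplus>b\<in>B. \<Oplus>a\<in>insert x A. f a b)"
    using insert by (intro finsum_cong') (auto intro!: finsum_closed)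
  finally show ?case .
qed

lemma (in abelian_monoid) finsum_Times:
  assumes "finite A" "finite B" "\<And>a b. a \<in> A \<Longrightarrow> b \<in> B \<Longrightarrow> f (a, b) \<in> carrier G"
  shows "(\<Oplus>p\<in>A \<times> B. f p) = (\<Oplus>a\<in>A. \<Oplus>b\<in>B. f (a, b))"
  using assms(1,3)
proof (induction A rule: finite_induct)
  case (insert x A)
  have "insert x A \<times> B = Pair x ` B \<union> A \<times> B" by auto
  then have "(\<Oplus>p\<in>insert x A \<times> B. f p) = (\<Oplus>p\<in>Pair x ` B. f p) \<oplus> (\<Oplus>p\<in>A \<times> B. f p)"
    using insert assms(2) by (subst finsum_Un_disjoint[symmetric]) auto
  also have "(\<Oplus>p\<in>Pair x ` B. f p) = (\<Oplus>b\<in>B. f (x, b))"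
    using insert by (subst finsum_reindex) (auto simp: inj_on_def)
  finally show ?case using insert by (subst finsum_insert) (auto intro!: finsum_closed)
qed simp

lemma (in abelian_monoid) finsum_delta:
  assumes "finite A" "\<And>a. a \<in> A \<Longrightarrow> f a \<in> carrier G"
  shows "(\<Oplus>a\<in>A. if a = x then f a else \<zero>) = (if x \<in> A then f x else \<zero>)"
proof (cases "x \<in> A")
  case True
  then show ?thesis using add.finprod_singleton_swap[of x A f] assms by auto
next
  case False
  then have "(\<Oplus>a\<in>A. if a = x then f a else \<zero>) = (\<Oplus>a\<in>A. \<zero>)"
    by (intro finsum_cong') auto
  then show ?thesis using False by simp
qed

text \<open>Gaussian elimination, by induction on the set \<open>T\<close> of coordinates. If every
  vector vanishes at the new coordinate, that coordinate imposes no condition; otherwise a vector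
  with nonzero entry there serves as pivot, the others are cleared at \<open>t\<close>, and both
  cardinalities drop by one.\<close>

lemma (in field) exists_linear_dependence:
  assumes "finite T" "finite J" "card T < card J" "\<And>j t. j \<in> J \<Longrightarrow> t \<in> T \<Longrightarrow> c j t \<in> carrier R"
  shows "\<exists>a. (\<forall>j. a j \<in> carrier R) \<and> (\<exists>j\<in>J. a j \<noteq> \<zero>) \<and> (\<forall>t\<in>T. (\<Oplus>j\<in>J. a j \<otimes> c j t) = \<zero>)"
  using assms
proof (induction T arbitrary: J c rule: finite_induct)
  case empty
  then obtain j where "j \<in> J" by fastforce
  then show ?case by (intro exI[of _ "\<lambda>_. \<one>"]) auto
next
  case (insert t T)
  show ?case
  proof (cases "\<forall>j\<in>J. c j t = \<zero>")
    case True
    from insert.IH[of J c] insert.prems insert.hyps obtain a where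
      a: "\<forall>j. a j \<in> carrier R" "\<exists>j\<in>J. a j \<noteq> \<zero>" "\<forall>t\<in>T. (\<Oplus>j\<in>J. a j \<otimes> c j t) = \<zero>" by auto
    moreover have "(\<Oplus>j\<in>J. a j \<otimes> c j t) = (\<Oplus>j\<in>J. \<zero>)"
      using True a by (intro finsum_cong') auto
    ultimately show ?thesis by (intro exI[of _ a]) auto
  next
    case False
    then obtain i where i: "i \<in> J" "c i t \<noteq> \<zero>" by blast
    define J' where "J' = J - {i}"
    have J': "J = insert i J'" "i \<notin> J'" "finite J'" "card T < card J'"
      using i insert by (auto simp: J'_def)
    have cc: "c j s \<in> carrier R" if "j \<in> J" "s \<in> insert t T" for j s
      using insert.prems that by blast
    \<comment> \<open>\<open>r j\<close> is the multiple of the pivot vector \<open>i\<close> that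
      clears the entry of vector \<open>j\<close> at \<open>t\<close>.\<close>
    define r where "r j = c j t \<otimes> inv (c i t)" for j
    have u: "c i t \<in> Units R" using i cc field_Units by auto
    have r: "r j \<in> carrier R" "r j \<otimes> c i t = c j t" if "j \<in> J" for j
      using that u cc[of j t] cc[of i t] i by (auto simp: r_def m_assoc)
    have "\<exists>a. (\<forall>j. a j \<in> carrier R) \<and> (\<exists>j\<in>J'. a j \<noteq> \<zero>) \<and>
        (\<forall>s\<in>T. (\<Oplus>j\<in>J'. a j \<otimes> (c j s \<ominus> r j \<otimes> c i s)) = \<zero>)"
    proof (rule insert.IH[OF J'(3,4)])
      fix j s assume "j \<in> J'" "s \<in> T"
      then have "j \<in> J" "s \<in> insert t T" using J'(1) by auto
      then show "c j s \<ominus> r j \<otimes> c i s \<in> carrier R" using r(1) cc i(1) by simp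
    qed
    then obtain a where
      a: "\<forall>j. a j \<in> carrier R" "\<exists>j\<in>J'. a j \<noteq> \<zero>"
        "\<forall>s\<in>T. (\<Oplus>j\<in>J'. a j \<otimes> (c j s \<ominus> r j \<otimes> c i s)) = \<zero>" by blast
    \<comment> \<open>The coefficient of the pivot collects what the cleared vectors subtract, so
      that the combination of the original vectors equals that of the cleared ones at every
      coordinate.\<close>
    define b where "b = \<ominus> (\<Oplus>j\<in>J'. a j \<otimes> r j)"
    have sc: "(\<Oplus>j\<in>J'. a j \<otimes> r j) \<in> carrier R" using a r J' by (intro finsum_closed) auto
    then have b: "b \<in> carrier R" by (simp add: b_def)
    define a' where "a' = a(i := b)"
    have key: "(\<Oplus>j\<in>J. a' j \<otimes> c j s) = (\<Oplus>j\<in>J'. a j \<otimes> (c j s \<ominus> r j \<otimes> c i s))" if s: "s \<in> insert t T" for s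
    proof -
      have cis: "c i s \<in> carrier R" using cc i s by blast
      have "(\<Oplus>j\<in>J'. a' j \<otimes> c j s) = (\<Oplus>j\<in>J'. a j \<otimes> c j s)"
        using J' a cc s by (intro finsum_cong') (auto simp: a'_def)
      then have "(\<Oplus>j\<in>J. a' j \<otimes> c j s) = b \<otimes> c i s \<oplus> (\<Oplus>j\<in>J'. a j \<otimes> c j s)"
        unfolding J'(1) using J' a b cc s by (subst finsum_insert) (auto simp: a'_def)
      also have "b \<otimes> c i s = \<ominus> ((\<Oplus>j\<in>J'. a j \<otimes> r j) \<otimes> c i s)"
        using sc cis by (simp add: b_def l_minus)
      also have "(\<Oplus>j\<in>J'. a j \<otimes> r j) \<otimes> c i s = (\<Oplus>j\<in>J'. a j \<otimes> r j \<otimes> c i s)"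
        using J' a r cis by (intro finsum_ldistr) auto
      finally have 1: "(\<Oplus>j\<in>J. a' j \<otimes> c j s)
          = (\<Oplus>j\<in>J'. a j \<otimes> c j s) \<ominus> (\<Oplus>j\<in>J'. a j \<otimes> r j \<otimes> c i s)"
        using J' a r cis cc s by (simp add: minus_eq a_comm Pi_iff)
      have "(\<Oplus>j\<in>J'. a j \<otimes> (c j s \<ominus> r j \<otimes> c i s)) \<oplus> (\<Oplus>j\<in>J'. a j \<otimes> r j \<otimes> c i s)
          = (\<Oplus>j\<in>J'. a j \<otimes> (c j s \<ominus> r j \<otimes> c i s) \<oplus> a j \<otimes> r j \<otimes> c i s)"
        using J' a r cis cc s by (intro finsum_addf[symmetric]) auto
      also have "\<dots> = (\<Oplus>j\<in>J'. a j \<otimes> c j s)"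
      proof (intro finsum_cong' HOL.refl)
        fix j assume j: "j \<in> J'"
        have "a j \<in> carrier R" "c j s \<in> carrier R" "r j \<in> carrier R" using a cc r j J' s by auto
        then show "a j \<otimes> (c j s \<ominus> r j \<otimes> c i s) \<oplus> a j \<otimes> r j \<otimes> c i s = a j \<otimes> c j s"
          using cis by (simp add: minus_eq r_distr r_minus m_assoc a_assoc l_neg)
      qed (use J' a cc s in auto)
      finally have 2: "(\<Oplus>j\<in>J'. a j \<otimes> (c j s \<ominus> r j \<otimes> c i s)) \<oplus> (\<Oplus>j\<in>J'. a j \<otimes> r j \<otimes> c i s)
          = (\<Oplus>j\<in>J'. a j \<otimes> c j s)" .
      have "(\<Oplus>j\<in>J'. a j \<otimes> (c j s \<ominus> r j \<otimes> c i s)) \<in> carrier R"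
        "(\<Oplus>j\<in>J'. a j \<otimes> r j \<otimes> c i s) \<in> carrier R"
        using J' a r cis cc s by (auto intro!: finsum_closed)
      then show ?thesis unfolding 1 2[symmetric] by (simp add: minus_eq a_assoc r_neg)
    qed
    have "(\<Oplus>j\<in>J'. a j \<otimes> (c j t \<ominus> r j \<otimes> c i t)) = (\<Oplus>j\<in>J'. \<zero>)"
    proof (intro finsum_cong' HOL.refl)
      fix j assume j: "j \<in> J'"
      then have "r j \<otimes> c i t = c j t" "c j t \<in> carrier R" using r cc J' by auto
      then show "a j \<otimes> (c j t \<ominus> r j \<otimes> c i t) = \<zero>" using a by (simp add: minus_eq r_neg)
    qed auto
    then have "\<forall>s\<in>insert t T. (\<Oplus>j\<in>J. a' j \<otimes> c j s) = \<zero>" using key a by auto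
    moreover have "\<forall>j. a' j \<in> carrier R" using a b by (auto simp: a'_def)
    moreover have "\<exists>j\<in>J. a' j \<noteq> \<zero>" using a J' by (auto simp: a'_def)
    ultimately show ?thesis by blast
  qed
qed

section \<open>The monoid algebra and its linear functionals\<close>

locale monoid_algebra = K?: field K + M: comm_monoid M
  for K :: "('k, 'b) ring_scheme" (structure) and M :: "('m, 'c) monoid_scheme"
begin

definition supp :: "('m \<Rightarrow> 'k) \<Rightarrow> 'm set" where
  "supp f = {m. f m \<noteq> \<zero>}"

text \<open>The linear extension of \<open>u\<close> from the basis \<open>M\<close> to the ring,
  evaluated at \<open>f\<close>. Ring identities are tested against all such functionals instead of
  rearranging convolution sums.\<close>

definition pairing :: "('m \<Rightarrow> 'k) \<Rightarrow> ('m \<Rightarrow> 'k) \<Rightarrow> 'k" where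
  "pairing f u = (\<Oplus>a\<in>supp f. f a \<otimes> u a)"

text \<open>As a ring element this is the basis element \<open>m\<close>; as second argument of
  \<open>pairing\<close> it is the functional that reads off the coefficient at
  \<open>m\<close>.\<close>

definition dirac :: "'m \<Rightarrow> 'm \<Rightarrow> 'k" where
  "dirac m = (\<lambda>x. if x = m then \<one> else \<zero>)"

definition smult :: "'k \<Rightarrow> ('m \<Rightarrow> 'k) \<Rightarrow> 'm \<Rightarrow> 'k" where
  "smult c f = (\<lambda>m. c \<otimes> f m)"

abbreviation "R \<equiv> monoid_ring K M"

lemma in_R_iff: "f \<in> carrier R \<longleftrightarrow> (\<forall>m. f m \<in> carrier K) \<and> finite (supp f) \<and> supp f \<subseteq> carrier M"
  by (auto simp: monoid_ring_def supp_def)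

lemma R_coeff [simp, intro]: "f \<in> carrier R \<Longrightarrow> f m \<in> carrier K"
  and R_finite [simp, intro]: "f \<in> carrier R \<Longrightarrow> finite (supp f)"
  and R_supp [simp]: "f \<in> carrier R \<Longrightarrow> a \<in> supp f \<Longrightarrow> a \<in> carrier M"
  and R_supp_subset: "f \<in> carrier R \<Longrightarrow> supp f \<subseteq> carrier M"
  by (auto simp: in_R_iff)

lemma not_supp: "a \<notin> supp f \<Longrightarrow> f a = \<zero>"
  by (simp add: supp_def)

lemma pairing_superset:
  assumes "f \<in> carrier R" "u \<in> carrier M \<rightarrow> carrier K" "finite A" "supp f \<subseteq> A" "A \<subseteq> carrier M"
  shows "pairing f u = (\<Oplus>a\<in>A. f a \<otimes> u a)"
  unfolding pairing_def
  using assms by (intro add.finprod_mono_neutral_cong_left) (auto simp: not_supp Pi_iff subset_iff)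

lemma pairing_closed [intro, simp]:
  assumes "f \<in> carrier R" "u \<in> carrier M \<rightarrow> carrier K"
  shows "pairing f u \<in> carrier K"
  unfolding pairing_def using assms by (intro finsum_closed) (auto simp: Pi_iff)

lemma pairing_cong:
  assumes "f \<in> carrier R" "u \<in> carrier M \<rightarrow> carrier K" "\<And>a. a \<in> supp f \<Longrightarrow> u a = v a"
  shows "pairing f u = pairing f v"
  unfolding pairing_def using assms(1,2) assms(3)[symmetric] by (intro finsum_cong') (auto simp: Pi_iff)

lemma pairing_cong2:
  assumes "f \<in> carrier R" "g \<in> carrier R"
    "\<And>a b. a \<in> carrier M \<Longrightarrow> b \<in> carrier M \<Longrightarrow> u a b \<in> carrier K"
    "\<And>a b. a \<in> carrier M \<Longrightarrow> b \<in> carrier M \<Longrightarrow> u a b = v a b"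
  shows "pairing f (\<lambda>a. pairing g (u a)) = pairing f (\<lambda>a. pairing g (v a))"
proof (rule pairing_cong[OF assms(1)])
  show "(\<lambda>a. pairing g (u a)) \<in> carrier M \<rightarrow> carrier K" using assms(2,3) by auto
  fix a assume "a \<in> supp f"
  then have a: "a \<in> carrier M" using assms(1) by simp
  show "pairing g (u a) = pairing g (v a)"
    by (rule pairing_cong[OF assms(2)]) (use a assms in auto)
qed

lemma pairing_swap:
  assumes "f \<in> carrier R" "g \<in> carrier R"
    "\<And>a b. a \<in> carrier M \<Longrightarrow> b \<in> carrier M \<Longrightarrow> u a b \<in> carrier K"
  shows "pairing f (\<lambda>a. pairing g (u a)) = pairing g (\<lambda>b. pairing f (\<lambda>a. u a b))"
proof -
  have "pairing f (\<lambda>a. pairing g (u a)) = (\<Oplus>a\<in>supp f. \<Oplus>b\<in>supp g. f a \<otimes> (g b \<otimes> u a b))"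
    unfolding pairing_def using assms
    by (intro finsum_cong') (auto simp: Pi_iff intro!: finsum_rdistr finsum_closed)
  also have "\<dots> = (\<Oplus>b\<in>supp g. \<Oplus>a\<in>supp f. f a \<otimes> (g b \<otimes> u a b))"
    using assms by (intro finsum_swap) auto
  also have "\<dots> = (\<Oplus>b\<in>supp g. \<Oplus>a\<in>supp f. g b \<otimes> (f a \<otimes> u a b))"
    using assms by (intro finsum_cong' finsum_closed) (auto simp: Pi_iff intro!: finsum_closed m_lcomm)
  also have "\<dots> = pairing g (\<lambda>b. pairing f (\<lambda>a. u a b))"
    unfolding pairing_def using assms
    by (intro finsum_cong') (auto simp: Pi_iff intro!: finsum_rdistr[symmetric] finsum_closed)
  finally show ?thesis .
qed

lemma pairing_add_left:
  assumes "f \<in> carrier R" "g \<in> carrier R" "f \<oplus>\<^bsub>R\<^esub> g \<in> carrier R" "u \<in> carrier M \<rightarrow> carrier K"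
  shows "pairing (f \<oplus>\<^bsub>R\<^esub> g) u = pairing f u \<oplus> pairing g u"
proof -
  let ?A = "supp f \<union> supp g"
  have "supp (f \<oplus>\<^bsub>R\<^esub> g) \<subseteq> ?A" by (auto simp: supp_def monoid_ring_def)
  moreover have A: "finite ?A" "?A \<subseteq> carrier M" using assms R_supp_subset by auto
  ultimately have "pairing (f \<oplus>\<^bsub>R\<^esub> g) u = (\<Oplus>a\<in>?A. (f a \<oplus> g a) \<otimes> u a)"
    using pairing_superset[OF assms(3,4), of ?A] by (simp add: monoid_ring_def)
  also have "\<dots> = (\<Oplus>a\<in>?A. f a \<otimes> u a \<oplus> g a \<otimes> u a)"
    using assms A by (intro finsum_cong') (auto simp: Pi_iff l_distr)
  also have "\<dots> = (\<Oplus>a\<in>?A. f a \<otimes> u a) \<oplus> (\<Oplus>a\<in>?A. g a \<otimes> u a)"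
    using assms by (intro finsum_addf) (auto simp: Pi_iff)
  also have "\<dots> = pairing f u \<oplus> pairing g u"
    using pairing_superset[OF assms(1,4) A(1) _ A(2)] pairing_superset[OF assms(2,4) A(1) _ A(2)]
    by simp
  finally show ?thesis .
qed

lemma pairing_smult_left:
  assumes "f \<in> carrier R" "smult c f \<in> carrier R" "u \<in> carrier M \<rightarrow> carrier K" "c \<in> carrier K"
  shows "pairing (smult c f) u = c \<otimes> pairing f u"
proof -
  have "supp (smult c f) \<subseteq> supp f" using assms(4) by (auto simp: supp_def smult_def)
  then have "pairing (smult c f) u = (\<Oplus>a\<in>supp f. c \<otimes> f a \<otimes> u a)"
    using assms by (subst pairing_superset[of _ _ "supp f"]) (auto simp: smult_def)
  also have "\<dots> = c \<otimes> pairing f u"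
    unfolding pairing_def using assms
    by (subst finsum_rdistr) (auto simp: Pi_iff m_assoc intro!: finsum_cong')
  finally show ?thesis .
qed

lemma pairing_smult_right:
  assumes "f \<in> carrier R" "u \<in> carrier M \<rightarrow> carrier K" "c \<in> carrier K"
  shows "pairing f (\<lambda>a. c \<otimes> u a) = c \<otimes> pairing f u"
  unfolding pairing_def using assms
  by (subst finsum_rdistr) (auto simp: Pi_iff m_lcomm intro!: finsum_cong')

lemma pairing_zero_right:
  assumes "f \<in> carrier R"
  shows "pairing f (\<lambda>a. \<zero>) = \<zero>"
proof -
  have "pairing f (\<lambda>a. \<zero>) = (\<Oplus>a\<in>supp f. \<zero>)"
    unfolding pairing_def using assms by (intro finsum_cong') auto
  then show ?thesis by simp
qed

lemma dirac_closed [simp]: "dirac m \<in> carrier M \<rightarrow> carrier K"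
  by (auto simp: dirac_def)

lemma supp_dirac: "supp (dirac m) \<subseteq> {m}"
  by (auto simp: supp_def dirac_def)

lemma dirac_in_R [intro, simp]: "m \<in> carrier M \<Longrightarrow> dirac m \<in> carrier R"
  by (auto simp: monoid_ring_def dirac_def)

lemma pairing_dirac_right:
  assumes "f \<in> carrier R"
  shows "pairing f (dirac m) = f m"
proof -
  have "pairing f (dirac m) = (\<Oplus>a\<in>supp f. if a = m then f a else \<zero>)"
    unfolding pairing_def dirac_def using assms by (intro finsum_cong') auto
  also have "\<dots> = (if m \<in> supp f then f m else \<zero>)"
    using assms by (intro finsum_delta) auto
  finally show ?thesis using not_supp by auto
qed

lemma pairing_dirac_left:
  assumes "m \<in> carrier M" "u \<in> carrier M \<rightarrow> carrier K"
  shows "pairing (dirac m) u = u m"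
proof -
  have "pairing (dirac m) u = (\<Oplus>a\<in>{m}. dirac m a \<otimes> u a)"
    using assms supp_dirac by (intro pairing_superset) auto
  also have "\<dots> = u m" using assms by (auto simp: dirac_def Pi_iff)
  finally show ?thesis .
qed

lemma R_eqI:
  assumes "f \<in> carrier R" "g \<in> carrier R"
    "\<And>u. u \<in> carrier M \<rightarrow> carrier K \<Longrightarrow> pairing f u = pairing g u"
  shows "f = g"
proof
  fix m
  show "f m = g m"
    using assms(3)[OF dirac_closed, of m] assms(1,2) by (simp add: pairing_dirac_right)
qed

lemma pairing_pairing:
  assumes "f \<in> carrier R" "g \<in> carrier R"
    "\<And>a b. a \<in> carrier M \<Longrightarrow> b \<in> carrier M \<Longrightarrow> u a b \<in> carrier K"
  shows "pairing f (\<lambda>a. pairing g (u a)) = (\<Oplus>p\<in>supp f \<times> supp g. f (fst p) \<otimes> g (snd p) \<otimes> u (fst p) (snd p))"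
proof -
  have "pairing f (\<lambda>a. pairing g (u a)) = (\<Oplus>a\<in>supp f. \<Oplus>b\<in>supp g. f a \<otimes> (g b \<otimes> u a b))"
    unfolding pairing_def using assms
    by (intro finsum_cong') (auto simp: Pi_iff intro!: finsum_rdistr finsum_closed)
  also have "\<dots> = (\<Oplus>a\<in>supp f. \<Oplus>b\<in>supp g. f a \<otimes> g b \<otimes> u a b)"
    using assms by (intro finsum_cong' finsum_closed)
      (auto simp: Pi_iff m_assoc intro!: finsum_closed)
  also have "\<dots> = (\<Oplus>p\<in>supp f \<times> supp g. f (fst p) \<otimes> g (snd p) \<otimes> u (fst p) (snd p))"
    using assms by (subst finsum_Times) auto
  finally show ?thesis .
qed

lemma mult_apply:
  assumes "f \<in> carrier R" "g \<in> carrier R"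
  shows "(f \<otimes>\<^bsub>R\<^esub> g) m = pairing f (\<lambda>a. pairing g (\<lambda>b. dirac m (a \<otimes>\<^bsub>M\<^esub> b)))"
proof -
  have "(f \<otimes>\<^bsub>R\<^esub> g) m = (\<Oplus>p\<in>{(a, b). f a \<noteq> \<zero> \<and> g b \<noteq> \<zero> \<and> a \<otimes>\<^bsub>M\<^esub> b = m}. f (fst p) \<otimes> g (snd p))"
    by (simp add: monoid_ring_def)
  also have "\<dots> = (\<Oplus>p\<in>supp f \<times> supp g. f (fst p) \<otimes> g (snd p) \<otimes> dirac m (fst p \<otimes>\<^bsub>M\<^esub> snd p))"
  proof (rule add.finprod_mono_neutral_cong_left)
    show "{(a, b). f a \<noteq> \<zero> \<and> g b \<noteq> \<zero> \<and> a \<otimes>\<^bsub>M\<^esub> b = m} \<subseteq> supp f \<times> supp g"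
      by (auto simp: supp_def)
  qed (use assms in \<open>auto simp: not_supp dirac_def\<close>)
  finally show ?thesis using assms by (subst pairing_pairing) (auto simp: dirac_def)
qed

lemma supp_mult:
  assumes "f \<in> carrier R" "g \<in> carrier R"
  shows "supp (f \<otimes>\<^bsub>R\<^esub> g) \<subseteq> (\<lambda>(a, b). a \<otimes>\<^bsub>M\<^esub> b) ` (supp f \<times> supp g)"
proof
  fix m assume m: "m \<in> supp (f \<otimes>\<^bsub>R\<^esub> g)"
  show "m \<in> (\<lambda>(a, b). a \<otimes>\<^bsub>M\<^esub> b) ` (supp f \<times> supp g)"
  proof (rule ccontr)
    assume n: "m \<notin> (\<lambda>(a, b). a \<otimes>\<^bsub>M\<^esub> b) ` (supp f \<times> supp g)"
    have "(f \<otimes>\<^bsub>R\<^esub> g) m = (\<Oplus>p\<in>{(a, b). f a \<noteq> \<zero> \<and> g b \<noteq> \<zero> \<and> a \<otimes>\<^bsub>M\<^esub> b = m}. f (fst p) \<otimes> g (snd p))"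
      by (simp add: monoid_ring_def)
    also have "{(a, b). f a \<noteq> \<zero> \<and> g b \<noteq> \<zero> \<and> a \<otimes>\<^bsub>M\<^esub> b = m} = {}"
      using n by (auto simp: supp_def)
    finally show False using m by (simp add: supp_def)
  qed
qed

lemma mult_closed:
  assumes "f \<in> carrier R" "g \<in> carrier R"
  shows "f \<otimes>\<^bsub>R\<^esub> g \<in> carrier R"
proof -
  have "finite (supp (f \<otimes>\<^bsub>R\<^esub> g))"
    by (rule finite_subset[OF supp_mult[OF assms]]) (use assms in auto)
  moreover have "supp (f \<otimes>\<^bsub>R\<^esub> g) \<subseteq> carrier M"
    using supp_mult[OF assms] assms by (auto dest!: subsetD)
  moreover have "(f \<otimes>\<^bsub>R\<^esub> g) m \<in> carrier K" for m
    using assms by (subst mult_apply) (auto intro!: pairing_closed simp: dirac_def)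
  ultimately show ?thesis by (unfold in_R_iff, blast)
qed

text \<open>On a product a functional becomes a double pairing, so commutativity and associativity
  of \<open>R\<close> reduce to those of \<open>M\<close> inside the argument of
  \<open>u\<close>.\<close>

lemma pairing_mult:
  assumes "f \<in> carrier R" "g \<in> carrier R" "u \<in> carrier M \<rightarrow> carrier K"
  shows "pairing (f \<otimes>\<^bsub>R\<^esub> g) u = pairing f (\<lambda>a. pairing g (\<lambda>b. u (a \<otimes>\<^bsub>M\<^esub> b)))"
proof -
  \<comment> \<open>A finite set containing the support of the product, so that the sums over values
    and over pairs of factors can be interchanged; each pair then contributes at exactly one
    \<open>x\<close>.\<close>
  define X where "X = (\<lambda>(a, b). a \<otimes>\<^bsub>M\<^esub> b) ` (supp f \<times> supp g)"
  have X: "finite X" "supp (f \<otimes>\<^bsub>R\<^esub> g) \<subseteq> X" "X \<subseteq> carrier M"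
    using assms supp_mult[OF assms(1,2)] by (auto simp: X_def)
  let ?T = "supp f \<times> supp g"
  let ?c = "\<lambda>p. f (fst p) \<otimes> g (snd p)"
  let ?p = "\<lambda>p. fst p \<otimes>\<^bsub>M\<^esub> snd p"
  have c: "?c p \<in> carrier K" for p using assms by auto
  have u: "u x \<in> carrier K" if "x \<in> X" for x using that X assms by auto
  have T: "finite ?T" using assms by auto
  have d: "dirac x y \<in> carrier K" for x y by (simp add: dirac_def)
  have "pairing (f \<otimes>\<^bsub>R\<^esub> g) u = (\<Oplus>x\<in>X. (f \<otimes>\<^bsub>R\<^esub> g) x \<otimes> u x)"
    using assms X by (intro pairing_superset mult_closed)
  also have "\<dots> = (\<Oplus>x\<in>X. (\<Oplus>p\<in>?T. ?c p \<otimes> dirac x (?p p)) \<otimes> u x)"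
    using assms u c d by (intro finsum_cong') (auto simp: mult_apply pairing_pairing intro!: finsum_closed m_closed)
  also have "\<dots> = (\<Oplus>x\<in>X. \<Oplus>p\<in>?T. ?c p \<otimes> dirac x (?p p) \<otimes> u x)"
    using assms T u c d by (intro finsum_cong' finsum_ldistr) (auto intro!: finsum_closed m_closed)
  also have "\<dots> = (\<Oplus>p\<in>?T. \<Oplus>x\<in>X. ?c p \<otimes> dirac x (?p p) \<otimes> u x)"
    using T X u c d by (intro finsum_swap) (auto intro!: m_closed)
  also have "\<dots> = (\<Oplus>p\<in>?T. ?c p \<otimes> u (?p p))"
  proof (intro finsum_cong' HOL.refl)
    show "(\<lambda>p. ?c p \<otimes> u (?p p)) \<in> ?T \<rightarrow> carrier K"
      using assms by (auto simp: Pi_iff)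
    fix p assume p: "p \<in> ?T"
    then have pX: "?p p \<in> X" by (auto simp: X_def)
    have "(\<Oplus>x\<in>X. ?c p \<otimes> dirac x (?p p) \<otimes> u x) = (\<Oplus>x\<in>X. if x = ?p p then ?c p \<otimes> u x else \<zero>)"
      using c u by (intro finsum_cong') (auto simp: dirac_def)
    also have "\<dots> = ?c p \<otimes> u (?p p)"
      using finsum_delta[of X "\<lambda>x. ?c p \<otimes> u x" "?p p"] X c u pX by auto
    finally show "(\<Oplus>x\<in>X. ?c p \<otimes> dirac x (?p p) \<otimes> u x) = ?c p \<otimes> u (?p p)" .
  qed
  also have "\<dots> = pairing f (\<lambda>a. pairing g (\<lambda>b. u (a \<otimes>\<^bsub>M\<^esub> b)))"
    using assms by (subst pairing_pairing) auto
  finally show ?thesis .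
qed

lemma add_apply: "(f \<oplus>\<^bsub>R\<^esub> g) m = f m \<oplus> g m"
  by (simp add: monoid_ring_def)

lemma zero_apply: "\<zero>\<^bsub>R\<^esub> m = \<zero>"
  by (simp add: monoid_ring_def)

lemma in_R_I:
  assumes "\<And>m. f m \<in> carrier K" "\<And>m. m \<notin> A \<Longrightarrow> f m = \<zero>" "finite A" "A \<subseteq> carrier M"
  shows "f \<in> carrier R"
proof -
  have "supp f \<subseteq> A" using assms(2) by (auto simp: supp_def)
  then show ?thesis using assms(1,3,4) finite_subset[of "supp f" A] unfolding in_R_iff by blast
qed

lemma add_closed_R: "f \<in> carrier R \<Longrightarrow> g \<in> carrier R \<Longrightarrow> f \<oplus>\<^bsub>R\<^esub> g \<in> carrier R"
  by (rule in_R_I[of _ "supp f \<union> supp g"]) (auto simp: add_apply not_supp)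

lemma smult_closed [intro, simp]: "f \<in> carrier R \<Longrightarrow> c \<in> carrier K \<Longrightarrow> smult c f \<in> carrier R"
  by (rule in_R_I[of _ "supp f"]) (auto simp: smult_def not_supp)

lemma one_eq: "\<one>\<^bsub>R\<^esub> = dirac \<one>\<^bsub>M\<^esub>"
  by (simp add: monoid_ring_def dirac_def)

lemma cring_R: "cring R"
proof (rule cringI)
  show "abelian_group R"
  proof (rule abelian_groupI)
    show "\<zero>\<^bsub>R\<^esub> \<in> carrier R" by (rule in_R_I[of _ "{}"]) (auto simp: zero_apply)
    show "\<exists>g\<in>carrier R. g \<oplus>\<^bsub>R\<^esub> f = \<zero>\<^bsub>R\<^esub>" if "f \<in> carrier R" for f
    proof
      show "smult (\<ominus> \<one>) f \<in> carrier R" using that by auto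
      show "smult (\<ominus> \<one>) f \<oplus>\<^bsub>R\<^esub> f = \<zero>\<^bsub>R\<^esub>"
        using that by (intro ext) (simp add: add_apply zero_apply smult_def l_minus l_neg)
    qed
    show "f \<oplus>\<^bsub>R\<^esub> g \<oplus>\<^bsub>R\<^esub> h = f \<oplus>\<^bsub>R\<^esub> (g \<oplus>\<^bsub>R\<^esub> h)"
      if "f \<in> carrier R" "g \<in> carrier R" "h \<in> carrier R" for f g h
      using that by (intro ext) (simp add: add_apply a_assoc)
    show "f \<oplus>\<^bsub>R\<^esub> g = g \<oplus>\<^bsub>R\<^esub> f" if "f \<in> carrier R" "g \<in> carrier R" for f g
      using that by (intro ext) (simp add: add_apply a_comm)
    show "\<zero>\<^bsub>R\<^esub> \<oplus>\<^bsub>R\<^esub> f = f" if "f \<in> carrier R" for f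
      using that by (intro ext) (simp add: add_apply zero_apply)
  qed (rule add_closed_R)
  show "comm_monoid R"
  proof (rule comm_monoidI)
    show "\<one>\<^bsub>R\<^esub> \<in> carrier R" by (simp add: one_eq)
    show "\<one>\<^bsub>R\<^esub> \<otimes>\<^bsub>R\<^esub> f = f" if "f \<in> carrier R" for f
    proof (intro R_eqI mult_closed that)
      fix u assume u: "u \<in> carrier M \<rightarrow> carrier K"
      have "pairing (\<one>\<^bsub>R\<^esub> \<otimes>\<^bsub>R\<^esub> f) u = pairing f (\<lambda>b. u (\<one>\<^bsub>M\<^esub> \<otimes>\<^bsub>M\<^esub> b))"
        using that u by (simp add: one_eq pairing_mult pairing_dirac_left Pi_iff)
      also have "\<dots> = pairing f u" using that u by (intro pairing_cong) auto
      finally show "pairing (\<one>\<^bsub>R\<^esub> \<otimes>\<^bsub>R\<^esub> f) u = pairing f u" .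
    qed (auto simp: one_eq)
    show "f \<otimes>\<^bsub>R\<^esub> g = g \<otimes>\<^bsub>R\<^esub> f" if "f \<in> carrier R" "g \<in> carrier R" for f g
    proof (intro R_eqI mult_closed that)
      fix u assume u: "u \<in> carrier M \<rightarrow> carrier K"
      have "pairing (f \<otimes>\<^bsub>R\<^esub> g) u = pairing f (\<lambda>a. pairing g (\<lambda>b. u (a \<otimes>\<^bsub>M\<^esub> b)))"
        using that u by (rule pairing_mult)
      also have "\<dots> = pairing g (\<lambda>b. pairing f (\<lambda>a. u (a \<otimes>\<^bsub>M\<^esub> b)))"
        using that u by (intro pairing_swap) auto
      also have "\<dots> = pairing g (\<lambda>b. pairing f (\<lambda>a. u (b \<otimes>\<^bsub>M\<^esub> a)))"
        using that u by (intro pairing_cong2) (auto simp: M.m_comm)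
      also have "\<dots> = pairing (g \<otimes>\<^bsub>R\<^esub> f) u"
        using that u by (intro pairing_mult[symmetric])
      finally show "pairing (f \<otimes>\<^bsub>R\<^esub> g) u = pairing (g \<otimes>\<^bsub>R\<^esub> f) u" .
    qed
    show "f \<otimes>\<^bsub>R\<^esub> g \<otimes>\<^bsub>R\<^esub> h = f \<otimes>\<^bsub>R\<^esub> (g \<otimes>\<^bsub>R\<^esub> h)"
      if "f \<in> carrier R" "g \<in> carrier R" "h \<in> carrier R" for f g h
    proof (intro R_eqI mult_closed that)
      fix u assume u: "u \<in> carrier M \<rightarrow> carrier K"
      have "pairing (f \<otimes>\<^bsub>R\<^esub> g \<otimes>\<^bsub>R\<^esub> h) u
          = pairing f (\<lambda>a. pairing g (\<lambda>b. pairing h (\<lambda>c. u (a \<otimes>\<^bsub>M\<^esub> b \<otimes>\<^bsub>M\<^esub> c))))"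
        using that u by (simp add: pairing_mult mult_closed Pi_iff)
      also have "\<dots> = pairing f (\<lambda>a. pairing g (\<lambda>b. pairing h (\<lambda>c. u (a \<otimes>\<^bsub>M\<^esub> (b \<otimes>\<^bsub>M\<^esub> c)))))"
      proof (rule pairing_cong)
        fix a assume "a \<in> supp f"
        with that have "a \<in> carrier M" by simp
        with that u show "pairing g (\<lambda>b. pairing h (\<lambda>c. u (a \<otimes>\<^bsub>M\<^esub> b \<otimes>\<^bsub>M\<^esub> c)))
            = pairing g (\<lambda>b. pairing h (\<lambda>c. u (a \<otimes>\<^bsub>M\<^esub> (b \<otimes>\<^bsub>M\<^esub> c))))"
          by (intro pairing_cong2) (auto simp: M.m_assoc)
      qed (use that u in \<open>auto simp: Pi_iff\<close>)
      also have "\<dots> = pairing f (\<lambda>a. pairing (g \<otimes>\<^bsub>R\<^esub> h) (\<lambda>x. u (a \<otimes>\<^bsub>M\<^esub> x)))"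
        using that u by (intro pairing_cong) (auto simp: pairing_mult Pi_iff)
      also have "\<dots> = pairing (f \<otimes>\<^bsub>R\<^esub> (g \<otimes>\<^bsub>R\<^esub> h)) u"
        using that u by (intro pairing_mult[symmetric] mult_closed)
      finally show "pairing (f \<otimes>\<^bsub>R\<^esub> g \<otimes>\<^bsub>R\<^esub> h) u = pairing (f \<otimes>\<^bsub>R\<^esub> (g \<otimes>\<^bsub>R\<^esub> h)) u" .
    qed
  qed (rule mult_closed)
  show "(f \<oplus>\<^bsub>R\<^esub> g) \<otimes>\<^bsub>R\<^esub> h = f \<otimes>\<^bsub>R\<^esub> h \<oplus>\<^bsub>R\<^esub> g \<otimes>\<^bsub>R\<^esub> h"
    if "f \<in> carrier R" "g \<in> carrier R" "h \<in> carrier R" for f g h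
  proof (rule R_eqI)
    fix u assume u: "u \<in> carrier M \<rightarrow> carrier K"
    have v: "(\<lambda>a. pairing h (\<lambda>b. u (a \<otimes>\<^bsub>M\<^esub> b))) \<in> carrier M \<rightarrow> carrier K"
      using that u by auto
    note fh = pairing_mult[OF that(1,3) u] and gh = pairing_mult[OF that(2,3) u]
    have "pairing ((f \<oplus>\<^bsub>R\<^esub> g) \<otimes>\<^bsub>R\<^esub> h) u
        = pairing (f \<oplus>\<^bsub>R\<^esub> g) (\<lambda>a. pairing h (\<lambda>b. u (a \<otimes>\<^bsub>M\<^esub> b)))"
      by (intro pairing_mult add_closed_R that u)
    also have "\<dots> = pairing (f \<otimes>\<^bsub>R\<^esub> h) u \<oplus> pairing (g \<otimes>\<^bsub>R\<^esub> h) u"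
      unfolding fh gh by (intro pairing_add_left add_closed_R that v)
    also have "\<dots> = pairing (f \<otimes>\<^bsub>R\<^esub> h \<oplus>\<^bsub>R\<^esub> g \<otimes>\<^bsub>R\<^esub> h) u"
      by (intro pairing_add_left[symmetric] add_closed_R mult_closed that u)
    finally show "pairing ((f \<oplus>\<^bsub>R\<^esub> g) \<otimes>\<^bsub>R\<^esub> h) u = pairing (f \<otimes>\<^bsub>R\<^esub> h \<oplus>\<^bsub>R\<^esub> g \<otimes>\<^bsub>R\<^esub> h) u" .
  qed (intro add_closed_R mult_closed that)+
qed
sublocale R: cring R by (rule cring_R)

lemma dirac_mult:
  assumes "a \<in> carrier M" "b \<in> carrier M"
  shows "dirac a \<otimes>\<^bsub>R\<^esub> dirac b = dirac (a \<otimes>\<^bsub>M\<^esub> b)"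
proof (rule R_eqI)
  fix u assume "u \<in> carrier M \<rightarrow> carrier K"
  then show "pairing (dirac a \<otimes>\<^bsub>R\<^esub> dirac b) u = pairing (dirac (a \<otimes>\<^bsub>M\<^esub> b)) u"
    using assms by (simp add: pairing_mult pairing_dirac_left Pi_iff)
qed (use assms in auto)

lemma smult_mult:
  assumes "c \<in> carrier K" "f \<in> carrier R" "g \<in> carrier R"
  shows "smult c f \<otimes>\<^bsub>R\<^esub> g = smult c (f \<otimes>\<^bsub>R\<^esub> g)"
proof (rule R_eqI)
  fix u assume u: "u \<in> carrier M \<rightarrow> carrier K"
  have v: "(\<lambda>a. pairing g (\<lambda>b. u (a \<otimes>\<^bsub>M\<^esub> b))) \<in> carrier M \<rightarrow> carrier K"
    using assms(3) u by auto
  have "pairing (smult c f \<otimes>\<^bsub>R\<^esub> g) u = pairing (smult c f) (\<lambda>a. pairing g (\<lambda>b. u (a \<otimes>\<^bsub>M\<^esub> b)))"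
    by (intro pairing_mult smult_closed assms u)
  also have "\<dots> = c \<otimes> pairing f (\<lambda>a. pairing g (\<lambda>b. u (a \<otimes>\<^bsub>M\<^esub> b)))"
    by (intro pairing_smult_left smult_closed assms v)
  also have "\<dots> = c \<otimes> pairing (f \<otimes>\<^bsub>R\<^esub> g) u"
    by (simp only: pairing_mult[OF assms(2,3) u])
  also have "\<dots> = pairing (smult c (f \<otimes>\<^bsub>R\<^esub> g)) u"
    by (intro pairing_smult_left[symmetric] smult_closed mult_closed assms u)
  finally show "pairing (smult c f \<otimes>\<^bsub>R\<^esub> g) u = pairing (smult c (f \<otimes>\<^bsub>R\<^esub> g)) u" .
qed (use assms in auto)

text \<open>A scalar acts as multiplication by a ring element, namely \<open>smult c\<close> of the
  unit, so every ideal is a subspace.\<close>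

lemma ideal_smult:
  assumes "ideal I R" "f \<in> I" "c \<in> carrier K"
  shows "smult c f \<in> I"
proof -
  have f: "f \<in> carrier R" using assms(1,2) by (rule ideal.Icarr)
  have "smult c f = smult c \<one>\<^bsub>R\<^esub> \<otimes>\<^bsub>R\<^esub> f"
    using f assms(3) by (simp add: smult_mult)
  then show ?thesis
    using ideal.I_l_closed[OF assms(1,2), of "smult c \<one>\<^bsub>R\<^esub>"] assms(3) by simp
qed

text \<open>Strip off one term of the support at a time. The contrapositive extracts from an element
  outside a prime a single basis element outside it.\<close>

lemma ideal_supp:
  assumes "ideal I R" "f \<in> carrier R" "\<And>m. m \<in> supp f \<Longrightarrow> dirac m \<in> I"
  shows "f \<in> I"
proof -
  interpret I: ideal I R by fact
  have "f \<in> I" if "finite A" "f \<in> carrier R" "supp f \<subseteq> A" "\<And>m. m \<in> supp f \<Longrightarrow> dirac m \<in> I" for A f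
    using that
  proof (induction A arbitrary: f rule: finite_induct)
    case empty
    then have "f = \<zero>\<^bsub>R\<^esub>" by (intro ext) (auto simp: zero_apply not_supp)
    then show ?case by simp
  next
    case (insert x A)
    show ?case
    proof (cases "x \<in> supp f")
      case False
      then show ?thesis using insert by blast
    next
      case True
      define g where "g = f(x := \<zero>)"
      have g: "g \<in> carrier R"
        using insert.prems(1) by (intro in_R_I[of _ "supp f"]) (auto simp: g_def not_supp)
      have sg: "supp g \<subseteq> supp f" "x \<notin> supp g" by (auto simp: g_def supp_def)
      have "g \<in> I"
      proof (rule insert.IH[OF g])
        show "supp g \<subseteq> A" using sg insert.prems(2) by blast
        show "dirac m \<in> I" if "m \<in> supp g" for m using sg that insert.prems(3) by blast
      qed
      moreover have "smult (f x) (dirac x) \<in> I"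
        using insert.prems(3)[OF True] R_coeff[OF insert.prems(1)] by (rule ideal_smult[OF assms(1)])
      moreover have eq: "f = smult (f x) (dirac x) \<oplus>\<^bsub>R\<^esub> g"
        using insert.prems(1) by (intro ext) (auto simp: add_apply smult_def dirac_def g_def)
      ultimately show ?thesis by (subst eq) (intro I.a_closed)
    qed
  qed
  then show ?thesis using assms by blast
qed

lemma pairing_finsum:
  assumes "finite J" "\<And>j. j \<in> J \<Longrightarrow> F j \<in> carrier R" "u \<in> carrier M \<rightarrow> carrier K"
  shows "pairing (\<Oplus>\<^bsub>R\<^esub>j\<in>J. F j) u = (\<Oplus>j\<in>J. pairing (F j) u)"
  using assms(1,2)
proof (induction J rule: finite_induct)
  case empty
  show ?case by (simp add: pairing_def supp_def zero_apply)
next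
  case (insert x J)
  have "pairing (F x \<oplus>\<^bsub>R\<^esub> (\<Oplus>\<^bsub>R\<^esub>j\<in>J. F j)) u = pairing (F x) u \<oplus> pairing (\<Oplus>\<^bsub>R\<^esub>j\<in>J. F j) u"
    using insert assms(3) by (intro pairing_add_left) (auto intro!: R.finsum_closed R.a_closed)
  with insert show ?case using assms(3) by (subst R.finsum_insert) (auto simp: Pi_iff)
qed

text \<open>Modulo \<open>Q\<close> only the term \<open>F 0\<close> survives, and it vanishes by
  the hypothesis on \<open>F\<close>. The rest is divisible by \<open>x\<close>, which can be
  cancelled modulo the prime \<open>P\<close>; then the coefficients are shifted and the argument
  repeats. The hypothesis that \<open>F e\<close> vanishes once it lies in \<open>Q\<close> stands
  for independence modulo \<open>Q\<close> of whatever the coefficients are built from.\<close>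

lemma pull_out_powers:
  fixes n :: nat
  assumes "primeideal P R" "ideal Q R" "P \<subseteq> Q" "x \<in> Q" "x \<notin> P"
    and "\<And>e. e < n \<Longrightarrow> F e \<in> carrier R" "\<And>e. e < n \<Longrightarrow> F e \<in> Q \<Longrightarrow> F e = \<zero>\<^bsub>R\<^esub>"
    and "(\<Oplus>\<^bsub>R\<^esub>e\<in>{..<n}. x [^]\<^bsub>R\<^esub> e \<otimes>\<^bsub>R\<^esub> F e) \<in> P"
  shows "\<forall>e<n. F e = \<zero>\<^bsub>R\<^esub>"
  using assms(6-)
proof (induction n arbitrary: F)
  case (Suc n)
  interpret P: primeideal P R by fact
  interpret Q: ideal Q R by fact
  have x: "x \<in> carrier R" using assms(4) by (rule Q.Icarr)
  let ?g = "\<lambda>e. x [^]\<^bsub>R\<^esub> e \<otimes>\<^bsub>R\<^esub> F e"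
  let ?h = "\<Oplus>\<^bsub>R\<^esub>e\<in>{..<n}. x [^]\<^bsub>R\<^esub> e \<otimes>\<^bsub>R\<^esub> F (Suc e)"
  have FR: "\<And>e. e \<in> {..<n} \<Longrightarrow> F (Suc e) \<in> carrier R" using Suc.prems(1) by simp
  have F: "F 0 \<in> carrier R" using Suc.prems(1) by simp
  have h: "?h \<in> carrier R" using FR x by (intro R.finsum_closed) simp
  have "(\<Oplus>\<^bsub>R\<^esub>e\<in>{..<Suc n}. ?g e) = ?g 0 \<oplus>\<^bsub>R\<^esub> (\<Oplus>\<^bsub>R\<^esub>e\<in>Suc ` {..<n}. ?g e)"
    unfolding lessThan_Suc_eq_insert_0 using FR F x by (intro R.finsum_insert) auto
  also have "(\<Oplus>\<^bsub>R\<^esub>e\<in>Suc ` {..<n}. ?g e) = (\<Oplus>\<^bsub>R\<^esub>e\<in>{..<n}. ?g (Suc e))"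
    using FR x by (intro R.finsum_reindex) auto
  also have "\<dots> = (\<Oplus>\<^bsub>R\<^esub>e\<in>{..<n}. x \<otimes>\<^bsub>R\<^esub> (x [^]\<^bsub>R\<^esub> e \<otimes>\<^bsub>R\<^esub> F (Suc e)))"
    using FR x by (intro R.finsum_cong') (auto simp: R.m_ac)
  also have "\<dots> = x \<otimes>\<^bsub>R\<^esub> ?h"
    using FR x by (intro R.finsum_rdistr[symmetric]) auto
  also have "?g 0 = F 0" using F by simp
  finally have eq: "(\<Oplus>\<^bsub>R\<^esub>e\<in>{..<Suc n}. ?g e) = F 0 \<oplus>\<^bsub>R\<^esub> x \<otimes>\<^bsub>R\<^esub> ?h" .
  have "x \<otimes>\<^bsub>R\<^esub> ?h \<in> Q" using assms(4) h by (rule Q.I_r_closed)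
  moreover have "F 0 \<oplus>\<^bsub>R\<^esub> x \<otimes>\<^bsub>R\<^esub> ?h \<in> Q" using Suc.prems(3) unfolding eq using assms(3) by blast
  ultimately have "(F 0 \<oplus>\<^bsub>R\<^esub> x \<otimes>\<^bsub>R\<^esub> ?h) \<ominus>\<^bsub>R\<^esub> x \<otimes>\<^bsub>R\<^esub> ?h \<in> Q"
    unfolding R.minus_eq by (blast intro: Q.a_closed[OF _ Q.a_inv_closed])
  also have "(F 0 \<oplus>\<^bsub>R\<^esub> x \<otimes>\<^bsub>R\<^esub> ?h) \<ominus>\<^bsub>R\<^esub> x \<otimes>\<^bsub>R\<^esub> ?h = F 0"
    using F h x by (simp add: R.minus_eq R.a_assoc R.r_neg)
  finally have F0: "F 0 = \<zero>\<^bsub>R\<^esub>" by (rule Suc.prems(2)[OF zero_less_Suc])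
  \<comment> \<open>With \<open>F 0\<close> gone, primality of \<open>P\<close> cancels
    \<open>x\<close>.\<close>
  have "x \<otimes>\<^bsub>R\<^esub> ?h \<in> P" using Suc.prems(3) unfolding eq F0 using h x by simp
  then have hP: "?h \<in> P" using P.I_prime[OF x h] assms(5) by blast
  have "\<forall>e<n. F (Suc e) = \<zero>\<^bsub>R\<^esub>"
    by (rule Suc.IH[OF _ _ hP]) (use FR Suc.prems(2) in simp_all)
  with F0 show ?case using less_Suc_eq_0_disj by auto
qed simp

section \<open>Monomials and their independence modulo a prime\<close>

primrec monomial :: "('m \<Rightarrow> 'k) list \<Rightarrow> nat list \<Rightarrow> 'm \<Rightarrow> 'k" where
  "monomial [] es = \<one>\<^bsub>R\<^esub>"
| "monomial (x # xs) es = x [^]\<^bsub>R\<^esub> hd es \<otimes>\<^bsub>R\<^esub> monomial xs (tl es)"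

lemma monomial_closed [simp]: "set xs \<subseteq> carrier R \<Longrightarrow> monomial xs es \<in> carrier R"
  by (induction xs arbitrary: es) auto

text \<open>Exponent vectors with entries below \<open>n\<close>. Their number n^d is what is later
  compared with a bound of degree \<open>r\<close> in \<open>n\<close>.\<close>

definition exponents :: "nat \<Rightarrow> nat \<Rightarrow> nat list set" where
  "exponents d n = {es. set es \<subseteq> {..<n} \<and> length es = d}"

lemma finite_exponents [simp]: "finite (exponents d n)"
  and card_exponents: "card (exponents d n) = n ^ d"
  unfolding exponents_def by (simp_all add: finite_lists_length_eq card_lists_length_eq)

lemma exponents_0: "exponents 0 n = {[]}"
  and exponents_Suc: "exponents (Suc d) n = (\<lambda>(e, es). e # es) ` ({..<n} \<times> exponents d n)"
  unfolding exponents_def by (auto simp: length_Suc_conv)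

text \<open>Induction along the chain. By the induction hypothesis the monomials in the later
  elements are independent modulo \<open>P (Suc 0)\<close>. Collecting powers of the first element
  \<open>x\<close>, which lies in \<open>P (Suc 0)\<close> but not in \<open>P 0\<close>, brings the
  relation into the form of \<open>pull_out_powers\<close>. At the end of the chain only a scalar is
  left, and a nonzero scalar is a unit, hence in no prime.\<close>

lemma algebraic_independence:
  assumes "\<And>i. i \<le> length xs \<Longrightarrow> primeideal (P i) R"
    and "\<And>i. i < length xs \<Longrightarrow> P i \<subseteq> P (Suc i) \<and> xs ! i \<in> P (Suc i) \<and> xs ! i \<notin> P i"
    and "\<And>es. a es \<in> carrier K"
    and "(\<Oplus>\<^bsub>R\<^esub>es\<in>exponents (length xs) n. smult (a es) (monomial xs es)) \<in> P 0"
    and "es \<in> exponents (length xs) n"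
  shows "a es = \<zero>"
  using assms
proof (induction xs arbitrary: P a es)
  case Nil
  have p: "primeideal (P 0) R" using Nil(1) by simp
  interpret P: primeideal "P 0" R by fact
  have a: "smult (a []) \<one>\<^bsub>R\<^esub> \<in> P 0" using Nil(3,4) by (simp add: exponents_0)
  show ?case
  proof (rule ccontr)
    assume "a es \<noteq> \<zero>"
    then have "a [] \<in> Units K" using Nil(3,5) field_Units by (auto simp: exponents_0)
    then have inv: "inv (a []) \<in> carrier K" "inv (a []) \<otimes> a [] = \<one>" by auto
    have "smult (inv (a [])) (smult (a []) \<one>\<^bsub>R\<^esub>) \<in> P 0"
      using P.is_ideal a inv(1) by (rule ideal_smult)
    also have "smult (inv (a [])) (smult (a []) \<one>\<^bsub>R\<^esub>) = \<one>\<^bsub>R\<^esub>"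
      using inv Nil(3) R_coeff[OF R.one_closed] by (intro ext) (simp add: smult_def flip: m_assoc)
    finally show False using P.one_imp_carrier P.I_notcarr by blast
  qed
next
  case (Cons x xs P a es)
  \<comment> \<open>The coefficient of the \<open>e\<close>-th power of \<open>x\<close>, a
    polynomial in the remaining elements.\<close>
  let ?F = "\<lambda>e. \<Oplus>\<^bsub>R\<^esub>es\<in>exponents (length xs) n. smult (a (e # es)) (monomial xs es)"
  have P: "primeideal (P 0) R" "primeideal (P (Suc 0)) R" and x: "P 0 \<subseteq> P (Suc 0)" "x \<in> P (Suc 0)" "x \<notin> P 0"
    using Cons.prems(1)[of 0] Cons.prems(1)[of 1] Cons.prems(2)[of 0] by auto
  interpret Q: primeideal "P (Suc 0)" R by fact
  have xc: "x \<in> carrier R" using x(2) by (rule Q.Icarr)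
  have xsc: "set xs \<subseteq> carrier R"
  proof
    fix y assume "y \<in> set xs"
    then obtain i where "i < length xs" "y = xs ! i" by (auto simp: in_set_conv_nth)
    then show "y \<in> carrier R"
      using Cons.prems(1)[of "Suc (Suc i)"] Cons.prems(2)[of "Suc i"]
      by (auto dest: ideal.Icarr[OF primeideal.axioms(1)])
  qed
  have F: "?F e \<in> carrier R" for e using xsc Cons.prems(3) by (intro R.finsum_closed) auto
  have IH: "a (e # es) = \<zero>" if "?F e \<in> P (Suc 0)" "es \<in> exponents (length xs) n" for e es
  proof (rule Cons.IH[of "\<lambda>i. P (Suc i)" "\<lambda>es. a (e # es)"])
    show "P (Suc i) \<subseteq> P (Suc (Suc i)) \<and> xs ! i \<in> P (Suc (Suc i)) \<and> xs ! i \<notin> P (Suc i)"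
      if "i < length xs" for i
      using Cons.prems(2)[of "Suc i"] that by simp
    show "primeideal (P (Suc i)) R" if "i \<le> length xs" for i
      using Cons.prems(1)[of "Suc i"] that by simp
  qed (use Cons.prems(3) that in simp_all)
  \<comment> \<open>The premise of \<open>pull_out_powers\<close>: all scalars in
    \<open>?F e\<close> vanish, so it is zero in \<open>R\<close> and not merely modulo the
    prime.\<close>
  have F0: "?F e = \<zero>\<^bsub>R\<^esub>" if "?F e \<in> P (Suc 0)" for e
  proof -
    have "?F e = (\<Oplus>\<^bsub>R\<^esub>es\<in>exponents (length xs) n. \<zero>\<^bsub>R\<^esub>)"
      using IH[OF that] xsc by (intro R.finsum_cong') (auto simp: smult_def fun_eq_iff zero_apply)
    then show ?thesis by simp
  qed
  have "(\<Oplus>\<^bsub>R\<^esub>es\<in>exponents (length (x # xs)) n. smult (a es) (monomial (x # xs) es))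
      = (\<Oplus>\<^bsub>R\<^esub>p\<in>{..<n} \<times> exponents (length xs) n. smult (a (fst p # snd p)) (monomial (x # xs) (fst p # snd p)))"
    unfolding length_Cons exponents_Suc
    using xc xsc Cons.prems(3) by (subst R.finsum_reindex) (auto simp: inj_on_def case_prod_beta)
  also have "\<dots> = (\<Oplus>\<^bsub>R\<^esub>e\<in>{..<n}. \<Oplus>\<^bsub>R\<^esub>es\<in>exponents (length xs) n. smult (a (e # es)) (monomial (x # xs) (e # es)))"
    using xc xsc Cons.prems(3) by (subst R.finsum_Times) auto
  also have "\<dots> = (\<Oplus>\<^bsub>R\<^esub>e\<in>{..<n}. x [^]\<^bsub>R\<^esub> e \<otimes>\<^bsub>R\<^esub> ?F e)"
  proof (intro R.finsum_cong' HOL.refl)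
    fix e
    have "x [^]\<^bsub>R\<^esub> e \<otimes>\<^bsub>R\<^esub> ?F e = (\<Oplus>\<^bsub>R\<^esub>es\<in>exponents (length xs) n. x [^]\<^bsub>R\<^esub> e \<otimes>\<^bsub>R\<^esub> smult (a (e # es)) (monomial xs es))"
      using xc xsc Cons.prems(3) by (intro R.finsum_rdistr) auto
    also have "\<dots> = (\<Oplus>\<^bsub>R\<^esub>es\<in>exponents (length xs) n. smult (a (e # es)) (monomial (x # xs) (e # es)))"
    proof (intro R.finsum_cong' HOL.refl)
      fix es
      have "x [^]\<^bsub>R\<^esub> e \<otimes>\<^bsub>R\<^esub> smult (a (e # es)) (monomial xs es) = smult (a (e # es)) (monomial xs es \<otimes>\<^bsub>R\<^esub> x [^]\<^bsub>R\<^esub> e)"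
        using xc xsc Cons.prems(3) by (simp add: R.m_comm[of "x [^]\<^bsub>R\<^esub> e"] smult_mult)
      then show "x [^]\<^bsub>R\<^esub> e \<otimes>\<^bsub>R\<^esub> smult (a (e # es)) (monomial xs es) = smult (a (e # es)) (monomial (x # xs) (e # es))"
        using xc xsc by (simp add: R.m_comm[of "x [^]\<^bsub>R\<^esub> e"])
    qed (use xc xsc Cons.prems(3) in auto)
    finally show "(\<Oplus>\<^bsub>R\<^esub>es\<in>exponents (length xs) n. smult (a (e # es)) (monomial (x # xs) (e # es))) = x [^]\<^bsub>R\<^esub> e \<otimes>\<^bsub>R\<^esub> ?F e" by simp
  qed (use xc F in auto)
  finally have "(\<Oplus>\<^bsub>R\<^esub>e\<in>{..<n}. x [^]\<^bsub>R\<^esub> e \<otimes>\<^bsub>R\<^esub> ?F e) \<in> P 0" using Cons.prems(4) by simp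
  then have "\<forall>e<n. ?F e = \<zero>\<^bsub>R\<^esub>"
    using P(1) Q.is_ideal x F F0 by (intro pull_out_powers[of "P 0" "P (Suc 0)" x])
  moreover obtain e es' where es': "es = e # es'" "e < n" "es' \<in> exponents (length xs) n"
    using Cons.prems(5) by (auto simp: exponents_Suc)
  ultimately have "?F e \<in> P (Suc 0)" by simp
  then show ?case unfolding es'(1) using es'(3) by (rule IH)
qed

end

section \<open>Chains of primes in a monoid algebra\<close>

context monoid_algebra
begin

lemma length_bound_mult:
  fixes len :: "'m \<Rightarrow> nat"
  assumes "\<And>a b. a \<in> carrier M \<Longrightarrow> b \<in> carrier M \<Longrightarrow> len (a \<otimes>\<^bsub>M\<^esub> b) = len a + len b"
    and "f \<in> carrier R" "g \<in> carrier R"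
    and "\<forall>m\<in>supp f. len m \<le> k" "\<forall>m\<in>supp g. len m \<le> l"
  shows "\<forall>m\<in>supp (f \<otimes>\<^bsub>R\<^esub> g). len m \<le> k + l"
proof
  fix m assume "m \<in> supp (f \<otimes>\<^bsub>R\<^esub> g)"
  then obtain a b where "a \<in> supp f" "b \<in> supp g" "m = a \<otimes>\<^bsub>M\<^esub> b"
    using supp_mult[OF assms(2,3)] by auto
  then show "len m \<le> k + l"
    using assms(1)[of a b] assms(4,5) R_supp[OF assms(2)] R_supp[OF assms(3)]
    by (simp add: add_mono)
qed

lemma length_bound_monomial:
  fixes len :: "'m \<Rightarrow> nat"
  assumes len: "\<And>a b. a \<in> carrier M \<Longrightarrow> b \<in> carrier M \<Longrightarrow> len (a \<otimes>\<^bsub>M\<^esub> b) = len a + len b"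
    and "set xs \<subseteq> carrier R" "\<forall>x\<in>set xs. \<forall>m\<in>supp x. len m \<le> l" "es \<in> exponents (length xs) n"
  shows "\<forall>m\<in>supp (monomial xs es). len m \<le> length xs * (n * l)"
  using assms(2-)
proof (induction xs arbitrary: es)
  case Nil
  have "len \<one>\<^bsub>M\<^esub> = 0" using len[of "\<one>\<^bsub>M\<^esub>" "\<one>\<^bsub>M\<^esub>"] by simp
  then show ?case using supp_dirac by (auto simp: one_eq)
next
  case (Cons x xs)
  have x: "x \<in> carrier R" "\<forall>m\<in>supp x. len m \<le> l" and xs: "set xs \<subseteq> carrier R"
    using Cons.prems by auto
  have one: "\<forall>m\<in>supp \<one>\<^bsub>R\<^esub>. len m \<le> 0"
    using supp_dirac len[of "\<one>\<^bsub>M\<^esub>" "\<one>\<^bsub>M\<^esub>"] by (auto simp: one_eq)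
  have pow: "\<forall>m\<in>supp (x [^]\<^bsub>R\<^esub> e). len m \<le> e * l" for e :: nat
  proof (induction e)
    case 0
    then show ?case using one by simp
  next
    case (Suc e)
    have "\<forall>m\<in>supp (x [^]\<^bsub>R\<^esub> e \<otimes>\<^bsub>R\<^esub> x). len m \<le> e * l + l"
      using Suc x by (intro length_bound_mult len) auto
    then show ?case by (simp add: add.commute)
  qed
  obtain e es' where es: "es = e # es'" "e < n" "es' \<in> exponents (length xs) n"
    using Cons.prems(3) by (auto simp: exponents_Suc)
  have "\<forall>m\<in>supp (monomial xs es'). len m \<le> length xs * (n * l)"
    using Cons.prems(2) es(3) xs by (intro Cons.IH) auto
  then have "\<forall>m\<in>supp (monomial (x # xs) es). len m \<le> e * l + length xs * (n * l)"
    using x xs pow unfolding es(1) monomial.simps list.sel by (intro length_bound_mult len) auto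
  moreover have "e * l + length xs * (n * l) \<le> length (x # xs) * (n * l)" using es(2) by simp
  ultimately show ?case using order_trans by blast
qed

text \<open>A chain of length \<open>d\<close> gives n^d independent monomials with exponents below
  \<open>n\<close>, whose supports have length linear in \<open>n\<close>. If there were fewer
  products of \<open>m0\<close> with elements of \<open>S\<close> up to that length, linear algebra
  would give a nontrivial combination whose part on \<open>S\<close> is killed by \<open>m0\<close>.
  As \<open>m0\<close> is outside \<open>P 0\<close> and all basis elements off \<open>S\<close> are
  inside, this combination would lie in \<open>P 0\<close>. So n^d is bounded by a polynomial of
  degree \<open>r\<close> in \<open>n\<close>.\<close>

lemma prime_chain_length:
  fixes d r B :: nat and len :: "'m \<Rightarrow> nat"
  assumes prime: "\<And>i. i \<le> d \<Longrightarrow> primeideal (P i) R" and chain: "\<And>i. i < d \<Longrightarrow> P i \<subset> P (Suc i)"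
    and m0: "m0 \<in> carrier M" "dirac m0 \<notin> P 0"
    and S: "S \<subseteq> carrier M" "\<And>m. m \<in> carrier M - S \<Longrightarrow> dirac m \<in> P 0"
    and len: "\<And>a b. a \<in> carrier M \<Longrightarrow> b \<in> carrier M \<Longrightarrow> len (a \<otimes>\<^bsub>M\<^esub> b) = len a + len b"
    and count: "\<And>L. finite {m0 \<otimes>\<^bsub>M\<^esub> t | t. t \<in> S \<and> len t \<le> L}"
      "\<And>L. card {m0 \<otimes>\<^bsub>M\<^esub> t | t. t \<in> S \<and> len t \<le> L} \<le> B * (L + 1) ^ r"
  shows "d \<le> r"
proof -
  have "\<exists>x. \<forall>i<d. x i \<in> P (Suc i) - P i" using chain by (intro choice) blast
  then obtain x where x: "\<And>i. i < d \<Longrightarrow> x i \<in> P (Suc i)" "\<And>i. i < d \<Longrightarrow> x i \<notin> P i" by blast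
  define xs where "xs = map x [0..<d]"
  have lxs: "length xs = d" by (simp add: xs_def)
  have xR: "x i \<in> carrier R" if "i < d" for i
  proof (rule ideal.Icarr[OF primeideal.axioms(1)])
    show "primeideal (P (Suc i)) R" using prime[of "Suc i"] that by simp
    show "x i \<in> P (Suc i)" using x that by blast
  qed
  have xsR: "set xs \<subseteq> carrier R" using xR by (auto simp: xs_def)
  have "finite (\<Union>y\<in>set xs. len ` supp y)" using xsR by auto
  then obtain l where l: "\<forall>k\<in>(\<Union>y\<in>set xs. len ` supp y). k \<le> l"
    using finite_nat_set_iff_bounded_le by blast
  have lb: "\<forall>m\<in>supp (monomial xs es). len m \<le> d * (n * l)" if "es \<in> exponents d n" for es n
    using length_bound_monomial[OF len xsR, of l es n] l that lxs by auto
  interpret P0: primeideal "P 0" R by (rule prime) simp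
  have bound: "n ^ d \<le> B * (d * (n * l) + 1) ^ r" for n
  proof (rule ccontr)
    define L where "L = d * (n * l)"
    define T where "T = {m0 \<otimes>\<^bsub>M\<^esub> t | t. t \<in> S \<and> len t \<le> L}"
    define J where "J = exponents d n"
    \<comment> \<open>\<open>\<phi> t f\<close> is the coefficient at \<open>t\<close> of the
      product of \<open>m0\<close> with the part of \<open>f\<close> supported on
      \<open>S\<close>.\<close>
    define \<phi> where "\<phi> t f = pairing f (\<lambda>b. if b \<in> S \<and> m0 \<otimes>\<^bsub>M\<^esub> b = t then \<one> else \<zero>)" for t f
    assume "\<not> n ^ d \<le> B * (d * (n * l) + 1) ^ r"
    then have "card T < card J"
      using count(2)[of L] by (simp add: T_def J_def L_def card_exponents)
    moreover have monomial_R: "monomial xs es \<in> carrier R" for es using xsR by simp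
    moreover have \<phi>_closed: "\<phi> t f \<in> carrier K" if "f \<in> carrier R" for t f
      unfolding \<phi>_def using that by (intro pairing_closed) auto
    ultimately obtain a where a: "\<And>j. a j \<in> carrier K" "\<exists>j\<in>J. a j \<noteq> \<zero>"
        "\<And>t. t \<in> T \<Longrightarrow> (\<Oplus>j\<in>J. a j \<otimes> \<phi> t (monomial xs j)) = \<zero>"
      using exists_linear_dependence[of T J "\<lambda>j t. \<phi> t (monomial xs j)"] count(1)[of L]
      by (auto simp: T_def J_def)
    define q where "q = (\<Oplus>\<^bsub>R\<^esub>j\<in>J. smult (a j) (monomial xs j))"
    have sm: "smult (a j) (monomial xs j) \<in> carrier R" for j using monomial_R a(1) by simp
    have qR: "q \<in> carrier R" unfolding q_def using sm by (intro R.finsum_closed) auto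
    have pq: "pairing q u = (\<Oplus>j\<in>J. a j \<otimes> pairing (monomial xs j) u)" if u: "u \<in> carrier M \<rightarrow> carrier K" for u
    proof -
      have "pairing q u = (\<Oplus>j\<in>J. pairing (smult (a j) (monomial xs j)) u)"
        unfolding q_def using sm u by (intro pairing_finsum) (auto simp: J_def)
      also have "\<dots> = (\<Oplus>j\<in>J. a j \<otimes> pairing (monomial xs j) u)"
        using pairing_smult_left[OF monomial_R sm u a(1)] pairing_closed[OF monomial_R u] a(1)
        by (intro finsum_cong') auto
      finally show ?thesis .
    qed
    have \<phi>q: "\<phi> t q = \<zero>" for t
    proof (cases "t \<in> T")
      case True
      then show ?thesis using a(3)[of t] pq[of "\<lambda>b. if b \<in> S \<and> m0 \<otimes>\<^bsub>M\<^esub> b = t then \<one> else \<zero>"]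
        by (simp add: \<phi>_def)
    next
      case False
      \<comment> \<open>The supports of the monomials are too short to reach a \<open>t\<close>
        outside \<open>T\<close>, so it was enough to kill the coordinates in
        \<open>T\<close>.\<close>
      have "\<phi> t (monomial xs j) = \<zero>" if "j \<in> J" for j
      proof -
        have "\<phi> t (monomial xs j) = pairing (monomial xs j) (\<lambda>b. \<zero>)"
          unfolding \<phi>_def using False lb[of j n] that
          by (intro pairing_cong monomial_R) (auto simp: T_def J_def L_def)
        then show ?thesis using pairing_zero_right[OF monomial_R] by simp
      qed
      then have "(\<Oplus>j\<in>J. a j \<otimes> \<phi> t (monomial xs j)) = (\<Oplus>j\<in>J. \<zero>)"
        using a(1) by (intro finsum_cong') auto
      then show ?thesis using pq[of "\<lambda>b. if b \<in> S \<and> m0 \<otimes>\<^bsub>M\<^esub> b = t then \<one> else \<zero>"]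
        by (simp add: \<phi>_def)
    qed
    \<comment> \<open>The part of \<open>q\<close> on \<open>S\<close> is put into
      \<open>P 0\<close> by cancelling \<open>m0\<close>, the part off \<open>S\<close> by the
      hypothesis on \<open>P 0\<close>.\<close>
    define p where "p = (\<lambda>m. if m \<in> S then q m else \<zero>)"
    define p' where "p' = (\<lambda>m. if m \<in> S then \<zero> else q m)"
    have pR: "p \<in> carrier R" and p'R: "p' \<in> carrier R"
      using qR by (auto intro!: in_R_I[of _ "supp q"] simp: p_def p'_def not_supp R_supp_subset)
    have "(dirac m0 \<otimes>\<^bsub>R\<^esub> p) t = \<zero>" for t
    proof -
      have "(dirac m0 \<otimes>\<^bsub>R\<^esub> p) t = pairing p (\<lambda>b. dirac t (m0 \<otimes>\<^bsub>M\<^esub> b))"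
        using mult_apply[OF dirac_in_R[OF m0(1)] pR, of t] pR m0(1)
        by (subst (asm) pairing_dirac_left) (auto simp: dirac_def)
      also have "\<dots> = (\<Oplus>b\<in>supp q. p b \<otimes> dirac t (m0 \<otimes>\<^bsub>M\<^esub> b))"
      proof (rule pairing_superset[OF pR])
        show "supp p \<subseteq> supp q" by (auto simp: p_def supp_def)
      qed (use qR R_supp_subset in \<open>auto simp: dirac_def\<close>)
      also have "\<dots> = \<phi> t q"
        unfolding \<phi>_def pairing_def using qR
        by (intro finsum_cong') (auto simp: p_def dirac_def)
      finally show ?thesis using \<phi>q by simp
    qed
    then have "dirac m0 \<otimes>\<^bsub>R\<^esub> p = \<zero>\<^bsub>R\<^esub>" by (intro ext) (simp add: zero_apply)
    then have "dirac m0 \<otimes>\<^bsub>R\<^esub> p \<in> P 0" using P0.zero_closed by simp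
    then have "p \<in> P 0" using P0.I_prime[OF dirac_in_R[OF m0(1)] pR] m0(2) by blast
    moreover have "p' \<in> P 0"
    proof (rule ideal_supp[OF P0.is_ideal p'R])
      fix m assume m: "m \<in> supp p'"
      then have "m \<in> carrier M" using p'R by simp
      moreover have "m \<notin> S" using m by (auto simp: p'_def supp_def)
      ultimately show "dirac m \<in> P 0" using S(2) by simp
    qed
    moreover have "q = p \<oplus>\<^bsub>R\<^esub> p'"
      using qR by (intro ext) (simp add: add_apply p_def p'_def)
    ultimately have "q \<in> P 0" by (simp add: P0.a_closed)
    have "\<forall>es\<in>J. a es = \<zero>"
    proof
      fix es assume es: "es \<in> J"
      show "a es = \<zero>"
      proof (rule algebraic_independence[of xs P a n es])
        show "primeideal (P i) R" if "i \<le> length xs" for i using that prime lxs by simp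
        show "P i \<subseteq> P (Suc i) \<and> xs ! i \<in> P (Suc i) \<and> xs ! i \<notin> P i" if "i < length xs" for i
          using that chain[of i] x lxs by (auto simp: xs_def)
        show "(\<Oplus>\<^bsub>R\<^esub>es\<in>exponents (length xs) n. smult (a es) (monomial xs es)) \<in> P 0"
          using \<open>q \<in> P 0\<close> by (simp add: q_def J_def lxs)
      qed (use a(1) es lxs J_def in auto)
    qed
    then show False using a(2) by blast
  qed
  show ?thesis
  proof (rule ccontr)
    assume "\<not> d \<le> r"
    then have dr: "Suc r \<le> d" by simp
    \<comment> \<open>For n \<ge> 1 one has d n l + 1 \<le> n (d l + 1), so the bound becomes
      n^(r+1) \<le> C n^r, which fails at n = C + 1.\<close>
    define C where "C = B * (d * l + 1) ^ r"
    define n where "n = Suc C"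
    have "n ^ Suc r \<le> n ^ d" using dr by (intro power_increasing) (auto simp: n_def)
    also have "\<dots> \<le> B * (d * (n * l) + 1) ^ r" by (rule bound)
    also have "\<dots> \<le> B * (n * (d * l + 1)) ^ r"
      by (intro mult_left_mono power_mono) (auto simp: n_def algebra_simps)
    also have "\<dots> = C * n ^ r" by (simp only: C_def power_mult_distrib mult_ac)
    finally have "n * n ^ r \<le> C * n ^ r" by simp
    then show False by (simp add: n_def)
  qed
qed

end

section \<open>Primes defined by weights\<close>

text \<open>Take the lexicographically largest elements, comparing the highest index below
  \<open>s\<close> first: a pair with the same sum must attain the maximum at each index in turn.
  This is the multiplication of leading monomials; agreement from \<open>s\<close> on leaves
  finitely many indices to compare.\<close>

lemma exists_unique_sum:
  fixes A B :: "(nat \<Rightarrow> nat) set"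
  assumes "finite A" "A \<noteq> {}" "finite B" "B \<noteq> {}"
    and "\<And>u v i. u \<in> A \<Longrightarrow> v \<in> A \<Longrightarrow> s \<le> i \<Longrightarrow> u i = v i"
    and "\<And>u v i. u \<in> B \<Longrightarrow> v \<in> B \<Longrightarrow> s \<le> i \<Longrightarrow> u i = v i"
  shows "\<exists>a\<in>A. \<exists>b\<in>B. \<forall>u\<in>A. \<forall>v\<in>B. (\<forall>i. u i + v i = a i + b i) \<longrightarrow> u = a \<and> v = b"
  using assms
proof (induction s arbitrary: A B)
  case 0
  from 0(2,4) obtain a b where "a \<in> A" "b \<in> B" by blast
  moreover have "u = a" if "u \<in> A" for u using 0(5)[OF that \<open>a \<in> A\<close>] by auto
  moreover have "v = b" if "v \<in> B" for v using 0(6)[OF that \<open>b \<in> B\<close>] by auto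
  ultimately show ?case by blast
next
  case (Suc s)
  \<comment> \<open>Keep the functions with maximal value at \<open>s\<close>; the survivors agree
    from \<open>s\<close> on, as the induction hypothesis requires.\<close>
  have max: "\<exists>X'. X' \<subseteq> X \<and> X' \<noteq> {} \<and> (\<exists>k. (\<forall>u\<in>X'. u s = k) \<and> (\<forall>u\<in>X - X'. u s < k))"
    if "finite X" "X \<noteq> {}" for X :: "(nat \<Rightarrow> nat) set"
  proof -
    define k where "k = Max ((\<lambda>u. u s) ` X)"
    have "k \<in> (\<lambda>u. u s) ` X" unfolding k_def using that by (intro Max_in) auto
    then have "{u \<in> X. u s = k} \<noteq> {}" by auto
    moreover have "u s \<le> k" if "u \<in> X" for u unfolding k_def using \<open>finite X\<close> that by simp
    ultimately show ?thesis
      by (intro exI[of _ "{u \<in> X. u s = k}"]) (auto simp: order.strict_iff_order)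
  qed
  obtain A' k where A': "A' \<subseteq> A" "A' \<noteq> {}" "\<forall>u\<in>A'. u s = k" "\<forall>u\<in>A - A'. u s < k"
    using max[OF Suc.prems(1,2)] by blast
  obtain B' l where B': "B' \<subseteq> B" "B' \<noteq> {}" "\<forall>u\<in>B'. u s = l" "\<forall>u\<in>B - B'. u s < l"
    using max[OF Suc.prems(3,4)] by blast
  have "\<exists>a\<in>A'. \<exists>b\<in>B'. \<forall>u\<in>A'. \<forall>v\<in>B'. (\<forall>i. u i + v i = a i + b i) \<longrightarrow> u = a \<and> v = b"
  proof (rule Suc.IH)
    show "finite A'" "finite B'" using A'(1) B'(1) Suc.prems(1,3) finite_subset by auto
    show "u i = v i" if "u \<in> A'" "v \<in> A'" "s \<le> i" for u v i
      using that A'(1) bspec[OF A'(3), of u] bspec[OF A'(3), of v] Suc.prems(5)[of u v i]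
      by (cases "i = s") auto
    show "u i = v i" if "u \<in> B'" "v \<in> B'" "s \<le> i" for u v i
      using that B'(1) bspec[OF B'(3), of u] bspec[OF B'(3), of v] Suc.prems(6)[of u v i]
      by (cases "i = s") auto
  qed (use A' B' in auto)
  then obtain a b where ab: "a \<in> A'" "b \<in> B'"
    "\<And>u v. u \<in> A' \<Longrightarrow> v \<in> B' \<Longrightarrow> (\<forall>i. u i + v i = a i + b i) \<Longrightarrow> u = a \<and> v = b" by blast
  have "u = a \<and> v = b" if uv: "u \<in> A" "v \<in> B" "\<forall>i. u i + v i = a i + b i" for u v
  proof -
    have "u s + v s = k + l"
      using uv(3) bspec[OF A'(3) ab(1)] bspec[OF B'(3) ab(2)] by simp
    moreover have "u s \<le> k \<and> (u \<notin> A' \<longrightarrow> u s < k)"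
      using uv(1) bspec[OF A'(3), of u] bspec[OF A'(4), of u] by (cases "u \<in> A'") auto
    moreover have "v s \<le> l \<and> (v \<notin> B' \<longrightarrow> v s < l)"
      using uv(2) bspec[OF B'(3), of v] bspec[OF B'(4), of v] by (cases "v \<in> B'") auto
    ultimately have "u \<in> A'" "v \<in> B'" by linarith+
    then show ?thesis using ab(3) uv(3) by blast
  qed
  then show ?case using ab(1,2) A'(1) B'(1) by blast
qed

context monoid_algebra
begin

definition weight_sum :: "'m set \<Rightarrow> ('m \<Rightarrow> 'w) \<Rightarrow> 'w \<Rightarrow> ('m \<Rightarrow> 'k) \<Rightarrow> 'k" where
  "weight_sum S w v f = pairing f (\<lambda>m. if m \<in> S \<and> w m = v then \<one> else \<zero>)"

text \<open>The kernel of the linear map that sends a basis element in \<open>S\<close> to the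
  formal monomial of its weight and every other basis element to 0.\<close>

definition weight_ideal :: "'m set \<Rightarrow> ('m \<Rightarrow> 'w) \<Rightarrow> ('m \<Rightarrow> 'k) set" where
  "weight_ideal S w = {f \<in> carrier R. \<forall>v. weight_sum S w v f = \<zero>}"

lemma weight_sum_closed [simp]: "f \<in> carrier R \<Longrightarrow> weight_sum S w v f \<in> carrier K"
  unfolding weight_sum_def by (intro pairing_closed) auto

text \<open>Group the terms by weight: a functional that vanishes off \<open>S\<close> and depends
  only on the weight sees \<open>f\<close> only through its weight sums.\<close>

lemma pairing_by_weight:
  assumes f: "f \<in> carrier R" and C: "\<And>v. C v \<in> carrier K"
  shows "pairing f (\<lambda>m. if m \<in> S then C (w m) else \<zero>)
    = (\<Oplus>v\<in>w ` supp f. C v \<otimes> weight_sum S w v f)"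
proof -
  let ?t = "\<lambda>a v. if v = w a then (if a \<in> S then f a \<otimes> C v else \<zero>) else \<zero>"
  have t: "?t a v \<in> carrier K" for a v using R_coeff[OF f, of a] C by auto
  have fin: "finite (supp f)" using f by simp
  have "C v \<otimes> weight_sum S w v f = (\<Oplus>a\<in>supp f. ?t a v)" for v
  proof -
    have "C v \<otimes> weight_sum S w v f = pairing f (\<lambda>m. C v \<otimes> (if m \<in> S \<and> w m = v then \<one> else \<zero>))"
      unfolding weight_sum_def using f C by (intro pairing_smult_right[symmetric]) auto
    also have "\<dots> = (\<Oplus>a\<in>supp f. ?t a v)"
      unfolding pairing_def using t R_coeff[OF f] C by (intro finsum_cong') auto
    finally show ?thesis .
  qed
  then have "(\<Oplus>v\<in>w ` supp f. C v \<otimes> weight_sum S w v f) = (\<Oplus>v\<in>w ` supp f. \<Oplus>a\<in>supp f. ?t a v)"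
    by simp
  also have "\<dots> = (\<Oplus>a\<in>supp f. \<Oplus>v\<in>w ` supp f. ?t a v)"
    using t fin by (intro finsum_swap) blast+
  also have "\<dots> = pairing f (\<lambda>m. if m \<in> S then C (w m) else \<zero>)"
    unfolding pairing_def
  proof (intro finsum_cong' HOL.refl)
    fix a assume a: "a \<in> supp f"
    show "(\<Oplus>v\<in>w ` supp f. ?t a v) = f a \<otimes> (if a \<in> S then C (w a) else \<zero>)"
      using finsum_delta[of "w ` supp f" "\<lambda>v. if a \<in> S then f a \<otimes> C v else \<zero>" "w a"] fin a R_coeff[OF f] C
      by auto
  qed (use R_coeff[OF f] C in auto)
  finally show ?thesis ..
qed

lemma pairing_weight_ideal:
  assumes "f \<in> weight_ideal S w" "\<And>v. C v \<in> carrier K"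
  shows "pairing f (\<lambda>m. if m \<in> S then C (w m) else \<zero>) = \<zero>"
proof -
  have f: "f \<in> carrier R" "\<And>v. weight_sum S w v f = \<zero>"
    using assms(1) by (auto simp: weight_ideal_def)
  have "(\<Oplus>v\<in>w ` supp f. C v \<otimes> weight_sum S w v f) = (\<Oplus>v\<in>w ` supp f. \<zero>)"
    using f(2) assms(2) by (intro finsum_cong') auto
  then show ?thesis using pairing_by_weight[of f C S w, OF f(1) assms(2)] by simp
qed

text \<open>When \<open>w'\<close> is a function of \<open>w\<close>, each sum for \<open>w'\<close>
  is a sum of weight sums for \<open>w\<close>.\<close>

lemma weight_ideal_antimono:
  assumes "\<And>m. w' m = h (w m)"
  shows "weight_ideal S w \<subseteq> weight_ideal S w'"
proof
  fix f assume f: "f \<in> weight_ideal S w"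
  have "weight_sum S w' v f = \<zero>" for v
  proof -
    have "weight_sum S w' v f = pairing f (\<lambda>m. if m \<in> S then (if h (w m) = v then \<one> else \<zero>) else \<zero>)"
      unfolding weight_sum_def assms by (rule arg_cong[of _ _ "pairing f"]) auto
    also have "\<dots> = \<zero>" using pairing_weight_ideal[of f S w "\<lambda>u. if h u = v then \<one> else \<zero>", OF f] by auto
    finally show ?thesis .
  qed
  then show "f \<in> weight_ideal S w'" using f by (auto simp: weight_ideal_def)
qed

lemma weight_sum_add:
  "f \<in> carrier R \<Longrightarrow> g \<in> carrier R \<Longrightarrow>
    weight_sum S w v (f \<oplus>\<^bsub>R\<^esub> g) = weight_sum S w v f \<oplus> weight_sum S w v g"
  unfolding weight_sum_def by (intro pairing_add_left add_closed_R) auto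

lemma weight_sum_zero: "weight_sum S w v \<zero>\<^bsub>R\<^esub> = \<zero>"
  unfolding weight_sum_def pairing_def by (simp add: supp_def zero_apply)

lemma weight_sum_minus:
  assumes "f \<in> carrier R"
  shows "weight_sum S w v (\<ominus>\<^bsub>R\<^esub> f) = \<ominus> weight_sum S w v f"
proof (rule minus_equality[symmetric])
  show "weight_sum S w v (\<ominus>\<^bsub>R\<^esub> f) \<oplus> weight_sum S w v f = \<zero>"
    using assms by (simp add: weight_sum_zero R.l_neg flip: weight_sum_add)
qed (use assms in auto)

lemma weight_sum_dirac:
  "m \<in> carrier M \<Longrightarrow> weight_sum S w v (dirac m) = (if m \<in> S \<and> w m = v then \<one> else \<zero>)"
  unfolding weight_sum_def by (subst pairing_dirac_left) auto

lemma dirac_in_weight_ideal_iff: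
  assumes "m \<in> carrier M"
  shows "dirac m \<in> weight_ideal S w \<longleftrightarrow> m \<notin> S"
  using assms by (auto simp: weight_ideal_def weight_sum_dirac)

text \<open>Such differences are the witnesses for strict inclusions between weight ideals.\<close>

lemma dirac_diff_in_weight_ideal_iff:
  assumes "m \<in> carrier M" "m' \<in> carrier M" "m \<in> S" "m' \<in> S"
  shows "dirac m \<ominus>\<^bsub>R\<^esub> dirac m' \<in> weight_ideal S w \<longleftrightarrow> w m = w m'"
proof -
  have "weight_sum S w v (dirac m \<ominus>\<^bsub>R\<^esub> dirac m')
      = (if w m = v then \<one> else \<zero>) \<ominus> (if w m' = v then \<one> else \<zero>)" for v
    using assms by (simp add: R.minus_eq weight_sum_add weight_sum_minus weight_sum_dirac minus_eq)
  moreover have "dirac m \<ominus>\<^bsub>R\<^esub> dirac m' \<in> carrier R" using assms by simp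
  ultimately show ?thesis by (auto simp: weight_ideal_def minus_eq r_neg split: if_splits)
qed

context
  fixes S :: "'m set" and w :: "'m \<Rightarrow> nat \<Rightarrow> nat" and s :: nat
  assumes S: "\<And>a b. a \<in> carrier M \<Longrightarrow> b \<in> carrier M \<Longrightarrow> a \<otimes>\<^bsub>M\<^esub> b \<in> S \<longleftrightarrow> a \<in> S \<and> b \<in> S"
    and one_S: "\<one>\<^bsub>M\<^esub> \<in> S"
    and w: "\<And>a b. a \<in> carrier M \<Longrightarrow> b \<in> carrier M \<Longrightarrow> a \<in> S \<Longrightarrow> b \<in> S \<Longrightarrow>
      w (a \<otimes>\<^bsub>M\<^esub> b) = (\<lambda>i. w a i + w b i)"
    and w_zero: "\<And>a i. s \<le> i \<Longrightarrow> w a i = 0"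
begin

text \<open>For \<open>a\<close> outside \<open>S\<close> every product leaves \<open>S\<close>. For
  \<open>a\<close> inside, the inner functional depends on \<open>a\<close> only through its weight,
  which is the form that \<open>pairing_by_weight\<close> needs.\<close>

lemma weight_sum_mult:
  assumes "f \<in> carrier R" "g \<in> carrier R"
  shows "weight_sum S w v (f \<otimes>\<^bsub>R\<^esub> g) = pairing f (\<lambda>a. if a \<in> S then
    pairing g (\<lambda>b. if b \<in> S then (if (\<lambda>i. w a i + w b i) = v then \<one> else \<zero>) else \<zero>) else \<zero>)"
proof -
  have "weight_sum S w v (f \<otimes>\<^bsub>R\<^esub> g) = pairing f (\<lambda>a. pairing g
      (\<lambda>b. if a \<otimes>\<^bsub>M\<^esub> b \<in> S \<and> w (a \<otimes>\<^bsub>M\<^esub> b) = v then \<one> else \<zero>))"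
    unfolding weight_sum_def using assms by (intro pairing_mult) auto
  also have "\<dots> = pairing f (\<lambda>a. if a \<in> S then
    pairing g (\<lambda>b. if b \<in> S then (if (\<lambda>i. w a i + w b i) = v then \<one> else \<zero>) else \<zero>) else \<zero>)"
  proof (rule pairing_cong[OF assms(1)])
    fix a assume "a \<in> supp f"
    then have a: "a \<in> carrier M" using assms(1) by simp
    show "pairing g (\<lambda>b. if a \<otimes>\<^bsub>M\<^esub> b \<in> S \<and> w (a \<otimes>\<^bsub>M\<^esub> b) = v then \<one> else \<zero>) =
      (if a \<in> S then pairing g (\<lambda>b. if b \<in> S then (if (\<lambda>i. w a i + w b i) = v then \<one> else \<zero>) else \<zero>) else \<zero>)"
    proof (cases "a \<in> S")
      case True
      then show ?thesis using a S w assms(2) by (simp, intro pairing_cong) auto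
    next
      case False
      then have "pairing g (\<lambda>b. if a \<otimes>\<^bsub>M\<^esub> b \<in> S \<and> w (a \<otimes>\<^bsub>M\<^esub> b) = v then \<one> else \<zero>) = pairing g (\<lambda>b. \<zero>)"
        using a S assms(2) by (intro pairing_cong) auto
      then show ?thesis using False pairing_zero_right[OF assms(2)] by simp
    qed
  qed (use assms(2) in \<open>auto intro!: pairing_closed\<close>)
  finally show ?thesis .
qed

text \<open>\<open>S\<close> is closed under products and under factors, so sending its complement
  to 0 is multiplicative, and additivity of \<open>w\<close> makes the target a polynomial ring in
  \<open>s\<close> variables. That it is a domain is shown by leading terms: a sum of weights
  reached in only one way has as coefficient a product of two nonzero scalars.\<close>

lemma primeideal_weight_ideal: "primeideal (weight_ideal S w) R"
proof (rule primeidealI)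
  show "ideal (weight_ideal S w) R"
  proof (rule idealI)
    show "ring R" ..
    show "subgroup (weight_ideal S w) (add_monoid R)"
    proof
      show "weight_ideal S w \<subseteq> carrier (add_monoid R)" by (auto simp: weight_ideal_def)
      show "\<one>\<^bsub>add_monoid R\<^esub> \<in> weight_ideal S w"
        by (simp add: weight_ideal_def weight_sum_zero)
      show "f \<otimes>\<^bsub>add_monoid R\<^esub> g \<in> weight_ideal S w"
        if "f \<in> weight_ideal S w" "g \<in> weight_ideal S w" for f g
        using that by (simp add: weight_ideal_def weight_sum_add)
      show "inv\<^bsub>add_monoid R\<^esub> f \<in> weight_ideal S w" if "f \<in> weight_ideal S w" for f
      proof -
        have "\<ominus>\<^bsub>R\<^esub> f \<in> weight_ideal S w"
          using that by (simp add: weight_ideal_def weight_sum_minus)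
        then show ?thesis by (simp only: a_inv_def)
      qed
    qed
    show 1: "g \<otimes>\<^bsub>R\<^esub> f \<in> weight_ideal S w" if f: "f \<in> weight_ideal S w" and g: "g \<in> carrier R" for f g
    proof -
      have fR: "f \<in> carrier R" using f by (simp add: weight_ideal_def)
      have "weight_sum S w v (g \<otimes>\<^bsub>R\<^esub> f) = \<zero>" for v
      proof -
        have "pairing f (\<lambda>b. if b \<in> S then (if (\<lambda>i. w a i + w b i) = v then \<one> else \<zero>) else \<zero>) = \<zero>" for a
          using pairing_weight_ideal[of f S w "\<lambda>u. if (\<lambda>i. w a i + u i) = v then \<one> else \<zero>", OF f] by simp
        then show ?thesis using weight_sum_mult[OF g fR, of v] pairing_zero_right[OF g] by (simp cong: if_cong)
      qed
      then show ?thesis using fR g by (simp add: weight_ideal_def)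
    qed
    show "f \<otimes>\<^bsub>R\<^esub> g \<in> weight_ideal S w" if f: "f \<in> weight_ideal S w" and g: "g \<in> carrier R" for f g
      using 1[OF that] f g R.m_comm[of f g] by (simp add: weight_ideal_def)
  qed
  show "carrier R \<noteq> weight_ideal S w"
    using dirac_in_weight_ideal_iff[of "\<one>\<^bsub>M\<^esub>" S w] one_S by auto
  fix f g assume f: "f \<in> carrier R" and g: "g \<in> carrier R" and fg: "f \<otimes>\<^bsub>R\<^esub> g \<in> weight_ideal S w"
  show "f \<in> weight_ideal S w \<or> g \<in> weight_ideal S w"
  proof (rule ccontr)
    assume not: "\<not> ?thesis"
    \<comment> \<open>The support of the image in the polynomial ring: the weights at which the
      coefficients do not cancel.\<close>
    let ?V = "\<lambda>f. {v \<in> w ` supp f. weight_sum S w v f \<noteq> \<zero>}"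
    have V: "weight_sum S w v h = \<zero>" if h: "h \<in> carrier R" and v: "v \<notin> ?V h" for v h
    proof (cases "v \<in> w ` supp h")
      case False
      have "weight_sum S w v h = pairing h (\<lambda>m. \<zero>)"
        unfolding weight_sum_def using False h by (intro pairing_cong) auto
      then show ?thesis using pairing_zero_right[OF h] by simp
    qed (use v in auto)
    have ne: "?V f \<noteq> {}" "?V g \<noteq> {}"
      using not f g V[OF f] V[OF g] by (auto simp only: weight_ideal_def)
    have "\<exists>a\<in>?V f. \<exists>b\<in>?V g. \<forall>u\<in>?V f. \<forall>v\<in>?V g. (\<forall>i. u i + v i = a i + b i) \<longrightarrow> u = a \<and> v = b"
      by (rule exists_unique_sum[where s = s]) (use ne f g w_zero in auto)
    then obtain a b where ab: "a \<in> ?V f" "b \<in> ?V g"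
      "\<And>u v. u \<in> ?V f \<Longrightarrow> v \<in> ?V g \<Longrightarrow> (\<forall>i. u i + v i = a i + b i) \<Longrightarrow> u = a \<and> v = b" by blast
    define t where "t = (\<lambda>i. a i + b i)"
    \<comment> \<open>The functional on \<open>g\<close> that sees only the weights completing
      \<open>u\<close> to \<open>t\<close>. By the choice of \<open>t\<close>, its product with the
      weight sum of \<open>f\<close> at \<open>u\<close> vanishes unless
      \<open>u = a\<close>.\<close>
    define C where "C u = (\<Oplus>v\<in>w ` supp g. (if (\<lambda>i. u i + v i) = t then \<one> else \<zero>) \<otimes> weight_sum S w v g)" for u
    have Cc: "C u \<in> carrier K" for u unfolding C_def using g by (intro finsum_closed) auto
    have C0: "C u \<otimes> weight_sum S w u f = \<zero>" if "u \<noteq> a" for u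
    proof (cases "u \<in> ?V f")
      case True
      have "(if (\<lambda>i. u i + v i) = t then \<one> else \<zero>) \<otimes> weight_sum S w v g = \<zero>" for v
      proof (cases "v \<in> ?V g")
        case in_V: True
        have "(\<lambda>i. u i + v i) \<noteq> t"
        proof
          assume "(\<lambda>i. u i + v i) = t"
          then have "\<forall>i. u i + v i = a i + b i" unfolding t_def fun_eq_iff .
          then show False using ab(3)[OF True in_V] that by blast
        qed
        then show ?thesis using weight_sum_closed[OF g, of S w v] by (simp only: if_False l_null)
      next
        case False
        show ?thesis unfolding V[OF g False] by auto
      qed
      then have "C u = \<zero>" by (simp add: C_def)
      then show ?thesis using f by simp
    next
      case False
      show ?thesis unfolding V[OF f False] using Cc by simp
    qed
    have tb: "(\<lambda>i. a i + v i) = t \<longleftrightarrow> v = b" for v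
      unfolding t_def fun_eq_iff by simp
    have "C a = (\<Oplus>v\<in>w ` supp g. if v = b then weight_sum S w v g else \<zero>)"
      unfolding C_def tb using g by (intro finsum_cong') auto
    also have "\<dots> = weight_sum S w b g"
      using finsum_delta[of "w ` supp g" "\<lambda>v. weight_sum S w v g" b] g ab(2) by auto
    finally have Ca: "C a = weight_sum S w b g" .
    have "weight_sum S w t (f \<otimes>\<^bsub>R\<^esub> g) = pairing f (\<lambda>m. if m \<in> S then C (w m) else \<zero>)"
    proof -
      have "pairing g (\<lambda>b. if b \<in> S then (if (\<lambda>i. u i + w b i) = t then \<one> else \<zero>) else \<zero>) = C u" for u
        using pairing_by_weight[of g "\<lambda>v. if (\<lambda>i. u i + v i) = t then \<one> else \<zero>" S w, OF g]
        by (simp add: C_def)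
      then show ?thesis unfolding weight_sum_mult[OF f g] by (simp cong: if_cong)
    qed
    also have "\<dots> = (\<Oplus>u\<in>w ` supp f. C u \<otimes> weight_sum S w u f)"
      by (rule pairing_by_weight[OF f Cc])
    also have "\<dots> = (\<Oplus>u\<in>w ` supp f. if u = a then C u \<otimes> weight_sum S w u f else \<zero>)"
      using C0 Cc f by (intro finsum_cong') auto
    also have "\<dots> = C a \<otimes> weight_sum S w a f"
      using finsum_delta[of "w ` supp f" "\<lambda>u. C u \<otimes> weight_sum S w u f" a] f Cc ab(1) by auto
    finally have "C a \<otimes> weight_sum S w a f = \<zero>" using fg by (simp add: weight_ideal_def)
    then have "C a = \<zero> \<or> weight_sum S w a f = \<zero>"
      using Cc[of a] weight_sum_closed[OF f] by (rule integral)
    then show False using ab(1,2) Ca by simp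
  qed
qed (rule cring_R)

end

end

section \<open>Krull dimension of locally closed subsets of a spectrum\<close>

context cring
begin

lemma openin_zariski: "openin (zariski R) U \<longleftrightarrow> (\<exists>I. ideal I R \<and> U = Spec R - vanishing R I)"
  unfolding zariski_def by (simp add: topology_inverse'[OF istopology_zariski])

lemma topspace_zariski: "topspace (zariski R) = Spec R"
proof
  show "topspace (zariski R) \<subseteq> Spec R"
    using openin_topspace[of "zariski R"] unfolding openin_zariski by blast
  have "vanishing R (carrier R) = {}"
  proof -
    have "\<not> carrier R \<subseteq> P" if "P \<in> Spec R" for P
    proof -
      interpret P: primeideal P R using that by (simp add: Spec_def)
      show ?thesis using P.a_subset P.I_notcarr by blast
    qed
    then show ?thesis by (auto simp: vanishing_def)
  qed
  then have "openin (zariski R) (Spec R)"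
    unfolding openin_zariski by (intro exI[of _ "carrier R"]) (simp add: oneideal)
  then show "Spec R \<subseteq> topspace (zariski R)" by (rule openin_subset)
qed

lemma closedin_zariski: "closedin (zariski R) C \<longleftrightarrow> (\<exists>I. ideal I R \<and> C = vanishing R I)"
proof -
  have "vanishing R I \<subseteq> Spec R" for I by (auto simp: vanishing_def)
  then show ?thesis
    unfolding closedin_def topspace_zariski openin_zariski by blast
qed

lemma closedin_subtopology_zariski:
  "closedin (subtopology (zariski R) Y) C \<longleftrightarrow> (\<exists>I. ideal I R \<and> C = vanishing R I \<inter> Y)"
  unfolding closedin_subtopology closedin_zariski by blast

text \<open>Irreducible closed sets have a generic point, the intersection of their members: it is
  prime by irreducibility and stays in \<open>Y\<close> because \<open>Y\<close> is locally
  closed.\<close>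

lemma irreducible_closed_iff:
  assumes Y: "Y = vanishing R I - vanishing R J"
  shows "irreducible_closed (subtopology (zariski R) Y) Z \<longleftrightarrow> (\<exists>P\<in>Y. Z = {Q \<in> Y. P \<subseteq> Q})"
proof
  assume irr: "irreducible_closed (subtopology (zariski R) Y) Z"
  then obtain A where A: "ideal A R" "Z = vanishing R A \<inter> Y" and ne: "Z \<noteq> {}"
    unfolding irreducible_closed_def closedin_subtopology_zariski by blast
  have ZY: "Z \<subseteq> Y" using A by blast
  have Zp: "primeideal Q R" if "Q \<in> Z" for Q using that ZY Y by (auto simp: vanishing_def Spec_def)
  have id: "ideal (\<Inter>Z) R"
    using ne Zp by (intro i_Intersect) (auto dest: primeideal.axioms)
  have prime: "primeideal (\<Inter>Z) R"
  proof (rule primeidealI[OF id is_cring])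
    obtain Q where Q: "Q \<in> Z" using ne by blast
    interpret Q: primeideal Q R using Zp[OF Q] .
    show "carrier R \<noteq> \<Inter>Z" using Q Q.I_notcarr Q.a_subset by blast
    fix a b assume a: "a \<in> carrier R" and b: "b \<in> carrier R" and ab: "a \<otimes> b \<in> \<Inter>Z"
    \<comment> \<open>The members of \<open>Z\<close> containing a given \<open>c\<close> form a
      closed set. As \<open>a \<otimes> b\<close> lies in every member, the two sets for
      \<open>a\<close> and \<open>b\<close> cover \<open>Z\<close>.\<close>
    have cl: "closedin (subtopology (zariski R) Y) {Q \<in> Z. c \<in> Q}" if c: "c \<in> carrier R" for c
    proof -
      have "c \<in> Q \<longleftrightarrow> Q \<in> vanishing R (PIdl c)" if "Q \<in> Z" for Q
        using Zp[OF that] cgenideal_self[OF c] cgenideal_minimal[of Q c]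
        by (auto simp: vanishing_def Spec_def primeideal_def)
      then have "{Q \<in> Z. c \<in> Q} = (vanishing R A \<inter> Y) \<inter> (vanishing R (PIdl c) \<inter> Y)"
        using A(2) by blast
      moreover have "closedin (subtopology (zariski R) Y) (vanishing R A \<inter> Y)"
        "closedin (subtopology (zariski R) Y) (vanishing R (PIdl c) \<inter> Y)"
        unfolding closedin_subtopology_zariski using A(1) cgenideal_ideal[OF c] by blast+
      ultimately show ?thesis by (simp only: closedin_Int)
    qed
    have "Z = {Q \<in> Z. a \<in> Q} \<union> {Q \<in> Z. b \<in> Q}"
      using ab a b primeideal.I_prime[OF Zp] by blast
    then have "{Q \<in> Z. a \<in> Q} = Z \<or> {Q \<in> Z. b \<in> Q} = Z"
      using irr cl[OF a] cl[OF b] unfolding irreducible_closed_def by blast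
    then show "a \<in> \<Inter>Z \<or> b \<in> \<Inter>Z" by blast
  qed
  \<comment> \<open>The intersection contains \<open>I\<close> because all members do, and it cannot
    contain \<open>J\<close> because it lies in a member that does not.\<close>
  have "\<Inter>Z \<in> Y"
    using prime ne ZY unfolding Y by (auto simp: vanishing_def Spec_def)
  moreover have "A \<subseteq> \<Inter>Z" using A(2) by (auto simp: vanishing_def)
  ultimately have "Z = {Q \<in> Y. \<Inter>Z \<subseteq> Q}"
    using A(2) Y by (auto simp: vanishing_def)
  then show "\<exists>P\<in>Y. Z = {Q \<in> Y. P \<subseteq> Q}" using \<open>\<Inter>Z \<in> Y\<close> by blast
next
  assume "\<exists>P\<in>Y. Z = {Q \<in> Y. P \<subseteq> Q}"
  then obtain P where P: "P \<in> Y" and Z: "Z = {Q \<in> Y. P \<subseteq> Q}" by blast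
  have prime: "primeideal P R" using P Y by (auto simp: vanishing_def Spec_def)
  have "Z = vanishing R P \<inter> Y" unfolding Z Y by (auto simp: vanishing_def)
  then have cl: "closedin (subtopology (zariski R) Y) Z"
    unfolding closedin_subtopology_zariski using primeideal.axioms(1)[OF prime] by blast
  moreover have "P \<in> Z" using P Z by blast
  \<comment> \<open>A closed set contains with a prime all larger primes of \<open>Y\<close>, so one
    that contains the generic point is all of \<open>Z\<close>.\<close>
  moreover have "A = Z" if "P \<in> A" "A \<subseteq> Z" "closedin (subtopology (zariski R) Y) A" for A
  proof -
    from that obtain I where "ideal I R" "A = vanishing R I \<inter> Y"
      unfolding closedin_subtopology_zariski by blast
    then show ?thesis using that Z Y by (auto simp: vanishing_def)
  qed
  ultimately show "irreducible_closed (subtopology (zariski R) Y) Z"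
    unfolding irreducible_closed_def by blast
qed

text \<open>Passing to generic points reverses inclusion, so increasing chains of closed sets become
  decreasing chains of primes in \<open>Y\<close>.\<close>

lemma krull_dim_locally_closed:
  assumes Y: "Y = vanishing R I - vanishing R J"
  shows "krull_dim (subtopology (zariski R) Y) =
    (SUP n \<in> {n. \<exists>P. (\<forall>i\<le>n. P i \<in> Y) \<and> (\<forall>i<n. P (Suc i) \<subset> P i)}. ereal (real n))"
proof -
  have "(\<exists>Z. (\<forall>i\<le>n. irreducible_closed (subtopology (zariski R) Y) (Z i)) \<and> (\<forall>i<n. Z i \<subset> Z (Suc i)))
      \<longleftrightarrow> (\<exists>P. (\<forall>i\<le>n. P i \<in> Y) \<and> (\<forall>i<n. P (Suc i) \<subset> P i))" for n
  proof
    assume "\<exists>Z. (\<forall>i\<le>n. irreducible_closed (subtopology (zariski R) Y) (Z i)) \<and> (\<forall>i<n. Z i \<subset> Z (Suc i))"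
    then obtain Z where Z: "\<forall>i\<le>n. \<exists>P\<in>Y. Z i = {Q \<in> Y. P \<subseteq> Q}" "\<forall>i<n. Z i \<subset> Z (Suc i)"
      unfolding irreducible_closed_iff[OF Y] by blast
    from Z(1) have "\<exists>P. \<forall>i. i \<le> n \<longrightarrow> P i \<in> Y \<and> Z i = {Q \<in> Y. P i \<subseteq> Q}"
      by (intro choice) blast
    then obtain P where P: "\<And>i. i \<le> n \<Longrightarrow> P i \<in> Y \<and> Z i = {Q \<in> Y. P i \<subseteq> Q}" by blast
    have "P (Suc i) \<subset> P i" if "i < n" for i
    proof
      have Zi: "Z i \<subset> Z (Suc i)" using Z(2) that by blast
      have i: "P i \<in> Y" "Z i = {Q \<in> Y. P i \<subseteq> Q}" using P[of i] that by simp_all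
      have si: "Z (Suc i) = {Q \<in> Y. P (Suc i) \<subseteq> Q}" using P[of "Suc i"] that by simp
      have "P i \<in> Z (Suc i)" using Zi i by blast
      then show "P (Suc i) \<subseteq> P i" unfolding si by blast
      show "P (Suc i) \<noteq> P i" using Zi i(2) si by auto
    qed
    then show "\<exists>P. (\<forall>i\<le>n. P i \<in> Y) \<and> (\<forall>i<n. P (Suc i) \<subset> P i)" using P by blast
  next
    assume "\<exists>P. (\<forall>i\<le>n. P i \<in> Y) \<and> (\<forall>i<n. P (Suc i) \<subset> P i)"
    then obtain P where P: "\<forall>i\<le>n. P i \<in> Y" "\<forall>i<n. P (Suc i) \<subset> P i" by blast
    have "{Q \<in> Y. P i \<subseteq> Q} \<subset> {Q \<in> Y. P (Suc i) \<subseteq> Q}" if "i < n" for i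
      using P(1)[rule_format, of "Suc i"] P(2)[rule_format, of i] that by auto
    then show "\<exists>Z. (\<forall>i\<le>n. irreducible_closed (subtopology (zariski R) Y) (Z i)) \<and> (\<forall>i<n. Z i \<subset> Z (Suc i))"
      unfolding irreducible_closed_iff[OF Y] using P(1)
      by (intro exI[of _ "\<lambda>i. {Q \<in> Y. P i \<subseteq> Q}"]) blast
  qed
  then show ?thesis unfolding krull_dim_def by simp
qed

end

section \<open>Hurwitz orbits\<close>

definition count_in :: "'g set \<Rightarrow> 'g list \<Rightarrow> nat" where
  "count_in C xs = length (filter (\<lambda>x. x \<in> C) xs)"

lemma count_in_simps [simp]:
  "count_in C [] = 0" "count_in C (x # xs) = (if x \<in> C then Suc (count_in C xs) else count_in C xs)"
  "count_in C (xs @ ys) = count_in C xs + count_in C ys"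
  by (auto simp: count_in_def)

lemma count_in_replicate [simp]: "count_in C (replicate n x) = (if x \<in> C then n else 0)"
  by (induction n) auto

lemma count_in_le_length: "count_in C xs \<le> length xs"
  by (simp add: count_in_def)

lemma count_in_UN:
  assumes "finite F" "\<And>C C'. C \<in> F \<Longrightarrow> C' \<in> F \<Longrightarrow> C \<noteq> C' \<Longrightarrow> C \<inter> C' = {}"
  shows "count_in (\<Union>F) xs = (\<Sum>C\<in>F. count_in C xs)"
proof (induction xs)
  case (Cons x xs)
  have "(\<Sum>C\<in>F. if x \<in> C then 1 else 0) = (if x \<in> \<Union>F then 1 else 0 :: nat)"
  proof (cases "x \<in> \<Union>F")
    case True
    then obtain C where C: "C \<in> F" "x \<in> C" by blast
    then have "x \<in> C' \<longleftrightarrow> C' = C" if "C' \<in> F" for C' using assms(2)[of C' C] that by blast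
    then have "(\<Sum>C'\<in>F. if x \<in> C' then 1 else 0) = (\<Sum>C'\<in>F. if C' = C then 1 else 0 :: nat)"
      by (intro sum.cong) auto
    also have "\<dots> = 1" using C(1) assms(1) by simp
    finally show ?thesis using True by simp
  next
    case False
    then have "(\<Sum>C'\<in>F. if x \<in> C' then 1 else 0) = (\<Sum>C'\<in>F. 0 :: nat)"
      by (intro sum.cong) auto
    then show ?thesis using False by simp
  qed
  moreover have "count_in C (x # xs) = (if x \<in> C then 1 else 0) + count_in C xs" for C by simp
  ultimately show ?case by (simp only: Cons.IH sum.distrib)
qed simp

lemma pigeonhole_count:
  assumes "set xs \<subseteq> A" "finite A" "card A * n < length xs"
  shows "\<exists>x\<in>A. n \<le> count_list xs x"
proof (rule ccontr)
  assume "\<not> ?thesis"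
  then have "\<And>x. x \<in> A \<Longrightarrow> count_list xs x \<le> n" by (simp add: not_le less_imp_le)
  then have "(\<Sum>x\<in>A. count_list xs x) \<le> card A * n" using sum_bounded_above[of A "count_list xs" n] by simp
  moreover have "(\<Sum>x\<in>A. count_list xs x) = length xs"
    using sum_count_set[OF assms(1,2)] .
  ultimately show False using assms(3) by simp
qed

context group
begin

section \<open>Moves in Hurwitz orbits\<close>

abbreviation orb :: "'a list \<Rightarrow> 'a list set" where
  "orb \<equiv> hurwitz_orbit G"

definition tuple_prod :: "'a list \<Rightarrow> 'a" where
  "tuple_prod xs = foldr (\<otimes>) xs \<one>"

definition conj_by :: "'a \<Rightarrow> 'a \<Rightarrow> 'a" where
  "conj_by h x = h \<otimes> x \<otimes> inv h"

lemma conj_by_closed [simp]: "h \<in> carrier G \<Longrightarrow> x \<in> carrier G \<Longrightarrow> conj_by h x \<in> carrier G"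
  by (simp add: conj_by_def)

lemma conj_by_one [simp]: "x \<in> carrier G \<Longrightarrow> conj_by \<one> x = x"
  by (simp add: conj_by_def)

lemma conj_by_conj_by: "h \<in> carrier G \<Longrightarrow> k \<in> carrier G \<Longrightarrow> x \<in> carrier G \<Longrightarrow> conj_by h (conj_by k x) = conj_by (h \<otimes> k) x"
  by (simp add: conj_by_def inv_mult_group m_assoc)

lemma conj_by_inv [simp]:
  assumes "h \<in> carrier G" "x \<in> carrier G"
  shows "conj_by (inv h) (conj_by h x) = x" "conj_by h (conj_by (inv h) x) = x"
  using assms by (simp_all add: conj_by_conj_by)

lemma conj_by_self [simp]: "x \<in> carrier G \<Longrightarrow> conj_by x x = x" "x \<in> carrier G \<Longrightarrow> conj_by (inv x) x = x"
  by (simp_all add: conj_by_def m_assoc)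

lemma tuple_prod_simps [simp]: "tuple_prod [] = \<one>" "tuple_prod (x # xs) = x \<otimes> tuple_prod xs"
  by (simp_all add: tuple_prod_def)

lemma tuple_prod_closed [simp]: "set xs \<subseteq> carrier G \<Longrightarrow> tuple_prod xs \<in> carrier G"
  by (induction xs) auto

lemma tuple_prod_append:
  "set xs \<subseteq> carrier G \<Longrightarrow> set ys \<subseteq> carrier G \<Longrightarrow> tuple_prod (xs @ ys) = tuple_prod xs \<otimes> tuple_prod ys"
  by (induction xs) (auto simp: m_assoc)

lemma tuple_prod_replicate: "x \<in> carrier G \<Longrightarrow> tuple_prod (replicate n x) = x [^] n"
proof (induction n)
  case (Suc n)
  then show ?case using nat_pow_Suc2[of x n] by simp
qed simp

lemma tuple_prod_map_conj_by:
  "h \<in> carrier G \<Longrightarrow> set xs \<subseteq> carrier G \<Longrightarrow> tuple_prod (map (conj_by h) xs) = conj_by h (tuple_prod xs)"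
proof (induction xs)
  case (Cons x xs)
  then show ?case
    by (simp add: conj_by_def m_assoc) (simp add: m_assoc[symmetric])
qed (simp add: conj_by_def)

text \<open>Concatenation is well defined on orbits; hence any consecutive piece of a tuple may be
  replaced by another tuple from its orbit.\<close>

lemma orb_cong:
  assumes "set xs \<subseteq> carrier G" "set ys \<subseteq> carrier G" "set xs' \<subseteq> carrier G" "set ys' \<subseteq> carrier G"
    and "orb xs = orb xs'" "orb ys = orb ys'"
  shows "orb (xs @ ys) = orb (xs' @ ys')"
  using Comp_mult[OF assms(1,2)] Comp_mult[OF assms(3,4)] assms(5,6) by simp

lemma orb_letter:
  assumes "set gs \<subseteq> carrier G" "Suc (fst x) < length gs"
  shows "orb (hurwitz_letter G x gs) = orb gs"
proof (rule hurwitz_orbit_eq[OF assms(1)])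
  have "hurwitz_letter G x gs = hurwitz_word G [x] gs" by (simp add: hurwitz_word_def)
  then show "hurwitz_letter G x gs \<in> orb gs"
    using assms by (auto simp: hurwitz_orbit_words intro!: exI[of _ "[x]"])
qed

lemma orb_two:
  assumes "x \<in> carrier G" "y \<in> carrier G"
  shows "orb [x, y] = orb [conj_by x y, x]" "orb [x, y] = orb [y, conj_by (inv y) x]"
  using orb_letter[of "[x, y]" "(0, True)"] orb_letter[of "[x, y]" "(0, False)"] assms
  by (simp_all add: conj_by_def)

text \<open>Inverse generators carry \<open>y\<close> to the front unchanged and conjugate the
  entries it passes. \<open>orb_move_left_conj\<close> is the opposite choice, which keeps those
  entries and conjugates \<open>y\<close>; comparing the two yields
  \<open>orb_conj_letter\<close>.\<close>

lemma orb_move_left: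
  assumes "set xs \<subseteq> carrier G" "y \<in> carrier G"
  shows "orb (xs @ [y]) = orb (y # map (conj_by (inv y)) xs)"
  using assms(1)
proof (induction xs)
  case (Cons x xs)
  let ?xs' = "map (conj_by (inv y)) xs"
  have c: "x \<in> carrier G" "set xs \<subseteq> carrier G" "set ?xs' \<subseteq> carrier G" using Cons.prems assms(2) by auto
  have "orb ([x] @ (xs @ [y])) = orb ([x] @ (y # ?xs'))"
    by (intro orb_cong HOL.refl Cons.IH) (use c assms(2) in simp_all)
  also have "\<dots> = orb ([x, y] @ ?xs')" by simp
  also have "\<dots> = orb ([y, conj_by (inv y) x] @ ?xs')"
    by (intro orb_cong HOL.refl orb_two(2)) (use c assms(2) in simp_all)
  finally show ?case by simp
qed simp

lemma orb_move_left_conj: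
  assumes "set xs \<subseteq> carrier G" "y \<in> carrier G"
  shows "orb (xs @ [y]) = orb (conj_by (tuple_prod xs) y # xs)"
  using assms(1)
proof (induction xs)
  case (Cons x xs)
  have c: "x \<in> carrier G" "set xs \<subseteq> carrier G" using Cons.prems by auto
  let ?z = "conj_by (tuple_prod xs) y"
  have "orb ([x] @ (xs @ [y])) = orb ([x] @ (?z # xs))"
    by (intro orb_cong HOL.refl Cons.IH) (use c assms(2) in simp_all)
  also have "\<dots> = orb ([x, ?z] @ xs)" by simp
  also have "\<dots> = orb ([conj_by x ?z, x] @ xs)"
    by (intro orb_cong HOL.refl orb_two(1)) (use c assms(2) in simp_all)
  finally show ?case using c assms(2) by (simp add: conj_by_conj_by)
qed (use assms in simp)

text \<open>Since \<open>xs\<close> has product 1, \<open>orb_move_left_conj\<close> carries each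
  entry of \<open>ys\<close> across \<open>xs\<close> unchanged.\<close>

lemma orb_commute:
  assumes "set xs \<subseteq> carrier G" "tuple_prod xs = \<one>" "set ys \<subseteq> carrier G"
  shows "orb (xs @ ys) = orb (ys @ xs)"
  using assms(3)
proof (induction ys)
  case (Cons y ys)
  have c: "y \<in> carrier G" "set ys \<subseteq> carrier G" using Cons.prems by auto
  have "orb (xs @ [y]) = orb (y # xs)"
    using orb_move_left_conj[OF assms(1) c(1)] assms(2) c by simp
  then have "orb ((xs @ [y]) @ ys) = orb ((y # xs) @ ys)"
    by (intro orb_cong HOL.refl) (use c assms(1) in simp_all)
  also have "\<dots> = orb ([y] @ (xs @ ys))" by simp
  also have "\<dots> = orb ([y] @ (ys @ xs))"
    by (intro orb_cong HOL.refl Cons.IH) (use c assms(1) in simp_all)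
  finally show ?case by simp
qed simp

lemma orb_commute_prefix:
  assumes "set xs \<subseteq> carrier G" "tuple_prod xs = \<one>" "set as \<subseteq> carrier G" "set ys \<subseteq> carrier G" "set zs \<subseteq> carrier G"
  shows "orb (as @ xs @ ys @ zs) = orb (as @ ys @ xs @ zs)"
proof -
  have "orb (as @ ((xs @ ys) @ zs)) = orb (as @ ((ys @ xs) @ zs))"
    by (intro orb_cong HOL.refl orb_commute) (use assms in simp_all)
  then show ?thesis by simp
qed

text \<open>Slide \<open>xs\<close> next to an occurrence of \<open>y\<close>, carry
  \<open>y\<close> across \<open>xs\<close> by commutation, bring it back by
  \<open>orb_move_left\<close>, and slide the result to the end. The first crossing leaves
  \<open>xs\<close> as it is, the second conjugates it.\<close>

lemma orb_conj_letter:
  assumes "set xs \<subseteq> carrier G" "tuple_prod xs = \<one>" "set ys \<subseteq> carrier G" "y \<in> set ys"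
  shows "orb (ys @ xs) = orb (ys @ map (conj_by (inv y)) xs)"
proof -
  obtain a b where ys: "ys = a @ y # b" using assms(4) by (meson split_list)
  have c: "y \<in> carrier G" "set a \<subseteq> carrier G" "set b \<subseteq> carrier G" using assms(3) ys by auto
  let ?xs' = "map (conj_by (inv y)) xs"
  have c': "set ?xs' \<subseteq> carrier G" using c assms(1) by auto
  have p': "tuple_prod ?xs' = \<one>" using tuple_prod_map_conj_by[of "inv y" xs] c assms(1,2) by (simp add: conj_by_def)
  have "orb (ys @ xs) = orb ((a @ [y]) @ b @ xs @ [])" using ys by simp
  also have "\<dots> = orb ((a @ [y]) @ xs @ b @ [])"
    by (rule orb_commute_prefix[symmetric]) (use c assms in auto)
  also have "\<dots> = orb ((a @ ([y] @ xs)) @ b)" by simp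
  also have "\<dots> = orb ((a @ ([y] @ ?xs')) @ b)"
  proof -
    have "orb ([y] @ xs) = orb (xs @ [y])" using orb_commute[OF assms(1,2), of "[y]"] c by simp
    also have "\<dots> = orb ([y] @ ?xs')" using orb_move_left[OF assms(1) c(1)] by simp
    finally have m: "orb ([y] @ xs) = orb ([y] @ ?xs')" .
    have "orb (a @ ([y] @ xs)) = orb (a @ ([y] @ ?xs'))"
      by (rule orb_cong[OF _ _ _ _ HOL.refl m]) (use c c' assms(1) in simp_all)
    then show ?thesis
      by (rule orb_cong[OF _ _ _ _ _ HOL.refl, rotated 4]) (use c c' assms(1) in simp_all)
  qed
  also have "\<dots> = orb ((a @ [y]) @ ?xs' @ b @ [])" by simp
  also have "\<dots> = orb ((a @ [y]) @ b @ ?xs' @ [])"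
    by (rule orb_commute_prefix) (use c c' p' in auto)
  finally show ?thesis using ys by simp
qed

text \<open>Conjugated tuples still have product 1, so the conjugations by single entries compose
  along the generation of \<open>h\<close>.\<close>

lemma orb_conj_generate:
  assumes "h \<in> generate G (set ys)" "set ys \<subseteq> carrier G" "set xs \<subseteq> carrier G" "tuple_prod xs = \<one>"
  shows "orb (ys @ xs) = orb (ys @ map (conj_by h) xs)"
proof -
  have conj: "set (map (conj_by k) zs) \<subseteq> carrier G \<and> tuple_prod (map (conj_by k) zs) = \<one>"
    if "k \<in> carrier G" "set zs \<subseteq> carrier G" "tuple_prod zs = \<one>" for k zs
    using that tuple_prod_map_conj_by[of k zs] by (auto simp: conj_by_def)
  show ?thesis using assms(1,3,4)
  proof (induction arbitrary: xs rule: generate.induct)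
    case one
    have "map (conj_by \<one>) xs = xs" using one by (intro map_idI) auto
    then show ?case by simp
  next
    case (incl y)
    have y: "y \<in> carrier G" using incl assms(2) by auto
    \<comment> \<open>\<open>orb_conj_letter\<close> conjugates by inverses only; for
      \<open>y\<close> itself it is applied to the conjugated tuple, which it takes back to
      \<open>xs\<close>.\<close>
    have "map (conj_by (inv y)) (map (conj_by y) xs) = xs"
      unfolding map_map by (intro map_idI) (use incl y in auto)
    then show ?case
      using orb_conj_letter[of "map (conj_by y) xs" ys y] conj[OF y incl(2,3)] incl(1) assms(2) by simp
  next
    case (inv y)
    then show ?case using orb_conj_letter[of xs ys y] assms(2) by simp
  next
    case (eng h1 h2)
    have h: "h1 \<in> carrier G" "h2 \<in> carrier G"
      using eng(1,2) generate_in_carrier[OF assms(2)] by auto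
    have "orb (ys @ xs) = orb (ys @ map (conj_by h2) xs)" by (rule eng.IH(2)[OF eng.prems])
    also have "\<dots> = orb (ys @ map (conj_by h1) (map (conj_by h2) xs))"
      using conj[OF h(2) eng.prems] by (intro eng.IH(1)) auto
    also have "map (conj_by h1) (map (conj_by h2) xs) = map (conj_by (h1 \<otimes> h2)) xs"
      unfolding map_map by (intro map_cong) (use h eng.prems in \<open>auto simp: conj_by_conj_by\<close>)
    finally show ?case .
  qed
qed

section \<open>Blocks of equal entries and a normal form\<close>

definition block :: "'a \<Rightarrow> 'a list" where
  "block g = replicate (order G) g"

definition blocks :: "'a list \<Rightarrow> 'a list" where
  "blocks gs = concat (map block gs)"

lemma blocks_simps [simp]:
  "blocks [] = []" "blocks (g # gs) = block g @ blocks gs" "blocks (xs @ ys) = blocks xs @ blocks ys"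
  by (simp_all add: blocks_def)

lemma count_in_blocks: "count_in C (blocks gs) = order G * count_in C gs"
  by (induction gs) (auto simp: block_def)

lemma block_carrier [simp]: "g \<in> carrier G \<Longrightarrow> set (block g) \<subseteq> carrier G"
  by (auto simp: block_def)

lemma blocks_carrier [simp]: "set gs \<subseteq> carrier G \<Longrightarrow> set (blocks gs) \<subseteq> carrier G"
  by (induction gs) (auto simp: block_def)

text \<open>The reason for blocks of length \<open>order G\<close>: they have product 1, so the
  commutation and conjugation rules above apply to them.\<close>

lemma tuple_prod_block: "g \<in> carrier G \<Longrightarrow> tuple_prod (block g) = \<one>"
  by (simp add: block_def tuple_prod_replicate pow_order_eq_1)

lemma tuple_prod_blocks: "set gs \<subseteq> carrier G \<Longrightarrow> tuple_prod (blocks gs) = \<one>"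
  by (induction gs) (auto simp: tuple_prod_append tuple_prod_block)

lemma orb_blocks_mset:
  assumes "mset gs = mset gs'" "set gs \<subseteq> carrier G" "set as \<subseteq> carrier G" "set t \<subseteq> carrier G"
  shows "orb (as @ blocks gs @ t) = orb (as @ blocks gs' @ t)"
  using assms(1-3)
proof (induction gs arbitrary: gs' as)
  case (Cons g gs)
  have g: "g \<in> carrier G" "set gs \<subseteq> carrier G" using Cons.prems by auto
  have "g \<in> set gs'" using mset_eq_setD[OF Cons.prems(1)] by auto
  then obtain a b where gs': "gs' = a @ g # b" by (meson split_list)
  have m: "mset gs = mset (a @ b)" using Cons.prems(1) gs' by simp
  then have ab: "set a \<subseteq> carrier G" "set b \<subseteq> carrier G" using g(2) mset_eq_setD[OF m] by auto
  have "orb ((as @ block g) @ blocks gs @ t) = orb ((as @ block g) @ blocks (a @ b) @ t)"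
    using m g Cons.prems(3) by (intro Cons.IH) auto
  also have "\<dots> = orb (as @ block g @ blocks a @ (blocks b @ t))" by simp
  also have "\<dots> = orb (as @ blocks a @ block g @ (blocks b @ t))"
    using g ab Cons.prems(3) assms(4) tuple_prod_block by (intro orb_commute_prefix) auto
  finally show ?case using gs' by simp
qed simp

text \<open>Each block may be conjugated by its own element of \<open>H\<close>. Blocks already
  replaced are absorbed into \<open>as\<close>, which keeps generating a group containing
  \<open>H\<close>.\<close>

lemma orb_blocks_conj:
  assumes "set gs \<subseteq> H" "H \<subseteq> generate G (set as)" "set as \<subseteq> carrier G" "set t \<subseteq> carrier G"
    and "\<And>g. g \<in> H \<Longrightarrow> \<exists>h\<in>H. r g = conj_by h g"
  shows "orb (as @ blocks gs @ t) = orb (as @ blocks (map r gs) @ t)"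
  using assms(1-3)
proof (induction gs arbitrary: as)
  case (Cons g gs)
  have H: "H \<subseteq> carrier G" using Cons.prems(2) generate_in_carrier[OF Cons.prems(3)] by blast
  have g: "g \<in> carrier G" "g \<in> H" "set gs \<subseteq> H" using Cons.prems(1) H by auto
  obtain h where h: "h \<in> H" "r g = conj_by h g" using assms(5)[OF g(2)] by blast
  have rg: "r g \<in> carrier G" using h g H by auto
  have gsc: "set (blocks gs) \<subseteq> carrier G" using g(3) H by (intro blocks_carrier) auto
  have "orb (as @ block g) = orb (as @ map (conj_by h) (block g))"
    using h g Cons.prems(2,3) by (intro orb_conj_generate tuple_prod_block block_carrier) auto
  also have "map (conj_by h) (block g) = block (r g)" using h by (simp add: block_def)
  finally have 1: "orb (as @ block g) = orb (as @ block (r g))" .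
  have "orb ((as @ block g) @ (blocks gs @ t)) = orb ((as @ block (r g)) @ (blocks gs @ t))"
    by (intro orb_cong HOL.refl 1) (use g rg gsc Cons.prems(3) assms(4) in simp_all)
  also have "\<dots> = orb ((as @ block (r g)) @ blocks (map r gs) @ t)"
  proof (rule Cons.IH[OF g(3)])
    show "set (as @ block (r g)) \<subseteq> carrier G" using rg Cons.prems(3) by simp
    then show "H \<subseteq> generate G (set (as @ block (r g)))"
      using Cons.prems(2) mono_generate[of "set as" "set (as @ block (r g))"] by auto
  qed
  finally show ?case by simp
qed simp

text \<open>A copy of \<open>g\<close> carried to the front conjugates the entries it passes by the
  inverse of \<open>g\<close>. This neither destroys nor creates copies of \<open>g\<close>, so the
  extraction can be repeated.\<close>

lemma orb_extract:
  assumes "set t \<subseteq> carrier G" "k \<le> count_list t g" "g \<in> carrier G"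
  shows "\<exists>t'. set t' \<subseteq> carrier G \<and> orb t = orb (replicate k g @ t')"
  using assms(1,2)
proof (induction k arbitrary: t)
  case (Suc k)
  then have "g \<in> set t" using count_notin[of g t] by fastforce
  then obtain a b where t: "t = a @ g # b" by (meson split_list)
  let ?t1 = "map (conj_by (inv g)) a @ b"
  have c: "set a \<subseteq> carrier G" "set b \<subseteq> carrier G" "set ?t1 \<subseteq> carrier G" using Suc.prems t assms(3) by auto
  have "orb ((a @ [g]) @ b) = orb ((g # map (conj_by (inv g)) a) @ b)"
    by (intro orb_cong HOL.refl orb_move_left) (use c assms(3) in auto)
  then have 1: "orb t = orb ([g] @ ?t1)" using t by simp
  have "count_list (map (conj_by (inv g)) a) g = count_list a g"
    using c(1)
  proof (induction a)
    case (Cons x a)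
    have "conj_by (inv g) x = g \<longleftrightarrow> x = g" if "x \<in> carrier G"
      using that assms(3) conj_by_inv(2)[of g x] conj_by_self by metis
    then show ?case using Cons by auto
  qed simp
  then have "k \<le> count_list ?t1 g" using Suc.prems(2) t by simp
  then obtain t' where t': "set t' \<subseteq> carrier G" "orb ?t1 = orb (replicate k g @ t')"
    using Suc.IH[OF c(3)] by blast
  have "orb ([g] @ ?t1) = orb ([g] @ (replicate k g @ t'))"
    by (intro orb_cong HOL.refl t'(2)) (use c t'(1) assms(3) in auto)
  then show ?case using 1 t'(1) by (intro exI[of _ t']) simp
qed (intro exI conjI, simp_all)

lemma orb_length:
  assumes "set xs \<subseteq> carrier G" "ys \<in> orb xs"
  shows "length ys = length xs"
  using hurwitz_orbit_closed[OF assms] by (simp add: tuples_def)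

text \<open>Split off blocks as long as the pigeonhole principle finds one; each shortens the tuple,
  and the bound on the remainder does not depend on \<open>t\<close>.\<close>

lemma orb_normal_form:
  assumes "set t \<subseteq> carrier G" "finite (carrier G)"
  shows "\<exists>gs t'. set gs \<subseteq> carrier G \<and> set t' \<subseteq> carrier G \<and> length t' \<le> order G * order G \<and>
    orb t = orb (blocks gs @ t')"
  using assms(1)
proof (induction "length t" arbitrary: t rule: less_induct)
  case less
  show ?case
  proof (cases "length t \<le> order G * order G")
    case True
    then show ?thesis using less.prems by (intro exI[of _ "[]"] exI[of _ t]) simp
  next
    case False
    then obtain g where g: "g \<in> carrier G" "order G \<le> count_list t g"
      using pigeonhole_count[OF less.prems assms(2), of "order G"] by (auto simp: order_def)
    obtain t1 where t1: "set t1 \<subseteq> carrier G" "orb t = orb (block g @ t1)"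
      using orb_extract[OF less.prems g(2,1)] by (auto simp: block_def)
    have "length t = length (block g @ t1)"
      using orb_length[of "block g @ t1" t] hurwitz_orbit_self[OF less.prems] t1 g by simp
    moreover have "0 < order G" using assms(2) order_gt_0_iff_finite by blast
    ultimately have "length t1 < length t" by (simp add: block_def)
    then obtain gs t' where *: "set gs \<subseteq> carrier G" "set t' \<subseteq> carrier G" "length t' \<le> order G * order G"
      "orb t1 = orb (blocks gs @ t')" using less.hyps t1(1) by blast
    have "orb (block g @ t1) = orb (block g @ (blocks gs @ t'))"
      by (intro orb_cong HOL.refl *(4)) (use *(1,2) g t1(1) in simp_all)
    then show ?thesis using * g t1(2) by (intro exI[of _ "g # gs"] exI[of _ t']) simp
  qed
qed

definition conj_closed :: "'a set \<Rightarrow> 'a set \<Rightarrow> bool" where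
  "conj_closed H C \<longleftrightarrow> (\<forall>h\<in>H. \<forall>x\<in>H. conj_by h x \<in> C \<longleftrightarrow> x \<in> C)"

lemma conj_by_subgroup: "subgroup H G \<Longrightarrow> h \<in> H \<Longrightarrow> x \<in> H \<Longrightarrow> conj_by h x \<in> H"
  unfolding conj_by_def by (intro subgroup.m_closed subgroup.m_inv_closed)

lemma hurwitz_letter_split:
  assumes "Suc i < length gs"
  obtains a x y b where "gs = a @ x # y # b"
    "hurwitz_letter G (i, True) gs = a @ conj_by x y # x # b"
    "hurwitz_letter G (i, False) gs = a @ y # (inv y \<otimes> x \<otimes> y) # b"
proof -
  define a where "a = take i gs"
  define b where "b = drop (Suc (Suc i)) gs"
  have gs: "gs = a @ gs ! i # gs ! Suc i # b" and a: "length a = i"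
    using assms by (auto simp: a_def b_def Cons_nth_drop_Suc)
  show ?thesis
  proof
    show "gs = a @ gs ! i # gs ! Suc i # b" by (rule gs)
    show "hurwitz_letter G (i, True) gs = a @ conj_by (gs ! i) (gs ! Suc i) # gs ! i # b"
      "hurwitz_letter G (i, False) gs = a @ gs ! Suc i # (inv (gs ! Suc i) \<otimes> gs ! i \<otimes> gs ! Suc i) # b"
      by (subst (1) gs, simp add: a list_update_append conj_by_def)+
  qed
qed

text \<open>A letter moves one entry and replaces its neighbour by a conjugate under an element of
  \<open>H\<close>, so entries stay in \<open>H\<close> and do not change their class.\<close>

lemma orb_invariant:
  assumes "subgroup H G" "conj_closed H C" "set gs \<subseteq> H" "ys \<in> orb gs"
  shows "set ys \<subseteq> H" "count_in C ys = count_in C gs"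
proof -
  have H: "H \<subseteq> carrier G" using assms(1) by (rule subgroup.subset)
  have letter: "set (hurwitz_letter G x hs) \<subseteq> H \<and> count_in C (hurwitz_letter G x hs) = count_in C hs"
    if hs: "set hs \<subseteq> H" and x: "Suc (fst x) < length hs" for x hs
  proof -
    obtain i b where xi: "x = (i, b)" by (cases x)
    then have "Suc i < length hs" using x by simp
    then obtain a u v c where s: "hs = a @ u # v # c"
      "hurwitz_letter G (i, True) hs = a @ conj_by u v # u # c"
      "hurwitz_letter G (i, False) hs = a @ v # (inv v \<otimes> u \<otimes> v) # c"
      by (rule hurwitz_letter_split)
    have uv: "u \<in> H" "v \<in> H" "inv v \<in> H" "u \<in> carrier G" "v \<in> carrier G"
      using hs s(1) H subgroup.m_inv_closed[OF assms(1)] by auto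
    have e: "inv v \<otimes> u \<otimes> v = conj_by (inv v) u" using uv by (simp add: conj_by_def)
    have "conj_by u v \<in> H" "conj_by (inv v) u \<in> H" "conj_by u v \<in> C \<longleftrightarrow> v \<in> C" "conj_by (inv v) u \<in> C \<longleftrightarrow> u \<in> C"
      using uv assms(1,2) by (auto intro: conj_by_subgroup simp: conj_closed_def)
    moreover have "hurwitz_letter G x hs = (if b then a @ conj_by u v # u # c else a @ v # conj_by (inv v) u # c)"
      using s(2,3) unfolding xi e by (cases b) simp_all
    moreover have "set a \<subseteq> H" "set c \<subseteq> H" using hs s(1) by auto
    ultimately show ?thesis using uv by (simp add: s(1))
  qed
  have word: "set (hurwitz_word G w gs) \<subseteq> H \<and> length (hurwitz_word G w gs) = length gs \<and>
      count_in C (hurwitz_word G w gs) = count_in C gs"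
    if "w \<in> braid_words (length gs)" for w
    using that
  proof (induction w)
    case (Cons x w)
    let ?hs = "hurwitz_word G w gs"
    have IH: "set ?hs \<subseteq> H" "length ?hs = length gs" "count_in C ?hs = count_in C gs" and x: "Suc (fst x) < length gs"
      using Cons by auto
    have "length (hurwitz_letter G x ?hs) = length ?hs" by (cases x rule: prod.exhaust, rename_tac i b, case_tac b) auto
    then show ?case using letter[of ?hs x] IH x by (simp add: hurwitz_word_def)
  qed (simp add: hurwitz_word_def assms(3))
  have "set gs \<subseteq> carrier G" using assms(3) H by blast
  then show "set ys \<subseteq> H" "count_in C ys = count_in C gs"
    using assms(4) word by (auto simp: hurwitz_orbit_words)
qed

end

section \<open>The monoid of components\<close>

context group
begin

section \<open>Conjugacy classes under a subgroup\<close>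

definition conj_class :: "'a set \<Rightarrow> 'a \<Rightarrow> 'a set" where
  "conj_class H x = (\<lambda>h. conj_by h x) ` H"

lemma conj_class_self: "subgroup H G \<Longrightarrow> x \<in> carrier G \<Longrightarrow> x \<in> conj_class H x"
  unfolding conj_class_def using subgroup.one_closed[of H G] conj_by_one[of x] by force

lemma conj_class_subset: "subgroup H G \<Longrightarrow> x \<in> H \<Longrightarrow> conj_class H x \<subseteq> H"
  unfolding conj_class_def using conj_by_subgroup by blast

lemma conj_class_conj_by:
  assumes "subgroup H G" "h \<in> H" "x \<in> H"
  shows "conj_class H (conj_by h x) = conj_class H x"
proof -
  have H: "H \<subseteq> carrier G" using assms(1) by (rule subgroup.subset)
  have sub: "conj_class H (conj_by k y) \<subseteq> conj_class H y" if "k \<in> H" "y \<in> H" for k y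
  proof
    fix z assume "z \<in> conj_class H (conj_by k y)"
    then obtain l where l: "l \<in> H" "z = conj_by l (conj_by k y)" by (auto simp: conj_class_def)
    then have "z = conj_by (l \<otimes> k) y" using conj_by_conj_by[of l k y] that H by auto
    then show "z \<in> conj_class H y"
      using subgroup.m_closed[OF assms(1) l(1) that(1)] by (auto simp: conj_class_def)
  qed
  have "conj_by (inv h) (conj_by h x) = x" using assms(2,3) H by (intro conj_by_inv) auto
  then have "conj_class H x \<subseteq> conj_class H (conj_by h x)"
    using sub[of "inv h" "conj_by h x"] subgroup.m_inv_closed[OF assms(1,2)] conj_by_subgroup[OF assms] by simp
  then show ?thesis using sub[OF assms(2,3)] by blast
qed

lemma conj_class_eq:
  assumes "subgroup H G" "x \<in> H" "y \<in> conj_class H x"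
  shows "conj_class H y = conj_class H x"
  using assms conj_class_conj_by by (auto simp: conj_class_def[of H x])

lemma conj_closed_conj_class:
  assumes "subgroup H G" "x \<in> H"
  shows "conj_closed H (conj_class H x)"
  unfolding conj_closed_def
proof (intro ballI)
  fix h y assume h: "h \<in> H" "y \<in> H"
  have H: "H \<subseteq> carrier G" using assms(1) by (rule subgroup.subset)
  have "z \<in> conj_class H x \<longleftrightarrow> conj_class H z = conj_class H x" if "z \<in> H" for z
    using conj_class_eq[OF assms] conj_class_self[OF assms(1), of z] that H by blast
  then show "conj_by h y \<in> conj_class H x \<longleftrightarrow> y \<in> conj_class H x"
    using h conj_class_conj_by[OF assms(1) h] conj_by_subgroup[OF assms(1) h] by simp
qed

lemma conj_class_disjoint:
  assumes "subgroup H G" "x \<in> H" "y \<in> H" "conj_class H x \<noteq> conj_class H y"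
  shows "conj_class H x \<inter> conj_class H y = {}"
  using conj_class_eq[OF assms(1,2)] conj_class_eq[OF assms(1,3)] assms(4) by blast

lemma conjugacy_classes_subgroup:
  assumes "subgroup H G"
  shows "conjugacy_classes (G\<lparr>carrier := H\<rparr>) = conj_class H ` H"
proof -
  have "orbit (G\<lparr>carrier := H\<rparr>) (\<lambda>g. \<lambda>h\<in>H. g \<otimes> h \<otimes> inv\<^bsub>G\<lparr>carrier := H\<rparr>\<^esub> g) x = conj_class H x"
    if "x \<in> H" for x
    using that m_inv_consistent[OF assms]
    by (simp add: orbit_def conj_class_def conj_by_def Setcompr_eq_image cong: image_cong)
  then show ?thesis
    unfolding conjugacy_classes_def orbits_def by auto
qed

lemma conjugacy_classes_eq: "conjugacy_classes G = conj_class (carrier G) ` carrier G"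
  using conjugacy_classes_subgroup[OF subgroup_self] by simp

text \<open>Next to a tuple generating \<open>H\<close>, the blocks of the normal form may be replaced by blocks of
  class representatives, whose multiplicities are read off from the class counts.\<close>

lemma orb_eq_of_counts:
  assumes "finite (carrier G)" "subgroup H G" "set ms \<subseteq> carrier G" "generate G (set ms) = H"
    and "set t1 \<subseteq> H" "set t2 \<subseteq> H"
    and "set gs1 \<subseteq> carrier G" "set gs2 \<subseteq> carrier G" "set t' \<subseteq> carrier G"
    and "orb t1 = orb (blocks gs1 @ t')" "orb t2 = orb (blocks gs2 @ t')"
    and "\<And>x. x \<in> H \<Longrightarrow> count_in (conj_class H x) t1 = count_in (conj_class H x) t2"
  shows "orb (ms @ t1) = orb (ms @ t2)"
proof -
  have H: "H \<subseteq> carrier G" using assms(2) by (rule subgroup.subset)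
  have N: "0 < order G" using assms(1) order_gt_0_iff_finite by blast
  \<comment> \<open>\<open>SOME\<close> is applied to the class as a set, so \<open>r\<close> is
    constant on each class.\<close>
  define r where "r x = (SOME y. y \<in> conj_class H x)" for x
  have r: "r x \<in> conj_class H x" if "x \<in> H" for x
    unfolding r_def
    by (rule someI[where P = "\<lambda>y. y \<in> conj_class H x"]) (use that H in \<open>auto intro: conj_class_self[OF assms(2)]\<close>)
  have r_eq: "r x = y \<longleftrightarrow> x \<in> conj_class H y \<and> r y = y" if "x \<in> H" "y \<in> H" for x y
  proof
    assume y: "r x = y"
    then have eq: "conj_class H y = conj_class H x"
      using r[OF that(1)] by (intro conj_class_eq[OF assms(2) that(1)]) simp
    moreover have "x \<in> conj_class H x" using that H by (intro conj_class_self[OF assms(2)]) auto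
    ultimately show "x \<in> conj_class H y \<and> r y = y" using y by (auto simp: r_def)
  next
    assume "x \<in> conj_class H y \<and> r y = y"
    then show "r x = y" using conj_class_eq[OF assms(2) that(2), of x] by (auto simp: r_def)
  qed
  \<comment> \<open>Common to both tuples: the entries of the normal form lie in \<open>H\<close>,
    its blocks may be replaced by those of representatives, and each class count of \<open>t\<close>
    is |G| times that of \<open>gs\<close> plus that of the remainder \<open>t'\<close>.\<close>
  have form: "set gs \<subseteq> H \<and> set (map r gs) \<subseteq> H \<and> orb (ms @ t) = orb (ms @ blocks (map r gs) @ t') \<and>
      (\<forall>x\<in>H. order G * count_in (conj_class H x) gs + count_in (conj_class H x) t' = count_in (conj_class H x) t)"
    if t: "set t \<subseteq> H" and gs: "set gs \<subseteq> carrier G" and eq: "orb t = orb (blocks gs @ t')" for t gs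
  proof -
    have "blocks gs @ t' \<in> orb t"
      unfolding eq using gs assms(9) by (intro hurwitz_orbit_self) simp
    note inv = orb_invariant[OF assms(2) _ t this]
    have "set (blocks gs @ t') \<subseteq> H" using inv(1)[of H] conj_by_subgroup[OF assms(2)] by (auto simp: conj_closed_def)
    moreover have "set gs \<subseteq> set (blocks gs)" using N by (induction gs) (auto simp: block_def)
    ultimately have gsH: "set gs \<subseteq> H" by auto
    have rH: "set (map r gs) \<subseteq> H" using gsH r conj_class_subset[OF assms(2)] by auto
    have "orb (ms @ t) = orb (ms @ (blocks gs @ t'))"
      by (rule orb_cong[OF _ _ _ _ HOL.refl eq]) (use assms(3,9) t H gs in auto)
    also have "\<dots> = orb (ms @ blocks (map r gs) @ t')"
    proof (rule orb_blocks_conj[OF gsH])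
      show "\<exists>h\<in>H. r g = conj_by h g" if "g \<in> H" for g
        using r[OF that] unfolding conj_class_def by blast
    qed (use assms(3,4,9) in auto)
    finally have "orb (ms @ t) = orb (ms @ blocks (map r gs) @ t')" .
    moreover have "order G * count_in (conj_class H x) gs + count_in (conj_class H x) t' = count_in (conj_class H x) t"
      if "x \<in> H" for x
      using inv(2)[OF conj_closed_conj_class[OF assms(2) that]] by (simp add: count_in_blocks)
    ultimately show ?thesis using gsH rH by blast
  qed
  note f1 = form[OF assms(5,7,10)] and f2 = form[OF assms(6,8,11)]
  \<comment> \<open>Both normal forms have the same remainder, so equal counts of \<open>t1\<close>
    and \<open>t2\<close> give equal counts of \<open>gs1\<close> and \<open>gs2\<close> after
    division by |G|.\<close>
  have cls: "count_in (conj_class H x) gs1 = count_in (conj_class H x) gs2" if "x \<in> H" for x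
  proof -
    have "order G * count_in (conj_class H x) gs1 = order G * count_in (conj_class H x) gs2"
      using f1 f2 assms(12)[OF that] that by (metis add_right_cancel)
    then show ?thesis using N by simp
  qed
  \<comment> \<open>A representative \<open>y\<close> occurs once for each entry of
    \<open>gs\<close> in its class, and no other element occurs.\<close>
  have count_r: "count (mset (map r gs)) y = (if y \<in> H \<and> r y = y then count_in (conj_class H y) gs else 0)"
    if "set gs \<subseteq> H" for gs y
    using that
  proof (induction gs)
    case (Cons g gs)
    have "r g \<in> H" using Cons.prems r[of g] conj_class_subset[OF assms(2), of g] by auto
    then have "r g = y \<longleftrightarrow> y \<in> H \<and> g \<in> conj_class H y \<and> r y = y"
      using r_eq[of g y] Cons.prems by auto
    then show ?case using Cons by auto
  qed simp
  have "mset (map r gs1) = mset (map r gs2)"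
    using count_r[of gs1] count_r[of gs2] f1 f2 cls by (intro multiset_eqI) simp
  then have "orb (ms @ blocks (map r gs1) @ t') = orb (ms @ blocks (map r gs2) @ t')"
    using f1 H assms(3,9) by (intro orb_blocks_mset) auto
  then show ?thesis using f1 f2 by simp
qed

end

locale hurwitz_stratum = group G for G :: "('a, 'b) monoid_scheme" (structure) +
  fixes D :: "'a set set" and \<xi> :: "'a set \<Rightarrow> nat" and H :: "'a set"
  assumes fin: "finite (carrier G)" and D_ne: "D \<noteq> {}" and D: "D \<subseteq> conjugacy_classes G"
    and \<xi>_pos: "\<And>\<gamma>. \<gamma> \<in> D \<Longrightarrow> 0 < \<xi> \<gamma>" and gen: "D_generated G D H"
begin

abbreviation "C \<equiv> Comp G D \<xi>"

definition component_tuple :: "nat \<Rightarrow> 'a list \<Rightarrow> bool" where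
  "component_tuple n gs \<longleftrightarrow> set gs \<subseteq> carrier G \<and> length gs = n * (\<Sum>\<gamma>\<in>D. \<xi> \<gamma>) \<and> tuple_prod gs = \<one> \<and>
    (\<forall>\<gamma>\<in>D. count_in \<gamma> gs = n * \<xi> \<gamma>)"

lemma H_sub: "subgroup H G" and H_meets: "\<gamma> \<in> D \<Longrightarrow> \<gamma> \<inter> H \<noteq> {}"
  and H_gen: "generate G (\<Union>\<gamma>\<in>D. \<gamma> \<inter> H) = H"
  using gen by (auto simp: D_generated_def)

lemma H_carrier: "H \<subseteq> carrier G"
  by (rule subgroup.subset[OF H_sub])

lemma finite_H: "finite H"
  using H_carrier fin finite_subset by blast

lemma finite_D: "finite D"
  using D fin unfolding conjugacy_classes_eq by (meson finite_imageI finite_subset)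

lemma D_class: "\<gamma> \<in> D \<Longrightarrow> \<exists>x\<in>carrier G. \<gamma> = conj_class (carrier G) x"
  using D unfolding conjugacy_classes_eq by blast

lemma D_conj_closed: "\<gamma> \<in> D \<Longrightarrow> conj_closed (carrier G) \<gamma>"
  using D_class conj_closed_conj_class[OF subgroup_self] by blast

lemma D_disjoint: "\<gamma> \<in> D \<Longrightarrow> \<delta> \<in> D \<Longrightarrow> \<gamma> \<noteq> \<delta> \<Longrightarrow> \<gamma> \<inter> \<delta> = {}"
  using D_class[of \<gamma>] D_class[of \<delta>] conj_class_disjoint[OF subgroup_self] by blast

lemma xi_sum_pos: "0 < (\<Sum>\<gamma>\<in>D. \<xi> \<gamma>)"
  using D_ne finite_D \<xi>_pos by (simp add: sum_pos)

lemma carrier_Comp: "carrier C = {orb gs | gs. \<exists>n. component_tuple n gs}"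
  unfolding Comp_def components_def component_tuple_def tuples_def tuple_prod_def count_in_def by auto

lemma component_tuple_append: "component_tuple m xs \<Longrightarrow> component_tuple n ys \<Longrightarrow> component_tuple (m + n) (xs @ ys)"
  by (auto simp: component_tuple_def tuple_prod_append algebra_simps)

lemma component_tuple_Nil: "component_tuple 0 []"
  by (simp add: component_tuple_def)

lemma component_tuple_carrier: "component_tuple n xs \<Longrightarrow> set xs \<subseteq> carrier G"
  by (simp add: component_tuple_def)

lemma orb_mult: "component_tuple m xs \<Longrightarrow> component_tuple n ys \<Longrightarrow> orb xs \<otimes>\<^bsub>C\<^esub> orb ys = orb (xs @ ys)"
  by (intro Comp_mult) (auto simp: component_tuple_def)

lemma one_Comp: "\<one>\<^bsub>C\<^esub> = orb []"
  by (simp add: Comp_def)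

lemma comm_monoid_Comp: "comm_monoid C"
proof (rule comm_monoidI)
  show "\<one>\<^bsub>C\<^esub> \<in> carrier C"
    unfolding one_Comp carrier_Comp using component_tuple_Nil by blast
  fix X Y assume "X \<in> carrier C" "Y \<in> carrier C"
  then obtain xs ys m n where xy: "X = orb xs" "Y = orb ys" "component_tuple m xs" "component_tuple n ys"
    unfolding carrier_Comp by blast
  then show "X \<otimes>\<^bsub>C\<^esub> Y \<in> carrier C"
    using orb_mult component_tuple_append unfolding carrier_Comp by blast
  show "X \<otimes>\<^bsub>C\<^esub> Y = Y \<otimes>\<^bsub>C\<^esub> X"
    using xy orb_commute[of xs ys] by (simp add: orb_mult[of m _ n] orb_mult[of n _ m] component_tuple_def)
  show "\<one>\<^bsub>C\<^esub> \<otimes>\<^bsub>C\<^esub> X = X"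
    unfolding one_Comp xy(1) using orb_mult[OF component_tuple_Nil xy(3)] by simp
  fix Z assume "Z \<in> carrier C"
  then obtain zs l where z: "Z = orb zs" "component_tuple l zs" unfolding carrier_Comp by blast
  show "X \<otimes>\<^bsub>C\<^esub> Y \<otimes>\<^bsub>C\<^esub> Z = X \<otimes>\<^bsub>C\<^esub> (Y \<otimes>\<^bsub>C\<^esub> Z)"
    unfolding xy(1,2) z(1) orb_mult[OF xy(3,4)] orb_mult[OF xy(4) z(2)]
      orb_mult[OF component_tuple_append[OF xy(3,4)] z(2)] orb_mult[OF xy(3) component_tuple_append[OF xy(4) z(2)]]
    by simp
qed

text \<open>The prescribed counts already add up to the length, which leaves no room for entries
  outside the classes in \<open>D\<close>.\<close>

lemma component_tuple_entries:
  assumes "component_tuple n t"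
  shows "set t \<subseteq> \<Union>D"
proof -
  have "count_in (\<Union>D) t = (\<Sum>\<gamma>\<in>D. count_in \<gamma> t)"
    using finite_D D_disjoint by (rule count_in_UN)
  also have "\<dots> = length t" using assms by (simp add: component_tuple_def sum_distrib_left)
  finally have "\<not> (\<exists>x\<in>set t. x \<notin> \<Union>D)"
    unfolding count_in_def using length_filter_less[of _ t "\<lambda>x. x \<in> \<Union>D"] by (metis less_irrefl)
  then show ?thesis by blast
qed

section \<open>Classes of \<open>H\<close> inside the classes in \<open>D\<close>\<close>

abbreviation "H_classes \<equiv> D_star G D H"

lemma conj_class_in_D:
  assumes "\<gamma> \<in> D" "x \<in> H" "x \<in> \<gamma>"
  shows "conj_class H x \<subseteq> \<gamma> \<inter> H"
proof -
  have "conj_by h x \<in> \<gamma>" if "h \<in> H" for h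
  proof -
    have "h \<in> carrier G" "x \<in> carrier G" using assms(2) that H_carrier by auto
    then show ?thesis using D_conj_closed[OF assms(1)] assms(3) by (simp add: conj_closed_def)
  qed
  then show ?thesis using conj_class_subset[OF H_sub assms(2)] by (auto simp: conj_class_def)
qed

lemma D_star_eq: "H_classes = {conj_class H x | x. x \<in> H \<inter> \<Union>D}"
proof -
  have "conj_class H x \<subseteq> (\<Union>\<gamma>\<in>D. \<gamma> \<inter> H) \<longleftrightarrow> x \<in> \<Union>D" if x: "x \<in> H" for x
  proof
    assume "conj_class H x \<subseteq> (\<Union>\<gamma>\<in>D. \<gamma> \<inter> H)"
    moreover have "x \<in> conj_class H x" using x H_carrier by (intro conj_class_self[OF H_sub]) auto
    ultimately show "x \<in> \<Union>D" by blast
  next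
    assume "x \<in> \<Union>D"
    then obtain \<gamma> where \<gamma>: "\<gamma> \<in> D" "x \<in> \<gamma>" by blast
    then have "conj_class H x \<subseteq> \<gamma> \<inter> H" using x by (intro conj_class_in_D)
    then show "conj_class H x \<subseteq> (\<Union>\<gamma>\<in>D. \<gamma> \<inter> H)" using \<gamma>(1) by blast
  qed
  then show ?thesis unfolding D_star_def conjugacy_classes_subgroup[OF H_sub] by blast
qed

definition classes_in :: "'a set \<Rightarrow> 'a set set" where
  "classes_in \<gamma> = {A \<in> H_classes. A \<subseteq> \<gamma>}"

lemma finite_H_classes: "finite H_classes"
  unfolding D_star_eq using finite_H by simp

lemma H_classes_ne: "A \<in> H_classes \<Longrightarrow> A \<noteq> {}"
  unfolding D_star_eq using subgroup.one_closed[OF H_sub] by (auto simp: conj_class_def)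

lemma H_classes_H: "A \<in> H_classes \<Longrightarrow> A \<subseteq> H"
  unfolding D_star_eq using conj_class_subset[OF H_sub] by blast

lemma H_classes_conj_closed: "A \<in> H_classes \<Longrightarrow> conj_closed H A"
  unfolding D_star_eq using conj_closed_conj_class[OF H_sub] by blast

lemma H_classes_disjoint: "A \<in> H_classes \<Longrightarrow> B \<in> H_classes \<Longrightarrow> A \<noteq> B \<Longrightarrow> A \<inter> B = {}"
  unfolding D_star_eq using conj_class_disjoint[OF H_sub] by blast

lemma H_classes_classes_in: "A \<in> H_classes \<Longrightarrow> \<exists>\<gamma>\<in>D. A \<in> classes_in \<gamma>"
  unfolding D_star_eq classes_in_def using conj_class_in_D by blast

lemma classes_in_unique: "A \<in> classes_in \<gamma> \<Longrightarrow> A \<in> classes_in \<delta> \<Longrightarrow> \<gamma> \<in> D \<Longrightarrow> \<delta> \<in> D \<Longrightarrow> \<gamma> = \<delta>"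
  unfolding classes_in_def using D_disjoint[of \<gamma> \<delta>] H_classes_ne[of A] by blast

lemma Union_classes_in:
  assumes "\<gamma> \<in> D"
  shows "\<Union>(classes_in \<gamma>) = \<gamma> \<inter> H"
proof
  show "\<Union>(classes_in \<gamma>) \<subseteq> \<gamma> \<inter> H" unfolding classes_in_def using H_classes_H by blast
  show "\<gamma> \<inter> H \<subseteq> \<Union>(classes_in \<gamma>)"
  proof
    fix x assume x: "x \<in> \<gamma> \<inter> H"
    then have "conj_class H x \<in> classes_in \<gamma>"
      unfolding classes_in_def D_star_eq using conj_class_in_D[OF assms, of x] assms by blast
    moreover have "x \<in> conj_class H x" using x H_carrier by (intro conj_class_self[OF H_sub]) auto
    ultimately show "x \<in> \<Union>(classes_in \<gamma>)" by blast
  qed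
qed

lemma count_in_classes_in:
  assumes "\<gamma> \<in> D" "set t \<subseteq> H"
  shows "(\<Sum>A\<in>classes_in \<gamma>. count_in A t) = count_in \<gamma> t"
proof -
  have "count_in (\<Union>(classes_in \<gamma>)) t = (\<Sum>A\<in>classes_in \<gamma>. count_in A t)"
    using finite_H_classes H_classes_disjoint by (intro count_in_UN) (auto simp: classes_in_def)
  moreover have "count_in (\<gamma> \<inter> H) t = count_in \<gamma> t"
    unfolding count_in_def using assms(2) by (intro arg_cong[of _ _ length] filter_cong) auto
  ultimately show ?thesis using Union_classes_in[OF assms(1)] by simp
qed

definition main_class :: "'a set \<Rightarrow> 'a set" where
  "main_class \<gamma> = (SOME A. A \<in> classes_in \<gamma>)"

text \<open>The classes whose counts serve as free coordinates. One class is left out for each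
  \<gamma>, because its count is determined by the others and the total for \<gamma>.\<close>

definition free_classes :: "'a set set" where
  "free_classes = H_classes - main_class ` D"

lemma main_class_classes_in: "\<gamma> \<in> D \<Longrightarrow> main_class \<gamma> \<in> classes_in \<gamma>"
proof -
  assume "\<gamma> \<in> D"
  then have "classes_in \<gamma> \<noteq> {}" using Union_classes_in[of \<gamma>] H_meets[of \<gamma>] by auto
  then show ?thesis by (simp add: main_class_def some_in_eq)
qed

lemma inj_main_class: "inj_on main_class D"
proof (rule inj_onI)
  fix \<gamma> \<delta> assume "\<gamma> \<in> D" "\<delta> \<in> D" "main_class \<gamma> = main_class \<delta>"
  then show "\<gamma> = \<delta>" using classes_in_unique[of "main_class \<gamma>" \<gamma> \<delta>]
      main_class_classes_in[of \<gamma>] main_class_classes_in[of \<delta>] by simp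
qed

lemma main_class_H_classes: "main_class ` D \<subseteq> H_classes"
  using main_class_classes_in by (auto simp: classes_in_def)

lemma finite_free_classes: "finite free_classes" and free_classes_subset: "free_classes \<subseteq> H_classes"
  using finite_H_classes by (auto simp: free_classes_def)

text \<open>Each \<gamma> accounts for one element of \<open>D_restrict D H\<close> and for one
  omitted class, and both assignments are injective because the classes in \<open>D\<close> are
  disjoint and meet \<open>H\<close>.\<close>

lemma splitting_number_eq: "splitting_number G D H = int (card free_classes)"
proof -
  have "D_restrict D H = (\<lambda>\<gamma>. \<gamma> \<inter> H) ` D" by (auto simp: D_restrict_def)
  moreover have "inj_on (\<lambda>\<gamma>. \<gamma> \<inter> H) D"
  proof (rule inj_onI)
    fix \<gamma> \<delta> assume "\<gamma> \<in> D" "\<delta> \<in> D" "\<gamma> \<inter> H = \<delta> \<inter> H"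
    then show "\<gamma> = \<delta>" using D_disjoint[of \<gamma> \<delta>] H_meets[of \<gamma>] by blast
  qed
  ultimately have "card (D_restrict D H) = card D" by (simp add: card_image)
  moreover have "card H_classes = card (main_class ` D) + card free_classes"
    unfolding free_classes_def using main_class_H_classes finite_H_classes by (simp add: card_Diff_subset finite_subset card_mono)
  ultimately show ?thesis
    unfolding splitting_number_def by (simp add: card_image[OF inj_main_class])
qed

text \<open>The count of \<open>main_class \<gamma>\<close> is recovered from the total \<open>n \<xi>(\<gamma>)\<close> for \<open>\<gamma>\<close>.\<close>

lemma counts_determined:
  assumes "component_tuple n1 t1" "component_tuple n2 t2" "set t1 \<subseteq> H" "set t2 \<subseteq> H" "length t1 = length t2"
    and "\<And>A. A \<in> free_classes \<Longrightarrow> count_in A t1 = count_in A t2" and "x \<in> H"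
  shows "count_in (conj_class H x) t1 = count_in (conj_class H x) t2"
proof (cases "conj_class H x \<in> H_classes")
  case True
  then obtain \<gamma> where \<gamma>: "\<gamma> \<in> D" "conj_class H x \<in> classes_in \<gamma>" using H_classes_classes_in by blast
  \<comment> \<open>Equal lengths force equal degrees, as the length is n |\<xi>| with |\<xi>| >
    0.\<close>
  have n: "n1 = n2" using assms(1,2,5) xi_sum_pos by (simp add: component_tuple_def)
  have free_classes: "A \<in> free_classes" if "A \<in> classes_in \<gamma> - {main_class \<gamma>}" for A
  proof -
    have "A \<noteq> main_class \<delta>" if "\<delta> \<in> D" for \<delta>
      using classes_in_unique[of A \<gamma> \<delta>] main_class_classes_in[OF that] \<gamma>(1) that \<open>A \<in> classes_in \<gamma> - {main_class \<gamma>}\<close> by auto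
    then show ?thesis using that by (auto simp: free_classes_def classes_in_def)
  qed
  have fp: "finite (classes_in \<gamma>)" using finite_H_classes by (simp add: classes_in_def)
  have "(\<Sum>A\<in>classes_in \<gamma>. count_in A t1) = (\<Sum>A\<in>classes_in \<gamma>. count_in A t2)"
    using count_in_classes_in[OF \<gamma>(1)] assms(1-4) \<gamma>(1) n by (simp add: component_tuple_def)
  moreover have "(\<Sum>A\<in>classes_in \<gamma> - {main_class \<gamma>}. count_in A t1) = (\<Sum>A\<in>classes_in \<gamma> - {main_class \<gamma>}. count_in A t2)"
    using free_classes assms(6) by (intro sum.cong) auto
  ultimately have "count_in (main_class \<gamma>) t1 = count_in (main_class \<gamma>) t2"
    using sum.remove[OF fp main_class_classes_in[OF \<gamma>(1)], of "\<lambda>A. count_in A t1"]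
      sum.remove[OF fp main_class_classes_in[OF \<gamma>(1)], of "\<lambda>A. count_in A t2"] by simp
  then show ?thesis using free_classes[of "conj_class H x"] assms(6) \<gamma>(2) by (cases "conj_class H x = main_class \<gamma>") auto
next
  case False
  \<comment> \<open>A class of \<open>H\<close> outside \<open>H_classes\<close> misses all classes
    in \<open>D\<close>, so both counts are 0.\<close>
  have "conj_class H x \<inter> \<Union>D = {}"
  proof (rule ccontr)
    assume "conj_class H x \<inter> \<Union>D \<noteq> {}"
    then obtain y where y: "y \<in> conj_class H x" "y \<in> \<Union>D" by blast
    then have "conj_class H x = conj_class H y" "y \<in> H"
      using conj_class_eq[OF H_sub assms(7)] conj_class_subset[OF H_sub assms(7)] by auto
    then show False using False y(2) unfolding D_star_eq by blast
  qed
  then have "count_in (conj_class H x) t = 0" if "component_tuple n t" for n t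
    using component_tuple_entries[OF that] by (auto simp: count_in_def filter_empty_conv)
  then show ?thesis using assms(1,2) by simp
qed

section \<open>Components with group inside \<open>H\<close>\<close>

definition repr :: "'a list set \<Rightarrow> 'a list" where
  "repr X = (SOME gs. gs \<in> X)"

definition H_components :: "'a list set set" where
  "H_components = {X \<in> carrier C. component_group G X \<subseteq> H}"

lemma repr_orb: "set gs \<subseteq> carrier G \<Longrightarrow> repr (orb gs) \<in> orb gs"
  unfolding repr_def using hurwitz_orbit_self by (rule someI)

lemma length_repr: "set gs \<subseteq> carrier G \<Longrightarrow> length (repr (orb gs)) = length gs"
  using orb_length repr_orb by blast

text \<open>Only lengths and class counts of \<open>repr\<close> are ever read off; they are
  constant on the orbit, so the arbitrary choice is harmless.\<close>

lemma count_in_repr: "set gs \<subseteq> H \<Longrightarrow> A \<in> H_classes \<Longrightarrow> count_in A (repr (orb gs)) = count_in A gs"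
  using orb_invariant(2)[OF H_sub H_classes_conj_closed _ repr_orb] H_carrier by auto

lemma orb_in_H_components_iff:
  assumes "component_tuple n gs"
  shows "orb gs \<in> H_components \<longleftrightarrow> set gs \<subseteq> H"
proof -
  have "generate G (set gs) \<subseteq> H \<longleftrightarrow> set gs \<subseteq> H"
    using generate_subgroup_incl[OF _ H_sub] generate.incl[of _ "set gs" G] by blast
  moreover have "orb gs \<in> carrier C" unfolding carrier_Comp using assms by blast
  ultimately show ?thesis
    unfolding H_components_def using component_group_orbit[OF component_tuple_carrier[OF assms]] by simp
qed

lemma H_componentsE:
  assumes "X \<in> H_components"
  obtains gs n where "X = orb gs" "component_tuple n gs" "set gs \<subseteq> H"
  using assms orb_in_H_components_iff unfolding H_components_def carrier_Comp by blast

text \<open>The entries of a concatenation lie in \<open>H\<close> exactly when those of both pieces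
  do. This closure under products and factors is what the weight primes require.\<close>

lemma mult_in_H_components_iff:
  assumes "X \<in> carrier C" "Y \<in> carrier C"
  shows "X \<otimes>\<^bsub>C\<^esub> Y \<in> H_components \<longleftrightarrow> X \<in> H_components \<and> Y \<in> H_components"
proof -
  obtain xs ys m n where xy: "X = orb xs" "Y = orb ys" "component_tuple m xs" "component_tuple n ys"
    using assms unfolding carrier_Comp by blast
  have "X \<otimes>\<^bsub>C\<^esub> Y = orb (xs @ ys)" unfolding xy(1,2) by (rule orb_mult[OF xy(3,4)])
  then show ?thesis
    using orb_in_H_components_iff[OF component_tuple_append[OF xy(3,4)]] orb_in_H_components_iff[OF xy(3)] orb_in_H_components_iff[OF xy(4)]
    unfolding xy(1,2) by simp
qed

text \<open>A product is determined by the remainder in the normal form of a tuple \<open>t\<close>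
  for \<open>X\<close>, the length of \<open>t\<close> and its counts in the free classes. The
  remainders form a finite set independent of \<open>L\<close>, and the other 1 + \<Omega> numbers
  lie between 0 and \<open>L\<close>.\<close>

lemma count_bound:
  assumes "component_tuple n ms" "generate G (set ms) = H"
  shows "finite {orb ms \<otimes>\<^bsub>C\<^esub> X | X. X \<in> H_components \<and> length (repr X) \<le> L}" (is "finite ?Q")
    and "card {orb ms \<otimes>\<^bsub>C\<^esub> X | X. X \<in> H_components \<and> length (repr X) \<le> L}
      \<le> card {t. set t \<subseteq> carrier G \<and> length t \<le> order G * order G} * (L + 1) ^ (card free_classes + 1)"
proof -
  let ?T = "{t. set t \<subseteq> carrier G \<and> length t \<le> order G * order G}"
  \<comment> \<open>One admissible choice of a representing tuple and its normal form for the
    product \<open>Q\<close>. Fixing the choices for all \<open>Q\<close> makes \<open>data\<close>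
    below a function of \<open>Q\<close>.\<close>
  define ok where "ok Q k t gs t' \<longleftrightarrow> component_tuple k t \<and> set t \<subseteq> H \<and> length t \<le> L \<and> Q = orb (ms @ t) \<and>
      set gs \<subseteq> carrier G \<and> t' \<in> ?T \<and> orb t = orb (blocks gs @ t')" for Q k t gs t'
  have "\<exists>z. ok Q (fst z) (fst (snd z)) (fst (snd (snd z))) (snd (snd (snd z)))" if Q: "Q \<in> ?Q" for Q
  proof -
    obtain X where X: "X \<in> H_components" "length (repr X) \<le> L" "Q = orb ms \<otimes>\<^bsub>C\<^esub> X" using Q by blast
    obtain t k where t: "X = orb t" "component_tuple k t" "set t \<subseteq> H" using X(1) by (rule H_componentsE)
    have tc: "set t \<subseteq> carrier G" using t(2) by (rule component_tuple_carrier)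
    obtain gs t' where gs: "set gs \<subseteq> carrier G" "set t' \<subseteq> carrier G" "length t' \<le> order G * order G"
      "orb t = orb (blocks gs @ t')" using orb_normal_form[OF tc fin] by blast
    have "length t \<le> L" using X(2) t(1) length_repr[OF tc] by simp
    moreover have "Q = orb (ms @ t)" using X(3) t(1) orb_mult[OF assms(1) t(2)] by simp
    ultimately have "ok Q k t gs t'" using t gs by (simp add: ok_def)
    then show ?thesis by (intro exI[of _ "(k, t, gs, t')"]) simp
  qed
  then have "\<forall>Q\<in>?Q. \<exists>z. ok Q (fst z) (fst (snd z)) (fst (snd (snd z))) (snd (snd (snd z)))" by blast
  from bchoice[OF this] obtain z where z:
    "\<And>Q. Q \<in> ?Q \<Longrightarrow> ok Q (fst (z Q)) (fst (snd (z Q))) (fst (snd (snd (z Q)))) (snd (snd (snd (z Q))))"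
    by blast
  define k where "k Q = fst (z Q)" for Q
  define t where "t Q = fst (snd (z Q))" for Q
  define gs where "gs Q = fst (snd (snd (z Q)))" for Q
  define t' where "t' Q = snd (snd (snd (z Q)))" for Q
  have d: "component_tuple (k Q) (t Q)" "set (t Q) \<subseteq> H" "length (t Q) \<le> L" "Q = orb (ms @ t Q)"
      "set (gs Q) \<subseteq> carrier G" "t' Q \<in> ?T" "orb (t Q) = orb (blocks (gs Q) @ t' Q)"
    if "Q \<in> ?Q" for Q
    using z[OF that] unfolding ok_def k_def t_def gs_def t'_def by blast+
  define data where "data Q = (t' Q, length (t Q), \<lambda>A\<in>free_classes. count_in A (t Q))" for Q
  let ?B = "?T \<times> {..L} \<times> (free_classes \<rightarrow>\<^sub>E {..L})"
  have finT: "finite ?T" using finite_lists_length_le[OF fin, of "order G * order G"] by simp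
  have finB: "finite ?B" using finT finite_free_classes by (intro finite_cartesian_product finite_PiE) auto
  have "inj_on data ?Q"
  proof (rule inj_onI)
    fix Q1 Q2 assume Q: "Q1 \<in> ?Q" "Q2 \<in> ?Q" and eq: "data Q1 = data Q2"
    note d1 = d[OF Q(1)] and d2 = d[OF Q(2)]
    have len: "length (t Q1) = length (t Q2)" and t': "t' Q1 = t' Q2"
      and fe: "(\<lambda>A\<in>free_classes. count_in A (t Q1)) = (\<lambda>A\<in>free_classes. count_in A (t Q2))"
      using eq by (simp_all add: data_def)
    have free_classes: "count_in A (t Q1) = count_in A (t Q2)" if "A \<in> free_classes" for A
      using fun_cong[OF fe, of A] that by simp
    have "orb (ms @ t Q1) = orb (ms @ t Q2)"
    proof (rule orb_eq_of_counts[OF fin H_sub component_tuple_carrier[OF assms(1)] assms(2)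
          d1(2) d2(2) d1(5) d2(5) _ d1(7)])
      show "count_in (conj_class H x) (t Q1) = count_in (conj_class H x) (t Q2)" if "x \<in> H" for x
        by (rule counts_determined[OF d1(1) d2(1) d1(2) d2(2) len free_classes that])
      show "orb (t Q2) = orb (blocks (gs Q2) @ t' Q1)" using d2(7) t' by simp
      show "set (t' Q1) \<subseteq> carrier G" using d1(6) by simp
    qed
    then show "Q1 = Q2" using d1(4) d2(4) by simp
  qed
  moreover have sub: "data ` ?Q \<subseteq> ?B"
  proof
    fix z assume "z \<in> data ` ?Q"
    then obtain Q where Q: "Q \<in> ?Q" "z = data Q" by blast
    have "count_in A (t Q) \<le> L" for A using d(3)[OF Q(1)] count_in_le_length[of A "t Q"] by linarith
    then show "z \<in> ?B" unfolding Q(2) data_def using d(3,6)[OF Q(1)] by auto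
  qed
  ultimately show "finite ?Q" using finB by (rule inj_on_finite)
  have "card ?Q \<le> card ?B" using \<open>inj_on data ?Q\<close> sub finB by (rule card_inj_on_le)
  also have "card ?B = card ?T * ((L + 1) * (L + 1) ^ card free_classes)"
    using finite_free_classes by (simp add: card_cartesian_product card_funcsetE)
  finally show "card ?Q \<le> card ?T * (L + 1) ^ (card free_classes + 1)" by simp
qed

section \<open>Tuples with prescribed multiplicities\<close>

definition power_tuple :: "('a \<Rightarrow> nat) \<Rightarrow> 'a list" where
  "power_tuple e = (let gl = SOME gl. set gl = H \<and> distinct gl in
    blocks (concat (map (\<lambda>g. replicate (e g) g) gl)))"

text \<open>Each g in \<open>H\<close> occurs |G| e(g) times. Building with blocks makes the product
  1 automatically, so a component can be prescribed by multiplicities alone, at the cost of a factor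
  |G| in the degree.\<close>

lemma power_tuple:
  shows set_power_tuple: "set (power_tuple e) = {g \<in> H. 0 < e g}"
    and count_in_power_tuple: "count_in A (power_tuple e) = order G * (\<Sum>g\<in>H \<inter> A. e g)"
    and length_power_tuple: "length (power_tuple e) = order G * (\<Sum>g\<in>H. e g)"
    and tuple_prod_power_tuple: "tuple_prod (power_tuple e) = \<one>"
proof -
  define gl where "gl = (SOME gl. set gl = H \<and> distinct gl)"
  have gl: "set gl = H" "distinct gl"
    using someI_ex[OF finite_distinct_list[OF finite_H]] unfolding gl_def by simp_all
  have N: "0 < order G" using fin order_gt_0_iff_finite by blast
  let ?f = "\<lambda>gl. concat (map (\<lambda>g. replicate (e g) g) gl)"
  have p: "power_tuple e = blocks (?f gl)" by (simp add: power_tuple_def Let_def gl_def)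
  have "set (blocks xs) = set xs" for xs using N by (induction xs) (auto simp: block_def)
  then show "set (power_tuple e) = {g \<in> H. 0 < e g}" unfolding p using gl(1) by auto
  have "count_in B (?f xs) = (\<Sum>g\<in>set xs \<inter> B. e g)" if "distinct xs" for B xs
    using that
  proof (induction xs)
    case (Cons x xs)
    then show ?case by (cases "x \<in> B") (auto simp: Int_insert_left)
  qed simp
  then have c: "count_in B (power_tuple e) = order G * (\<Sum>g\<in>H \<inter> B. e g)" for B
    unfolding p count_in_blocks using gl by simp
  then show "count_in A (power_tuple e) = order G * (\<Sum>g\<in>H \<inter> A. e g)" .
  have "length (power_tuple e) = count_in UNIV (power_tuple e)" by (simp add: count_in_def)
  then show "length (power_tuple e) = order G * (\<Sum>g\<in>H. e g)" using c[of UNIV] by simp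
  show "tuple_prod (power_tuple e) = \<one>"
    unfolding p using gl(1) H_carrier by (intro tuple_prod_blocks) auto
qed

lemma component_tuple_power_tuple:
  assumes "\<And>\<gamma>. \<gamma> \<in> D \<Longrightarrow> (\<Sum>g\<in>H \<inter> \<gamma>. e g) = n * \<xi> \<gamma>" and "\<And>g. g \<in> H \<Longrightarrow> g \<notin> \<Union>D \<Longrightarrow> e g = 0"
  shows "component_tuple (order G * n) (power_tuple e)" "set (power_tuple e) \<subseteq> H"
proof -
  show sub: "set (power_tuple e) \<subseteq> H" unfolding set_power_tuple by blast
  have "(\<Sum>g\<in>H. e g) = (\<Sum>g\<in>(\<Union>\<gamma>\<in>D. H \<inter> \<gamma>). e g)"
    using assms(2) finite_H by (intro sum.mono_neutral_right) auto
  also have "\<dots> = (\<Sum>\<gamma>\<in>D. \<Sum>g\<in>H \<inter> \<gamma>. e g)"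
    using finite_D finite_H D_disjoint by (intro sum.UNION_disjoint) blast+
  also have "\<dots> = n * (\<Sum>\<gamma>\<in>D. \<xi> \<gamma>)" using assms(1) by (simp add: sum_distrib_left)
  finally show "component_tuple (order G * n) (power_tuple e)"
    unfolding component_tuple_def using sub H_carrier assms(1)
    by (auto simp: tuple_prod_power_tuple length_power_tuple count_in_power_tuple)
qed

text \<open>All elements of \<gamma> \<inter> H receive the same positive multiplicity, so every
  generator of \<open>H\<close> occurs.\<close>

lemma exists_generating_tuple: "\<exists>n ms. component_tuple n ms \<and> 0 < n \<and> generate G (set ms) = H"
proof -
  \<comment> \<open>A common multiple of the sizes of the sets \<gamma> \<inter> H, so that the
    total q \<xi>(\<gamma>) can be spread evenly over \<gamma> \<inter> H.\<close>
  define q where "q = (\<Prod>\<gamma>\<in>D. card (H \<inter> \<gamma>))"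
  have card_pos: "0 < card (H \<inter> \<gamma>)" if "\<gamma> \<in> D" for \<gamma>
    using H_meets[OF that] finite_H by (simp add: card_gt_0_iff Int_commute)
  have dvd: "card (H \<inter> \<gamma>) dvd q" if "\<gamma> \<in> D" for \<gamma>
    unfolding q_def using finite_D that by (rule dvd_prodI)
  have q: "0 < q" unfolding q_def using card_pos by (simp add: prod_pos)
  define e where "e g = (\<Sum>\<gamma>\<in>D. if g \<in> \<gamma> then \<xi> \<gamma> * (q div card (H \<inter> \<gamma>)) else 0)" for g
  have e: "e g = \<xi> \<gamma> * (q div card (H \<inter> \<gamma>))" if "\<gamma> \<in> D" "g \<in> \<gamma>" for g \<gamma>
  proof -
    have "e g = (\<Sum>\<delta>\<in>D. if \<delta> = \<gamma> then \<xi> \<delta> * (q div card (H \<inter> \<delta>)) else 0)"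
      unfolding e_def using D_disjoint[of \<gamma>] that by (intro sum.cong) auto
    then show ?thesis using finite_D that(1) by simp
  qed
  have "(\<Sum>g\<in>H \<inter> \<gamma>. e g) = q * \<xi> \<gamma>" if "\<gamma> \<in> D" for \<gamma>
  proof -
    have "(\<Sum>g\<in>H \<inter> \<gamma>. e g) = card (H \<inter> \<gamma>) * (q div card (H \<inter> \<gamma>)) * \<xi> \<gamma>"
      using e[OF that] by simp
    then show ?thesis using dvd[OF that] by simp
  qed
  moreover have "e g = 0" if "g \<notin> \<Union>D" for g using that by (auto simp: e_def)
  ultimately have "component_tuple (order G * q) (power_tuple e)" using component_tuple_power_tuple(1)[of e q] by blast
  moreover have "set (power_tuple e) = (\<Union>\<gamma>\<in>D. \<gamma> \<inter> H)"
  proof -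
    have "0 < e g \<longleftrightarrow> g \<in> \<Union>D" for g
    proof
      assume "g \<in> \<Union>D"
      then obtain \<gamma> where \<gamma>: "\<gamma> \<in> D" "g \<in> \<gamma>" by blast
      have "0 < q div card (H \<inter> \<gamma>)"
        using dvd[OF \<gamma>(1)] q card_pos[OF \<gamma>(1)] by (auto elim!: dvdE)
      then show "0 < e g" using e[OF \<gamma>] \<xi>_pos[OF \<gamma>(1)] by simp
    qed (auto simp: e_def intro: ccontr)
    then show ?thesis unfolding set_power_tuple by auto
  qed
  moreover have "0 < order G * q" using q fin order_gt_0_iff_finite by simp
  ultimately show ?thesis using H_gen by metis
qed

text \<open>Both tuples have degree \<open>order G\<close>. In the first, each \<gamma> is
  represented by one point of its main class. In the second, one unit of multiplicity, that is |G|
  entries, is moved from this point to a point of \<open>A\<close>, for the \<gamma> containing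
  \<open>A\<close>. Among the free classes only the count in \<open>A\<close> changes.\<close>

lemma exists_separating_tuples:
  assumes "A \<in> free_classes"
  shows "\<exists>n t1 t2. component_tuple n t1 \<and> component_tuple n t2 \<and> set t1 \<subseteq> H \<and> set t2 \<subseteq> H \<and>
    (\<forall>B\<in>free_classes. count_in B t1 = count_in B t2 \<longleftrightarrow> B \<noteq> A)"
proof -
  define pt where "pt B = (SOME x. x \<in> B)" for B :: "'a set"
  have pt: "pt B \<in> B" if "B \<in> H_classes" for B
    unfolding pt_def using H_classes_ne[OF that] by (simp add: some_in_eq)
  obtain \<alpha> where \<alpha>: "\<alpha> \<in> D" "A \<in> classes_in \<alpha>" using H_classes_classes_in assms free_classes_subset by blast
  have AD: "A \<in> H_classes" "\<And>\<gamma>. \<gamma> \<in> D \<Longrightarrow> A \<noteq> main_class \<gamma>" using assms by (auto simp: free_classes_def)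
  define e1 where "e1 g = (\<Sum>\<gamma>\<in>D. if g = pt (main_class \<gamma>) then \<xi> \<gamma> else 0)" for g
  \<comment> \<open>The subtraction \<open>\<xi> \<alpha> - 1\<close> is not truncated, as \<xi> is
    positive on \<open>D\<close>.\<close>
  define e2 where "e2 g = (if g = pt A then 1 else if g = pt (main_class \<alpha>) then \<xi> \<alpha> - 1 else e1 g)" for g
  have ptd: "pt (main_class \<gamma>) \<in> \<gamma>" "pt (main_class \<gamma>) \<in> H" "pt (main_class \<gamma>) \<in> main_class \<gamma>" "main_class \<gamma> \<in> H_classes" if "\<gamma> \<in> D" for \<gamma>
    using main_class_classes_in[OF that] pt[of "main_class \<gamma>"] H_classes_H[of "main_class \<gamma>"] by (auto simp: classes_in_def)
  have ptA: "pt A \<in> \<alpha>" "pt A \<in> H" "pt A \<in> A" "pt A \<noteq> pt (main_class \<alpha>)"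
  proof -
    show "pt A \<in> A" using pt AD(1) by blast
    then show "pt A \<in> \<alpha>" "pt A \<in> H" using \<alpha>(2) H_classes_H[OF AD(1)] by (auto simp: classes_in_def)
    show "pt A \<noteq> pt (main_class \<alpha>)"
      using H_classes_disjoint[OF AD(1) ptd(4)[OF \<alpha>(1)] AD(2)[OF \<alpha>(1)]] ptd(3)[OF \<alpha>(1)] \<open>pt A \<in> A\<close> by auto
  qed
  have e1: "e1 g = (if g = pt (main_class \<gamma>) then \<xi> \<gamma> else 0)" if "\<gamma> \<in> D" "g \<in> \<gamma>" for g \<gamma>
  proof -
    have "e1 g = (\<Sum>\<delta>\<in>D. if \<delta> = \<gamma> then (if g = pt (main_class \<gamma>) then \<xi> \<gamma> else 0) else 0)"
      unfolding e1_def
    proof (intro sum.cong HOL.refl)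
      fix \<delta> assume "\<delta> \<in> D"
      then show "(if g = pt (main_class \<delta>) then \<xi> \<delta> else 0) =
          (if \<delta> = \<gamma> then if g = pt (main_class \<gamma>) then \<xi> \<gamma> else 0 else 0)"
        using D_disjoint[of \<gamma> \<delta>] ptd(1)[of \<delta>] that by (cases "\<delta> = \<gamma>") auto
    qed
    then show ?thesis using finite_D that(1) by simp
  qed
  have e1_0: "e1 g = 0" if "g \<notin> main_class \<gamma>" "\<gamma> \<in> D" "g \<in> \<gamma>" for g \<gamma>
    using e1[OF that(2,3)] ptd(3)[OF that(2)] that(1) by auto
  have s1: "(\<Sum>g\<in>H \<inter> \<gamma>. e1 g) = 1 * \<xi> \<gamma>" if "\<gamma> \<in> D" for \<gamma>
  proof -
    have "(\<Sum>g\<in>H \<inter> \<gamma>. e1 g) = (\<Sum>g\<in>H \<inter> \<gamma>. if g = pt (main_class \<gamma>) then \<xi> \<gamma> else 0)"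
      using e1[OF that] by (intro sum.cong) auto
    then show ?thesis using finite_H ptd[OF that] by simp
  qed
  have s2: "(\<Sum>g\<in>H \<inter> \<gamma>. e2 g) = 1 * \<xi> \<gamma>" if "\<gamma> \<in> D" for \<gamma>
  proof (cases "\<gamma> = \<alpha>")
    case True
    have "(\<Sum>g\<in>H \<inter> \<alpha>. e2 g) = (\<Sum>g\<in>H \<inter> \<alpha>. (if g = pt A then 1 else 0) + (if g = pt (main_class \<alpha>) then \<xi> \<alpha> - 1 else 0))"
      using e1[OF \<alpha>(1)] ptA(4) by (intro sum.cong) (auto simp: e2_def)
    also have "\<dots> = 1 + (\<xi> \<alpha> - 1)"
      using finite_H ptd[OF \<alpha>(1)] ptA by (simp add: sum.distrib)
    finally show ?thesis using True \<xi>_pos[OF \<alpha>(1)] by simp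
  next
    case False
    have "e2 g = e1 g" if "g \<in> H \<inter> \<gamma>" for g
      using that D_disjoint[OF \<open>\<gamma> \<in> D\<close> \<alpha>(1) False] ptA(1) ptd(1)[OF \<alpha>(1)] by (auto simp: e2_def)
    then show ?thesis using s1[OF that] by simp
  qed
  have z1: "e1 g = 0" if "g \<notin> \<Union>D" for g unfolding e1_def using that ptd(1) by (intro sum.neutral) auto
  have z2: "e2 g = 0" if "g \<notin> \<Union>D" for g
    using that z1[OF that] ptA(1) ptd(1)[OF \<alpha>(1)] \<alpha>(1) by (auto simp: e2_def)
  note t1 = component_tuple_power_tuple[OF s1 z1] and t2 = component_tuple_power_tuple[OF s2 z2]
  have N: "0 < order G" using fin order_gt_0_iff_finite by blast
  have c1: "count_in B (power_tuple e1) = 0" if B: "B \<in> free_classes" for B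
  proof -
    obtain \<beta> where \<beta>: "\<beta> \<in> D" "B \<in> classes_in \<beta>" using H_classes_classes_in B free_classes_subset by blast
    have "e1 g = 0" if "g \<in> B" for g
    proof (rule e1_0[OF _ \<beta>(1)])
      show "g \<in> \<beta>" using \<beta>(2) that by (auto simp: classes_in_def)
      have "B \<noteq> main_class \<beta>" using B \<beta>(1) by (auto simp: free_classes_def)
      then show "g \<notin> main_class \<beta>"
        using H_classes_disjoint[of B "main_class \<beta>"] B free_classes_subset ptd(4)[OF \<beta>(1)] that by blast
    qed
    then show ?thesis by (simp add: count_in_power_tuple)
  qed
  have c2: "count_in B (power_tuple e2) = (if B = A then order G else 0)" if B: "B \<in> free_classes" for B
  proof -
    have Bd: "pt (main_class \<alpha>) \<notin> B"
      using H_classes_disjoint[of B "main_class \<alpha>"] B free_classes_subset ptd(3,4)[OF \<alpha>(1)] \<alpha>(1) by (auto simp: free_classes_def)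
    have "(\<Sum>g\<in>H \<inter> B. e1 g) = 0" using c1[OF B] N by (simp add: count_in_power_tuple)
    then have 0: "e1 g = 0" if "g \<in> H \<inter> B" for g using that finite_H by simp
    have "(\<Sum>g\<in>H \<inter> B. e2 g) = (\<Sum>g\<in>H \<inter> B. if g = pt A then 1 else 0)"
      using 0 Bd by (intro sum.cong) (auto simp: e2_def)
    also have "\<dots> = (if B = A then 1 else 0)"
      using finite_H ptA H_classes_disjoint[of B A] B free_classes_subset AD(1) by auto
    finally show ?thesis by (simp add: count_in_power_tuple)
  qed
  show ?thesis
    using t1 t2 c1 c2 N by (intro exI[of _ "order G * 1"] exI[of _ "power_tuple e1"] exI[of _ "power_tuple e2"]) auto
qed

lemma exists_nonempty_tuple: "\<exists>n t. component_tuple n t \<and> set t \<subseteq> H \<and> t \<noteq> []"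
proof -
  obtain n ms where ms: "component_tuple n ms" "0 < n" "generate G (set ms) = H"
    using exists_generating_tuple by blast
  have "length ms \<noteq> 0" using ms(1,2) xi_sum_pos by (simp add: component_tuple_def)
  moreover have "set ms \<subseteq> H" using ms(3) generate.incl[of _ "set ms" G] by blast
  ultimately show ?thesis using ms(1) by auto
qed

end

section \<open>The dimension of a stratum\<close>

context hurwitz_stratum
begin

text \<open>The first \<open>j\<close> of the \<Omega> + 1 coordinates, padded by zeros: index 0 is
  the length and index i > 0 the count in \<open>El ! (i - 1)\<close>. Hence \<open>j\<close> runs
  up to \<open>Suc (length El)\<close>.\<close>

definition weight :: "'a set list \<Rightarrow> nat \<Rightarrow> 'a list set \<Rightarrow> nat \<Rightarrow> nat" where
  "weight El j X i = (if i < j then if i = 0 then length (repr X) else count_in (El ! (i - 1)) (repr X) else 0)"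

lemma weight_mult:
  assumes El: "set El = free_classes" and j: "j \<le> Suc (length El)"
    and X: "X \<in> H_components" and Y: "Y \<in> H_components"
  shows "weight El j (X \<otimes>\<^bsub>C\<^esub> Y) = (\<lambda>i. weight El j X i + weight El j Y i)"
proof
  fix i
  obtain xs m where xs: "X = orb xs" "component_tuple m xs" "set xs \<subseteq> H" using X by (rule H_componentsE)
  obtain ys n where ys: "Y = orb ys" "component_tuple n ys" "set ys \<subseteq> H" using Y by (rule H_componentsE)
  have XY: "X \<otimes>\<^bsub>C\<^esub> Y = orb (xs @ ys)" unfolding xs(1) ys(1) by (rule orb_mult[OF xs(2) ys(2)])
  have c: "set xs \<subseteq> carrier G" "set ys \<subseteq> carrier G" using xs(2) ys(2) component_tuple_carrier by blast+
  have H: "set (xs @ ys) \<subseteq> H" using xs(3) ys(3) by simp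
  have "length (repr (orb (xs @ ys))) = length (repr (orb xs)) + length (repr (orb ys))"
    using c by (simp add: length_repr)
  moreover have "count_in A (repr (orb (xs @ ys))) = count_in A (repr (orb xs)) + count_in A (repr (orb ys))" if "A \<in> H_classes" for A
    using count_in_repr[OF H that] count_in_repr[OF xs(3) that] count_in_repr[OF ys(3) that] by simp
  moreover have "El ! (i - 1) \<in> H_classes" if "i < j" "i \<noteq> 0"
  proof -
    have "El ! (i - 1) \<in> set El" using that j by (intro nth_mem) simp
    then show ?thesis using El free_classes_subset by blast
  qed
  ultimately show "weight El j (X \<otimes>\<^bsub>C\<^esub> Y) i = weight El j X i + weight El j Y i"
    unfolding weight_def XY unfolding xs(1) ys(1) by simp
qed

lemma krull_dim_stratum:
  fixes K :: "('k, 'c) ring_scheme"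
  assumes "field K"
  shows "krull_dim (stratum K G D \<xi> H) = ereal (real (card free_classes + 1))"
proof -
  interpret A: monoid_algebra K C
    by (intro monoid_algebra.intro assms comm_monoid_Comp)
  let ?R = "monoid_ring K C"
  let ?I = "I_ideal K G D \<xi> H" and ?J = "I_star_ideal K G D \<xi> H"
  define Y where "Y = vanishing ?R ?J - vanishing ?R ?I"
  have dirac_I: "A.dirac X \<in> ?I \<longleftrightarrow> H \<subseteq> component_group G X"
    and dirac_J: "A.dirac X \<in> ?J \<longleftrightarrow> H \<subset> component_group G X" if "X \<in> carrier C" for X
    using that assms A.dirac_in_R[OF that] unfolding I_ideal_def I_star_ideal_def basis_span_def
    by (auto simp: A.dirac_def)
  have Y_iff: "P \<in> Y \<longleftrightarrow> primeideal P ?R \<and> ?J \<subseteq> P \<and> \<not> ?I \<subseteq> P" for P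
    unfolding Y_def vanishing_def Spec_def by blast
  have group_orb: "component_group G (orb gs) = generate G (set gs)" if "component_tuple n gs" for n gs
    using component_group_orbit component_tuple_carrier[OF that] by blast
  let ?chains = "{n. \<exists>P. (\<forall>i\<le>n. P i \<in> Y) \<and> (\<forall>i<n. P (Suc i) \<subset> P i)}"
  have dim: "krull_dim (stratum K G D \<xi> H) = (SUP n \<in> ?chains. ereal (real n))"
    unfolding stratum_def component_ring_def Let_def Y_def[symmetric]
    by (rule A.R.krull_dim_locally_closed[OF Y_def])
  have upper: "n \<le> card free_classes + 1" if chain: "n \<in> ?chains" for n
  proof -
    obtain P where P: "\<And>i. i \<le> n \<Longrightarrow> P i \<in> Y" "\<And>i. i < n \<Longrightarrow> P (Suc i) \<subset> P i"
      using chain by blast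
    have Pn: "primeideal (P n) ?R" "?J \<subseteq> P n" "\<not> ?I \<subseteq> P n" using P(1)[of n] Y_iff by auto
    interpret Pn: primeideal "P n" ?R by (rule Pn(1))
    \<comment> \<open>\<open>?I\<close> is spanned by components, so one of them, \<open>Z\<close>,
      escapes the smallest prime \<open>P n\<close>. Its group contains \<open>H\<close>, and cannot
      do so properly because \<open>?J\<close> lies in \<open>P n\<close>.\<close>
    obtain f where f: "f \<in> ?I" "f \<notin> P n" using Pn(3) by blast
    have fR: "f \<in> carrier ?R" and fI: "A.supp f \<subseteq> {X \<in> carrier C. H \<subseteq> component_group G X}"
      using f(1) unfolding I_ideal_def basis_span_def A.supp_def by auto
    obtain Z where Z: "Z \<in> A.supp f" "A.dirac Z \<notin> P n"
      using A.ideal_supp[OF Pn.is_ideal fR] f(2) by blast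
    then have ZC: "Z \<in> carrier C" "H \<subseteq> component_group G Z" using fI by auto
    then have ZH: "component_group G Z = H" using Z(2) Pn(2) dirac_J[OF ZC(1)] by blast
    obtain m ms where ms: "Z = orb ms" "component_tuple m ms" using ZC(1) unfolding carrier_Comp by blast
    have gen_ms: "generate G (set ms) = H" using ZH ms group_orb by simp
    \<comment> \<open>The dimension is given by decreasing chains, whereas
      \<open>prime_chain_length\<close> takes an increasing one; hence the index
      \<open>n - i\<close>.\<close>
    show ?thesis
    proof (rule A.prime_chain_length[of n "\<lambda>i. P (n - i)" Z H_components "\<lambda>X. length (repr X)"])
      show "primeideal (P (n - i)) ?R" if "i \<le> n" for i using P(1)[of "n - i"] Y_iff by simp
      show "P (n - i) \<subset> P (n - Suc i)" if "i < n" for i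
        using P(2)[of "n - Suc i"] that by (simp add: Suc_diff_Suc)
      show "Z \<in> carrier C" by (rule ZC(1))
      show "A.dirac Z \<notin> P (n - 0)" using Z(2) by simp
      show "H_components \<subseteq> carrier C" by (auto simp: H_components_def)
      \<comment> \<open>The product of such an \<open>X\<close> with \<open>Z\<close> has a group
        properly containing \<open>H\<close>, so it lies in \<open>?J\<close> and in the prime,
        while \<open>Z\<close> does not.\<close>
      show "A.dirac X \<in> P (n - 0)" if X: "X \<in> carrier C - H_components" for X
      proof -
        obtain k xs where xs: "X = orb xs" "component_tuple k xs" using X unfolding carrier_Comp by blast
        have "\<not> set xs \<subseteq> H" using X xs orb_in_H_components_iff[OF xs(2)] by blast
        moreover have "H \<subseteq> generate G (set (xs @ ms))"
          using gen_ms mono_generate[of "set ms" "set (xs @ ms)"] by auto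
        moreover have "set xs \<subseteq> generate G (set (xs @ ms))" by (auto intro: generate.incl)
        ultimately have "H \<subset> generate G (set (xs @ ms))" by blast
        moreover have XZ: "X \<otimes>\<^bsub>C\<^esub> Z = orb (xs @ ms)" unfolding xs(1) ms(1) by (rule orb_mult[OF xs(2) ms(2)])
        moreover have "X \<otimes>\<^bsub>C\<^esub> Z \<in> carrier C" using X ZC(1) by auto
        ultimately have "A.dirac (X \<otimes>\<^bsub>C\<^esub> Z) \<in> ?J"
          using dirac_J group_orb[OF component_tuple_append[OF xs(2) ms(2)]] by simp
        then have "A.dirac X \<otimes>\<^bsub>?R\<^esub> A.dirac Z \<in> P n"
          using Pn(2) A.dirac_mult[of X Z] X ZC(1) by auto
        then show ?thesis
          using Pn.I_prime[of "A.dirac X" "A.dirac Z"] Z(2) X ZC(1) by simp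
      qed
      show "length (repr (X \<otimes>\<^bsub>C\<^esub> X')) = length (repr X) + length (repr X')"
        if X: "X \<in> carrier C" "X' \<in> carrier C" for X X'
      proof -
        obtain xs ys k l where xy: "X = orb xs" "X' = orb ys" "component_tuple k xs" "component_tuple l ys"
          using X unfolding carrier_Comp by blast
        then show ?thesis
          using length_repr[of xs] length_repr[of ys] length_repr[of "xs @ ys"] component_tuple_carrier
          by (simp add: orb_mult[OF xy(3,4)])
      qed
      show "finite {Z \<otimes>\<^bsub>C\<^esub> X | X. X \<in> H_components \<and> length (repr X) \<le> L}" for L
        unfolding ms(1) by (rule count_bound(1)[OF ms(2) gen_ms])
      show "card {Z \<otimes>\<^bsub>C\<^esub> X | X. X \<in> H_components \<and> length (repr X) \<le> L}
          \<le> card {t. set t \<subseteq> carrier G \<and> length t \<le> order G * order G} * (L + 1) ^ (card free_classes + 1)" for L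
        unfolding ms(1) by (rule count_bound(2)[OF ms(2) gen_ms])
    qed
  qed
  obtain El where El: "set El = free_classes" "distinct El" using finite_distinct_list[OF finite_free_classes] by blast
  have card_free_classes: "card free_classes = length El" using El distinct_card by metis
  \<comment> \<open>\<open>j = 0\<close> uses no coordinate and gives the largest of these ideals;
    each further coordinate refines the weight and shrinks the ideal.\<close>
  define P where "P j = A.weight_ideal H_components (weight El j)" for j
  have prime: "primeideal (P j) ?R" if "j \<le> card free_classes + 1" for j
    unfolding P_def
  proof (rule A.primeideal_weight_ideal[where s = j])
    show "X \<otimes>\<^bsub>C\<^esub> X' \<in> H_components \<longleftrightarrow> X \<in> H_components \<and> X' \<in> H_components" if "X \<in> carrier C" "X' \<in> carrier C" for X X'
      by (rule mult_in_H_components_iff[OF that])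
    show "\<one>\<^bsub>C\<^esub> \<in> H_components" unfolding one_Comp using orb_in_H_components_iff[OF component_tuple_Nil] by simp
    show "weight El j (X \<otimes>\<^bsub>C\<^esub> X') = (\<lambda>i. weight El j X i + weight El j X' i)"
      if "X \<in> H_components" "X' \<in> H_components" for X X'
      by (rule weight_mult[OF El(1) _ that]) (use \<open>j \<le> card free_classes + 1\<close> card_free_classes in simp)
    show "weight El j X i = 0" if "j \<le> i" for X i using that by (simp add: weight_def)
  qed
  have PY: "P j \<in> Y" if j: "j \<le> card free_classes + 1" for j
  proof -
    interpret P: primeideal "P j" ?R by (rule prime[OF j])
    have dirac_P: "A.dirac X \<in> P j \<longleftrightarrow> X \<notin> H_components" if "X \<in> carrier C" for X
      unfolding P_def by (rule A.dirac_in_weight_ideal_iff[OF that])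
    have "?J \<subseteq> P j"
    proof
      fix f assume "f \<in> ?J"
      then have fR: "f \<in> carrier ?R" and fJ: "A.supp f \<subseteq> {X \<in> carrier C. H \<subset> component_group G X}"
        unfolding I_star_ideal_def basis_span_def A.supp_def by auto
      show "f \<in> P j"
      proof (rule A.ideal_supp[OF P.is_ideal fR])
        fix X assume "X \<in> A.supp f"
        then have "X \<in> carrier C" "H \<subset> component_group G X" using fJ by auto
        then show "A.dirac X \<in> P j" using dirac_P unfolding H_components_def by auto
      qed
    qed
    \<comment> \<open>A component with group exactly \<open>H\<close> lies in \<open>?I\<close> and
      in \<open>H_components\<close>, and elements of \<open>H_components\<close> are outside
      \<open>P j\<close>.\<close>
    moreover have "\<not> ?I \<subseteq> P j"
    proof -
      obtain n ms where ms: "component_tuple n ms" "generate G (set ms) = H"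
        using exists_generating_tuple by blast
      have Z: "orb ms \<in> carrier C" unfolding carrier_Comp using ms(1) by blast
      have "A.dirac (orb ms) \<in> ?I" using dirac_I[OF Z] group_orb[OF ms(1)] ms(2) by simp
      moreover have "orb ms \<in> H_components" unfolding H_components_def using Z group_orb[OF ms(1)] ms(2) by simp
      ultimately show ?thesis using dirac_P[OF Z] by blast
    qed
    ultimately show ?thesis using prime[OF j] Y_iff by blast
  qed
  have strict: "P (Suc j) \<subset> P j" if j: "j < card free_classes + 1" for j
  proof -
    \<comment> \<open>Forgetting coordinate \<open>j\<close> turns the finer weight into the coarser
      one.\<close>
    have sub: "P (Suc j) \<subseteq> P j"
      unfolding P_def
      by (rule A.weight_ideal_antimono[where h = "\<lambda>u i. if i < j then u i else 0"])
        (auto simp: weight_def)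
    \<comment> \<open>The difference of two such components lies in \<open>P j\<close> but not in
      \<open>P (Suc j)\<close>.\<close>
    have "\<exists>X\<in>H_components. \<exists>X'\<in>H_components. weight El j X = weight El j X' \<and> weight El (Suc j) X \<noteq> weight El (Suc j) X'"
    proof (cases j)
      case 0
      \<comment> \<open>The first coordinate to be added is the length, which separates a nonempty
        tuple from the empty one.\<close>
      obtain n t where t: "component_tuple n t" "set t \<subseteq> H" "t \<noteq> []" using exists_nonempty_tuple by blast
      have "length (repr (orb t)) \<noteq> length (repr (orb []))"
        using length_repr[OF component_tuple_carrier[OF t(1)]] length_repr[of "[]"] t(3) by simp
      then have "weight El 1 (orb t) 0 \<noteq> weight El 1 (orb []) 0" by (simp add: weight_def)
      moreover have "weight El 0 (orb t) = weight El 0 (orb [])" by (simp add: weight_def fun_eq_iff)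
      moreover have "orb t \<in> H_components" "orb [] \<in> H_components"
        using orb_in_H_components_iff[OF t(1)] orb_in_H_components_iff[OF component_tuple_Nil] t(2) by simp_all
      ultimately show ?thesis unfolding 0 One_nat_def
        by (intro bexI[of _ "orb t"] bexI[of _ "orb []"] conjI) auto
    next
      case (Suc k)
      \<comment> \<open>The new coordinate \<open>j = Suc k\<close> counts the entries in
        \<open>El ! k\<close>, so tuples separating that class are needed.\<close>
      have k: "k < length El" using j Suc card_free_classes by simp
      have "El ! k \<in> free_classes" using k El(1) nth_mem by blast
      from exists_separating_tuples[OF this] obtain n t1 t2 where
        t: "component_tuple n t1" "component_tuple n t2" "set t1 \<subseteq> H" "set t2 \<subseteq> H"
        "\<forall>B\<in>free_classes. count_in B t1 = count_in B t2 \<longleftrightarrow> B \<noteq> El ! k"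
        by (elim exE conjE)
      have cr: "count_in B (repr (orb t1)) = count_in B t1" "count_in B (repr (orb t2)) = count_in B t2" if "B \<in> free_classes" for B
        using count_in_repr[OF t(3), of B] count_in_repr[OF t(4), of B] that free_classes_subset by auto
      have len: "length (repr (orb t1)) = length (repr (orb t2))"
        using length_repr[OF component_tuple_carrier[OF t(1)]] length_repr[OF component_tuple_carrier[OF t(2)]] t(1,2)
        by (simp add: component_tuple_def)
      have "weight El j (orb t1) i = weight El j (orb t2) i" for i
      proof (cases "0 < i \<and> i < j")
        case True
        then have "i - 1 < k" using Suc by auto
        then have "El ! (i - 1) \<noteq> El ! k" "El ! (i - 1) \<in> free_classes"
          using k El nth_mem[of "i - 1" El] by (auto simp: nth_eq_iff_index_eq)
        then show ?thesis using cr bspec[OF t(5), of "El ! (i - 1)"] by (simp add: weight_def len)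
      qed (auto simp: weight_def len)
      moreover have "weight El (Suc j) (orb t1) j \<noteq> weight El (Suc j) (orb t2) j"
        using Suc cr \<open>El ! k \<in> free_classes\<close> bspec[OF t(5), of "El ! k"] by (simp add: weight_def)
      moreover have "orb t1 \<in> H_components" "orb t2 \<in> H_components"
        using orb_in_H_components_iff[OF t(1)] orb_in_H_components_iff[OF t(2)] t(3,4) by simp_all
      ultimately show ?thesis
        by (intro bexI[of _ "orb t1"] bexI[of _ "orb t2"] conjI ext) auto
    qed
    then obtain X X' where X: "X \<in> H_components" "X' \<in> H_components" "weight El j X = weight El j X'"
      "weight El (Suc j) X \<noteq> weight El (Suc j) X'" by blast
    have "X \<in> carrier C" "X' \<in> carrier C" using X(1,2) by (auto simp: H_components_def)
    note iff = A.dirac_diff_in_weight_ideal_iff[OF this X(1,2)]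
    have "A.dirac X \<ominus>\<^bsub>?R\<^esub> A.dirac X' \<in> P j" "A.dirac X \<ominus>\<^bsub>?R\<^esub> A.dirac X' \<notin> P (Suc j)"
      unfolding P_def iff using X(3,4) by simp_all
    then show ?thesis using sub by blast
  qed
  have "card free_classes + 1 \<in> ?chains" using PY strict by blast
  then have "ereal (real (card free_classes + 1)) \<le> (SUP n \<in> ?chains. ereal (real n))" by (rule SUP_upper)
  moreover have "(SUP n \<in> ?chains. ereal (real n)) \<le> ereal (real (card free_classes + 1))"
    using upper by (intro SUP_least) (simp only: ereal_less_eq of_nat_le_iff)
  ultimately show ?thesis unfolding dim by (rule antisym[rotated])
qed

end

theorem theorem1p2:
  fixes G :: "('g, 'a) monoid_scheme"
    and K :: "('k, 'b) ring_scheme"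
    and D :: "'g set set"
    and \<xi> :: "'g set \<Rightarrow> nat"
    and H :: "'g set"
  assumes "group G" and "finite (carrier G)"
    and "D \<noteq> {}" and "D \<subseteq> conjugacy_classes G - {{\<one>\<^bsub>G\<^esub>}}"
    and "\<forall>\<gamma>\<in>D. 0 < \<xi> \<gamma>"
    and "field K" and "\<not> ring_char K dvd order G"
    and "D_generated G D H" and "H \<noteq> {\<one>\<^bsub>G\<^esub>}"
  shows "krull_dim (stratum K G D \<xi> H) = ereal (real_of_int (splitting_number G D H + 1))"
proof -
  interpret hurwitz_stratum G D \<xi> H
    using assms by (intro hurwitz_stratum.intro hurwitz_stratum_axioms.intro) auto
  show ?thesis using krull_dim_stratum[OF assms(6)] by (simp add: splitting_number_eq)
qed

end
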